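(* Let $W$ be a reflexive Banach space with a scaling $(u,t) \mapsto u_t$ (satisfying $(A_1)$–$(A_5)$, with exponent $\sigma > 0$), let $A_\sigma$ be a scaled operator satisfying $(A_6)$, $(A_7)$, and $(A_{10})$, and let $f \in C(W,W^* )$ be an odd potential operator that maps bounded sets into bounded sets and satisfies $(f_1)$–$(f_4)$, with exponent $\gamma \ne \sigma$. Then the equation $$A_\sigma(u) = f(u) \quad \text{in } W^*$$ has an infinite sequence of nontrivial solutions $$\overline{u}_k = u^k_{\mu_k^{-1/(\sigma - \gamma)}}$$ (the image of $u^k$ under the scaling with parameter $t = \mu_k^{-1/(\sigma-\gamma)}$), where $u^k \in \mathcal{M}$, $\mu_k > 0$, and $\mu_k \nearrow \infty$. Moreover, $$E(\overline{u}_k) = \left(1 - \frac{\sigma}{\gamma}\right) \mu_k^{-\sigma/(\sigma - \gamma)};$$ in particular, $E(\overline{u}_k) < 0$ and $E(\overline{u}_k) \nearrow 0$ if $\gamma < \sigma$, while $E(\overline{u}_k) > 0$ and $E(\overline{u}_k) \nearrow \infty$ if $\gamma > \sigma$.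
   Context: $W^*$ is the dual of $W$; $\nearrow$ denotes nondecreasing convergence. A scaling in $W$ is a continuous mapping $W \times [0,\infty) \to W$, $(u,t) \mapsto u_t$ satisfying: $(A_1)$ $(u_{t_1})_{t_2} = u_{t_1 t_2}$ for all $u \in W$, $t_1,t_2 \ge 0$; $(A_2)$ $(\tau u)_t = \tau u_t$ for all $u \in W$, $\tau \in \mathbb{R}$, $t \ge 0$; $(A_3)$ $u_0 = 0$ and $u_1 = u$ for all $u \in W$; $(A_4)$ $u_t$ is bounded on bounded sets in $W \times [0,\infty)$; $(A_5)$ there exists $\sigma > 0$ such that $\|u_t\| = O(t^\sigma)$ as $t \to \infty$, uniformly in $u$ on bounded sets. An operator $g \in C(W,W^* )$ is a potential operator if there is a functional $G \in C^1(W,\mathbb{R})$, a potential for $g$, with Fréchet derivative $G' = g$; potentials are normalized by $G(0) = 0$. A scaled operator is an odd potential operator $A_\sigma \in C(W,W^* )$ that maps bounded sets into bounded sets and satisfies $A_\sigma(u_t) v_t = t^\sigma A_\sigma(u) v$ for all $u, v \in W$, $t \ge 0$ (with the same $\sigma$ as in $(A_5)$). Its potential is $I_\sigma(u) = \int_0^1 A_\sigma(\tau u) u\, d\tau$. Assumptions on $A_\sigma$: $(A_6)$ $A_\sigma(u) u > 0$ for all $u \in W \setminus \{0\}$; $(A_7)$ every sequence $(u_j)$ in $W$ such that $u_j \rightharpoonup u$ and $A_\sigma(u_j)(u_j - u) \to 0$ has a subsequence that converges strongly to $u$; $(A_{10})$ $I_\sigma$ is coercive, i.e., $I_\sigma(u)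 \to \infty$ as $\|u\| \to \infty$. Assumptions on $f$: $(f_1)$ there exists $\gamma \ne \sigma$ such that $f(u_t) v_t = t^\gamma f(u) v$ for all $u, v \in W$ and $t \ge 0$; $(f_2)$ $f(u) u > 0$ for all $u \in W \setminus \{0\}$; $(f_3)$ if $u_j \rightharpoonup u$ in $W$, then $f(u_j) \to f(u)$ in $W^*$; $(f_4)$ for any $\mu \in \mathbb{R}$, every solution $u$ of the equation $A_\sigma(u) = \mu f(u)$ satisfies the scaling identity $\sigma I_\sigma(u) = \gamma \mu F(u)$, where $F(u) = \int_0^1 f(\tau u) u\, d\tau$ is the potential of $f$. Finally, $\mathcal{M} = \{u \in W : I_\sigma(u) = 1\}$ and $E(u) = I_\sigma(u) - F(u)$, $u \in W$.
   Formalization: The space W is additionally assumed to be infinite-dimensional; in a finite-dimensional W the set M is compact, so the eigenvalues μ_k are bounded (or W = 0 has no nontrivial solution) and the claim always fails. *)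

theory Defs
  imports "HOL-Analysis.Analysis"
begin

text \<open>The dual of \<open>'a\<close> is \<open>'a \<Rightarrow>\<^sub>L real\<close> with the operator norm.\<close>

text \<open>Surjectivity of the canonical embedding \<open>x \<mapsto> (\<phi> \<mapsto> \<phi> x)\<close> into the bidual.\<close>

definition reflexive_space :: "'a::real_normed_vector itself \<Rightarrow> bool" where
  "reflexive_space _ \<longleftrightarrow>
    (\<forall>\<Phi> :: ('a \<Rightarrow>\<^sub>L real) \<Rightarrow>\<^sub>L real. \<exists>x::'a. \<forall>\<phi>. blinfun_apply \<Phi> \<phi> = blinfun_apply \<phi> x)"

definition infinite_dimensional :: "'a::real_vector itself \<Rightarrow> bool" where
  "infinite_dimensional _ \<longleftrightarrow> (\<nexists>B::'a set. finite B \<and> span B = UNIV)"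

definition weakly_converges :: "(nat \<Rightarrow> 'a::real_normed_vector) \<Rightarrow> 'a \<Rightarrow> bool" where
  "weakly_converges u l \<longleftrightarrow>
    (\<forall>\<phi> :: 'a \<Rightarrow>\<^sub>L real. (\<lambda>j. blinfun_apply \<phi> (u j)) \<longlonglongrightarrow> blinfun_apply \<phi> l)"

text \<open>\<open>S u t\<close> stands for \<open>u\<^sub>t\<close>; only its values at \<open>t \<ge> 0\<close> matter.
  The last clause is the growth bound \<open>\<parallel>u\<^sub>t\<parallel> = O(t\<^sup>\<sigma>)\<close> as \<open>t \<rightarrow> \<infinity>\<close>,
  uniform on bounded sets.\<close>

definition is_scaling :: "real \<Rightarrow> ('a::real_normed_vector \<Rightarrow> real \<Rightarrow> 'a) \<Rightarrow> bool" where
  "is_scaling \<sigma> S \<longleftrightarrow>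
    continuous_on (UNIV \<times> {0..}) (\<lambda>(u, t). S u t) \<and>
    (\<forall>u. \<forall>t1\<ge>0. \<forall>t2\<ge>0. S (S u t1) t2 = S u (t1 * t2)) \<and>
    (\<forall>u \<tau>. \<forall>t\<ge>0. S (\<tau> *\<^sub>R u) t = \<tau> *\<^sub>R S u t) \<and>
    (\<forall>u. S u 0 = 0 \<and> S u 1 = u) \<and>
    (\<forall>B \<subseteq> UNIV \<times> {0..}. bounded B \<longrightarrow> bounded ((\<lambda>(u, t). S u t) ` B)) \<and>
    \<sigma> > 0 \<and>
    (\<forall>B. bounded B \<longrightarrow>
      (\<exists>C. eventually (\<lambda>t. \<forall>u\<in>B. norm (S u t) \<le> C * t powr \<sigma>) at_top))"

text \<open>\<open>G\<close> is automatically of class \<open>C\<^sup>1\<close>, its derivative \<open>g\<close> being continuous.\<close>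

definition potential_operator :: "('a::real_normed_vector \<Rightarrow> 'a \<Rightarrow>\<^sub>L real) \<Rightarrow> bool" where
  "potential_operator g \<longleftrightarrow>
    continuous_on UNIV g \<and>
    (\<exists>G :: 'a \<Rightarrow> real. G 0 = 0 \<and> (\<forall>u. (G has_derivative blinfun_apply (g u)) (at u)))"

definition odd_bounded_potential_operator ::
    "('a::real_normed_vector \<Rightarrow> 'a \<Rightarrow>\<^sub>L real) \<Rightarrow> bool" where
  "odd_bounded_potential_operator g \<longleftrightarrow>
    potential_operator g \<and> (\<forall>u. g (- u) = - g u) \<and> (\<forall>B. bounded B \<longrightarrow> bounded (g ` B))"

text \<open>At \<open>t = 0\<close> both sides vanish: \<open>0 powr s = 0\<close> and \<open>S v 0 = 0\<close>.\<close>

definition scaling_homogeneous ::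
    "('a::real_normed_vector \<Rightarrow> real \<Rightarrow> 'a) \<Rightarrow> real \<Rightarrow> ('a \<Rightarrow> 'a \<Rightarrow>\<^sub>L real) \<Rightarrow> bool" where
  "scaling_homogeneous S s g \<longleftrightarrow>
    (\<forall>u v. \<forall>t\<ge>0. blinfun_apply (g (S u t)) (S v t) = t powr s * blinfun_apply (g u) v)"

definition scaled_operator ::
    "('a::real_normed_vector \<Rightarrow> real \<Rightarrow> 'a) \<Rightarrow> real \<Rightarrow> ('a \<Rightarrow> 'a \<Rightarrow>\<^sub>L real) \<Rightarrow> bool" where
  "scaled_operator S \<sigma> A \<longleftrightarrow>
    odd_bounded_potential_operator A \<and> scaling_homogeneous S \<sigma> A"

definition potential :: "('a::real_normed_vector \<Rightarrow> 'a \<Rightarrow>\<^sub>L real) \<Rightarrow> 'a \<Rightarrow> real" where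
  "potential g u = integral {0..1} (\<lambda>\<tau>. blinfun_apply (g (\<tau> *\<^sub>R u)) u)"

definition unit_level :: "('a::real_normed_vector \<Rightarrow> 'a \<Rightarrow>\<^sub>L real) \<Rightarrow> 'a set" where
  "unit_level A = {u. potential A u = 1}"

definition energy ::
    "('a::real_normed_vector \<Rightarrow> 'a \<Rightarrow>\<^sub>L real) \<Rightarrow> ('a \<Rightarrow> 'a \<Rightarrow>\<^sub>L real) \<Rightarrow> 'a \<Rightarrow> real" where
  "energy A f u = potential A u - potential f u"

end

theory Submission
  imports Defs "HOL-Homology.Simplices" "HOL-Library.Diagonal_Subsequence"
begin

text \<open>
  Write \<open>I\<close> and \<open>F\<close> for the potentials of \<open>A\<close> and \<open>f\<close>, and \<open>M\<close> for the level set \<open>I = 1\<close>.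
  If \<open>u \<in> M\<close> satisfies \<open>A u = \<mu> f u\<close>, then moving \<open>u\<close> along the scaling by
  \<open>t = \<mu> powr (- 1 / (\<sigma> - \<gamma>))\<close> turns it into a solution of \<open>A v = f v\<close>, whose energy is read off
  from the homogeneity of \<open>I\<close> and \<open>F\<close> and from the identity \<open>\<sigma> = \<gamma> \<mu> F u\<close>.  By the same identity
  the eigenvalue is large exactly when \<open>F u\<close> is small, so it suffices to find, for every \<open>d > 0\<close>,
  an eigenvector in \<open>M\<close> with \<open>F u \<le> d\<close> (\<open>exists_critical_point_below\<close>); an increasing unbounded
  sequence of eigenvalues is then selected recursively.

  Such an eigenvector is found by a Galerkin argument that needs neither a flow nor a genus.
  Since \<open>f\<close> is completely continuous and the space is reflexive, \<open>f\<close> maps balls to totally bounded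
  sets, so finitely many functionals \<open>\<phi> 0, \<dots>, \<phi> (m - 1)\<close> have no common zero on the part of \<open>M\<close>
  where \<open>F \<ge> d / 2\<close>.  Fix an \<open>(m + 1)\<close>-dimensional subspace and let \<open>\<epsilon> > 0\<close> be the minimum of \<open>F\<close>
  on its intersection with \<open>M\<close>.  If, in a larger finite-dimensional subspace, \<open>F\<close> restricted to \<open>M\<close>
  had no critical point at the levels between \<open>\<epsilon>\<close> and \<open>d\<close>, then finitely many odd steps along the
  difference of the normalized gradients of \<open>F\<close> and \<open>I\<close>, each followed by radial projection back to
  \<open>M\<close>, would push the \<open>m\<close>-dimensional sphere into \<open>F \<ge> d / 2\<close> (\<open>odd_deformation\<close>); the functionals
  \<open>\<phi> i\<close> would then give \<open>m\<close> odd continuous functions on that sphere without a common zero,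
  contradicting the Borsuk--Ulam theorem.  So every large finite-dimensional subspace contains a
  critical point at a level in \<open>[\<epsilon>, d]\<close>.

  The subspaces are enlarged step by step, adding each critical point found and a vector on which its
  residual \<open>A u - \<mu> f u\<close> is almost attained.  The critical points have a weak limit, nonzero because
  \<open>F \<ge> \<epsilon>\<close>; the compactness condition on \<open>A\<close> makes the convergence strong along a subsequence.  The
  residual of the limit vanishes on all the subspaces, in particular on the almost norming vectors,
  hence it is zero.

  The Borsuk--Ulam theorem \<open>borsuk_ulam\<close> is proved with singular chains.  The octahedral sphere
  carries a \<open>j\<close>-chain \<open>c j\<close> for every \<open>j\<close> up to its dimension such that the boundary of \<open>c (Suc j)\<close> is
  \<open>c j \<plusminus> a (c j)\<close>, where \<open>a\<close> is the antipodal map.  After fine subdivision every vertex is labelled by the index and sign of a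
  component of the map that is bounded away from zero there.  By a variant of Ky Fan's lemma, the
  number modulo two of alternating simplices in \<open>c j\<close> and \<open>a (c j)\<close> together does not depend on \<open>j\<close>;
  it is odd for \<open>j = 0\<close>, but zero as soon as \<open>j\<close> reaches the number of components.

  Reflexivity is used in the form of weak sequential compactness of bounded sets
  (\<open>weak_sequential_compactness\<close>), which rests on the Hahn--Banach theorem and on Tychonoff's theorem.
\<close>

section \<open>Alternating label patterns\<close>

text \<open>
  The elements of \<open>K\<close> carry labels consisting of a magnitude \<open>mag\<close> and a sign \<open>sg\<close>.  Only the
  labels of magnitude less than \<open>k\<close> are considered: the predicate says that each such magnitude
  occurs at most once and that the signs, read from the largest magnitude downwards, alternate
  beginning with \<open>s\<close>.
\<close>

primrec alternating :: "('v \<Rightarrow> nat) \<Rightarrow> ('v \<Rightarrow> bool) \<Rightarrow> nat \<Rightarrow> bool \<Rightarrow> 'v set \<Rightarrow> bool" where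
  "alternating mag sg 0 s K = True"
| "alternating mag sg (Suc k) s K =
     (if \<forall>v\<in>K. mag v \<noteq> k then alternating mag sg k s K
      else (\<exists>v. {v\<in>K. mag v = k} = {v} \<and> sg v = s) \<and> alternating mag sg k (\<not> s) K)"

lemma alternating_Suc_none:
  "\<forall>v\<in>K. mag v \<noteq> k \<Longrightarrow> alternating mag sg (Suc k) s K = alternating mag sg k s K"
  by simp

lemma alternating_Suc_one:
  assumes "{v\<in>K. mag v = k} = {v}"
  shows "alternating mag sg (Suc k) s K \<longleftrightarrow> sg v = s \<and> alternating mag sg k (\<not> s) K"
proof -
  have "\<not> (\<forall>v\<in>K. mag v \<noteq> k)" using assms by blast
  then show ?thesis using assms by (simp only: alternating.simps if_False) simp
qed

lemma alternating_cong:
  assumes "\<And>v. v \<in> K \<Longrightarrow> mag v < k \<Longrightarrow> v \<in> L" "\<And>v. v \<in> L \<Longrightarrow> mag v < k \<Longrightarrow> v \<in> K"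
  shows "alternating mag sg k s K = alternating mag sg k s L"
  using assms
proof (induction k arbitrary: s)
  case (Suc k)
  have "{v\<in>K. mag v = k} = {v\<in>L. mag v = k}" using Suc.prems by auto
  moreover have "alternating mag sg k s K = alternating mag sg k s L" for s
    by (rule Suc.IH) (use Suc.prems in auto)
  moreover have "(\<forall>v\<in>K. mag v \<noteq> k) \<longleftrightarrow> (\<forall>v\<in>L. mag v \<noteq> k)" using Suc.prems by auto
  ultimately show ?case by simp
qed simp

lemma alternating_image:
  assumes "inj_on p K"
  shows "alternating mag sg k s (p ` K) = alternating (mag \<circ> p) (sg \<circ> p) k s K"
proof (induction k arbitrary: s)
  case (Suc k)
  have eq: "{v \<in> p ` K. mag v = k} = p ` {v\<in>K. (mag \<circ> p) v = k}" by auto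
  have "(\<exists>v. p ` {v\<in>K. (mag \<circ> p) v = k} = {v} \<and> sg v = s) \<longleftrightarrow>
        (\<exists>v. {v\<in>K. (mag \<circ> p) v = k} = {v} \<and> (sg \<circ> p) v = s)" (is "?l = ?r")
  proof
    assume ?l
    then obtain v where v: "p ` {v\<in>K. (mag \<circ> p) v = k} = {v}" "sg v = s"
      by (elim exE conjE)
    have "v \<in> p ` {v\<in>K. (mag \<circ> p) v = k}" using v(1) by simp
    then obtain w where w: "w \<in> K" "mag (p w) = k" "p w = v" by auto
    have "{v\<in>K. (mag \<circ> p) v = k} = {w}"
    proof -
      have "x = w" if "x \<in> K" "mag (p x) = k" for x
      proof -
        have "p x \<in> p ` {v\<in>K. (mag \<circ> p) v = k}" using that by simp
        then have "p x = v" using v(1) by simp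
        then show ?thesis using inj_onD[OF assms, of x w] w that by simp
      qed
      then show ?thesis unfolding o_apply using w(1,2) by blast
    qed
    with v(2) w show ?r by (intro exI[of _ w]) simp
  next
    assume ?r
    then obtain v where "{v\<in>K. (mag \<circ> p) v = k} = {v}" "(sg \<circ> p) v = s"
      by (elim exE conjE)
    then show ?l by (intro exI[of _ "p v"]) (simp only: image_insert image_empty o_apply simp_thms)
  qed
  moreover have "(\<forall>v\<in>p ` K. mag v \<noteq> k) \<longleftrightarrow> (\<forall>v\<in>K. (mag \<circ> p) v \<noteq> k)" by auto
  ultimately show ?case using Suc.IH by (simp only: eq alternating.simps)
qed simp

lemma alternating_inj_on:
  assumes "alternating mag sg k s K"
  shows "inj_on mag {v\<in>K. mag v < k}"
  using assms
proof (induction k arbitrary: s)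
  case (Suc k)
  have IH: "inj_on mag {v\<in>K. mag v < k}"
    using Suc.IH Suc.prems by (cases "\<forall>v\<in>K. mag v \<noteq> k") auto
  have one: "v = w" if "v \<in> K" "w \<in> K" "mag v = k" "mag w = k" for v w
  proof -
    have "\<not> (\<forall>v\<in>K. mag v \<noteq> k)" using that by blast
    then obtain x where "{v\<in>K. mag v = k} = {x}"
      using Suc.prems by (simp only: alternating.simps if_False) blast
    then show ?thesis using that by (metis (mono_tags, lifting) mem_Collect_eq singletonD)
  qed
  show ?case
  proof (rule inj_onI)
    fix v w assume "v \<in> {v\<in>K. mag v < Suc k}" "w \<in> {v\<in>K. mag v < Suc k}" "mag v = mag w"
    then show "v = w"
      using one inj_onD[OF IH, of v w] by (cases "mag v = k") auto
  qed
qed (simp add: inj_on_def)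

lemma alternating_card_le:
  assumes "alternating mag sg m s K" "\<And>v. v \<in> K \<Longrightarrow> mag v < m"
  shows "card K \<le> m"
proof -
  have "{v\<in>K. mag v < m} = K" using assms(2) by auto
  then have "inj_on mag K" using alternating_inj_on[OF assms(1)] by simp
  then have "card K = card (mag ` K)" by (simp add: card_image)
  also have "\<dots> \<le> card {..<m}" using assms(2) by (intro card_mono) auto
  finally show ?thesis by simp
qed

declare alternating.simps(2) [simp del]

text \<open>
  The combinatorial core of Ky Fan's lemma: if no two labels are complementary (same magnitude and
  different signs), then the number of ways to reach an alternating pattern by removing one element
  has the parity of the number of signs with which the whole set alternates.
\<close>

lemma alternating_boundary:
  fixes K :: "'b set"
  assumes fin: "finite K"
    and nocomp: "\<And>v w. v \<in> K \<Longrightarrow> w \<in> K \<Longrightarrow> mag v = mag w \<Longrightarrow> sg v = sg w"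
  shows "even (card {v\<in>K. mag v < k \<and> alternating mag sg k s (K - {v})}
               + of_bool (alternating mag sg k s K) + of_bool (alternating mag sg k (\<not> s) K))"
proof (induction k arbitrary: s)
  case (Suc k)
  let ?C = "{v\<in>K. mag v = k}"
  let ?N = "\<lambda>k s. {v\<in>K. mag v < k \<and> alternating mag sg k s (K - {v})}"
  have split: "?N (Suc k) s = {v\<in>?C. alternating mag sg (Suc k) s (K - {v})}
       \<union> {v\<in>K. mag v < k \<and> alternating mag sg (Suc k) s (K - {v})}"
    by (auto simp: less_Suc_eq)
  have cardsplit: "card (?N (Suc k) s) = card {v\<in>?C. alternating mag sg (Suc k) s (K - {v})}
       + card {v\<in>K. mag v < k \<and> alternating mag sg (Suc k) s (K - {v})}"
    unfolding split by (rule card_Un_disjoint) (use fin in auto)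
  have low: "{w\<in>K - {v}. mag w = k} = ?C" if "mag v < k" for v
    using that by auto
  have drop: "alternating mag sg k s' (K - {v}) = alternating mag sg k s' K" if "mag v = k" for s' v
    by (rule alternating_cong) (use that in auto)
  consider "?C = {}" | v where "?C = {v}" | v w where "v \<in> ?C" "w \<in> ?C" "v \<noteq> w" by blast
  then show ?case
  proof cases
    case 1
    have no: "\<forall>w\<in>K. mag w \<noteq> k" using 1 by auto
    then have "alternating mag sg (Suc k) s' (K - {v}) = alternating mag sg k s' (K - {v})" for s' v
      using no by (intro alternating_Suc_none) auto
    then have 2: "{v\<in>K. mag v < k \<and> alternating mag sg (Suc k) s (K - {v})} = ?N k s"
      by simp
    have 3: "?N (Suc k) s = ?N k s" using 2 split 1 by simp
    have "alternating mag sg (Suc k) s' K = alternating mag sg k s' K" for s'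
      using no by (rule alternating_Suc_none)
    with Suc.IH[of s] 3 show ?thesis by simp
  next
    case (2 v)
    have mv: "mag v = k" and vK: "v \<in> K" using 2 by auto
    have rem: "alternating mag sg (Suc k) s (K - {v}) = alternating mag sg k s K"
    proof -
      have "\<forall>w\<in>K - {v}. mag w \<noteq> k" using 2 by auto
      then show ?thesis using drop[OF mv] alternating_Suc_none by metis
    qed
    have c1: "card {v\<in>?C. alternating mag sg (Suc k) s (K - {v})} = of_bool (alternating mag sg k s K)"
    proof -
      have "{v\<in>?C. alternating mag sg (Suc k) s (K - {v})} = (if alternating mag sg k s K then {v} else {})"
        unfolding 2 using rem by auto
      then show ?thesis by simp
    qed
    have later: "alternating mag sg (Suc k) s (K - {w}) = (sg v = s \<and> alternating mag sg k (\<not> s) (K - {w}))"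
      if "mag w < k" for w
      by (rule alternating_Suc_one) (use low[OF that] 2 in simp)
    have whole: "alternating mag sg (Suc k) s' K = (sg v = s' \<and> alternating mag sg k (\<not> s') K)" for s'
      by (rule alternating_Suc_one) (use 2 in simp)
    show ?thesis
    proof (cases "sg v = s")
      case True
      have "{v\<in>K. mag v < k \<and> alternating mag sg (Suc k) s (K - {v})} = ?N k (\<not> s)"
        using later True by auto
      then have "card (?N (Suc k) s) = of_bool (alternating mag sg k s K) + card (?N k (\<not> s))"
        using cardsplit c1 by simp
      with Suc.IH[of "\<not> s"] whole[of s] whole[of "\<not> s"] True show ?thesis
        by (cases "alternating mag sg k s K"; cases "alternating mag sg k (\<not> s) K") simp_all
    next
      case False
      have "{v\<in>K. mag v < k \<and> alternating mag sg (Suc k) s (K - {v})} = {}"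
        using later False by auto
      then have "card (?N (Suc k) s) = of_bool (alternating mag sg k s K)"
        using cardsplit c1 by (simp only: card.empty add_0_right)
      with whole[of s] whole[of "\<not> s"] False show ?thesis
        by auto
    qed
  next
    case (3 v w)
    have no: "\<not> alternating mag sg (Suc k) s' K" for s'
      using alternating_inj_on[of mag sg "Suc k" s' K] 3 by (auto simp: inj_on_def)
    have l0: "{v\<in>K. mag v < k \<and> alternating mag sg (Suc k) s (K - {v})} = {}"
    proof -
      have False if "x \<in> K" "mag x < k" "alternating mag sg (Suc k) s (K - {x})" for x
        using alternating_inj_on[OF that(3)] 3 that by (auto simp: inj_on_def)
      then show ?thesis by blast
    qed
    \<comment> \<open>A removal helps only if \<open>v\<close> and \<open>w\<close> are the whole level, and then both removals help equally.\<close>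
    have sgeq: "sg x = sg y" if "x \<in> ?C" "y \<in> ?C" for x y using nocomp that by simp
    have "even (card {v\<in>?C. alternating mag sg (Suc k) s (K - {v})})"
    proof (cases "?C = {v, w}")
      case True
      have a: "{x\<in>K - {v}. mag x = k} = {w}" "{x\<in>K - {w}. mag x = k} = {v}" using True 3 by auto
      have "alternating mag sg (Suc k) s (K - {v}) = (sg w = s \<and> alternating mag sg k (\<not> s) K)"
        using alternating_Suc_one[OF a(1)] drop[of v] 3 by simp
      moreover have "alternating mag sg (Suc k) s (K - {w}) = (sg v = s \<and> alternating mag sg k (\<not> s) K)"
        using alternating_Suc_one[OF a(2)] drop[of w] 3 by simp
      ultimately have "alternating mag sg (Suc k) s (K - {v}) = alternating mag sg (Suc k) s (K - {w})"
        using sgeq[of v w] 3 by simp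
      then have "{v\<in>?C. alternating mag sg (Suc k) s (K - {v})} = {v, w}
         \<or> {v\<in>?C. alternating mag sg (Suc k) s (K - {v})} = {}"
        unfolding True by auto
      moreover have "even (card {v, w})" "even (card ({} :: 'b set))" using \<open>v \<noteq> w\<close> by simp_all
      ultimately show ?thesis by (elim disjE) (simp_all only:)
    next
      case False
      then obtain x where x: "x \<in> ?C" "x \<noteq> v" "x \<noteq> w" using 3 by blast
      have "\<not> alternating mag sg (Suc k) s (K - {y})" if "y \<in> ?C" for y
      proof
        assume "alternating mag sg (Suc k) s (K - {y})"
        then have inj: "inj_on mag {u\<in>K - {y}. mag u < Suc k}" by (rule alternating_inj_on)
        obtain p q where "p \<in> ?C" "q \<in> ?C" "p \<noteq> q" "p \<noteq> y" "q \<noteq> y"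
          using x 3 by metis
        with inj show False by (auto simp: inj_on_def)
      qed
      then have "{v\<in>?C. alternating mag sg (Suc k) s (K - {v})} = {}" by blast
      then show ?thesis by (simp only: card.empty) simp
    qed
    with cardsplit have "even (card (?N (Suc k) s))"
      unfolding l0 card.empty by simp
    then show ?thesis using no by simp
  qed
qed simp

lemma alternating_empty: "alternating mag sg k s {}"
  by (induction k arbitrary: s) (simp_all add: alternating_Suc_none)

lemma alternating_neg:
  "alternating mag (\<lambda>v. \<not> sg v) k s K = alternating mag sg k (\<not> s) K"
proof (induction k arbitrary: s)
  case (Suc k)
  have *: "((\<not> sg v) = s) = (sg v = (\<not> s))" for v by (cases s) simp_all
  show ?case unfolding alternating.simps(2) Suc.IH * ..
qed simp

section \<open>Counting alternating singular simplices modulo two\<close>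

text \<open>The image of the \<open>i\<close>-th vertex of the standard simplex under a singular simplex.\<close>

definition simplex_vertex :: "((nat \<Rightarrow> real) \<Rightarrow> 'a) \<Rightarrow> nat \<Rightarrow> 'a" where
  "simplex_vertex f i = f (\<lambda>j. if j = i then 1 else 0)"

text \<open>The order embedding of the vertices of the \<open>k\<close>-th face: it leaves out \<open>k\<close>.\<close>

definition skip :: "nat \<Rightarrow> nat \<Rightarrow> nat" where
  "skip k j = (if j < k then j else Suc j)"

lemma skip_image: "k \<le> Suc p \<Longrightarrow> skip k ` {..p} = {..Suc p} - {k}"
proof -
  assume k: "k \<le> Suc p"
  have "x \<in> skip k ` {..p}" if "x \<le> Suc p" "x \<noteq> k" for x
  proof (cases "x < k")
    case True
    then show ?thesis using k by (intro image_eqI[of _ _ x]) (auto simp: skip_def)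
  next
    case False
    then show ?thesis using that by (intro image_eqI[of _ _ "x - 1"]) (auto simp: skip_def)
  qed
  then show ?thesis using k by (auto simp: skip_def)
qed

lemma inj_skip: "inj_on (skip k) A"
  by (auto simp: inj_on_def skip_def split: if_splits)

lemma simplex_vertex_in_topspace:
  assumes "singular_simplex p X f" "i \<le> p"
  shows "simplex_vertex f i \<in> topspace X"
proof -
  have "f \<in> standard_simplex p \<rightarrow> topspace X"
    using assms(1) by (auto simp: singular_simplex_def continuous_map_def)
  then show ?thesis using assms(2) by (auto simp: simplex_vertex_def)
qed

lemma simplex_vertex_singular_face:
  assumes "k \<le> Suc p" "j \<le> p"
  shows "simplex_vertex (singular_face (Suc p) k f) j = simplex_vertex f (skip k j)"
proof -
  have "simplical_face k (\<lambda>i. if i = j then 1 else 0) = (\<lambda>i. if i = skip k j then 1 else (0::real))"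
    using assms by (auto simp: simplical_face_def skip_def fun_eq_iff)
  then show ?thesis using assms by (simp add: simplex_vertex_def singular_face_def)
qed

lemma simplex_vertex_simplex_map:
  "i \<le> p \<Longrightarrow> simplex_vertex (simplex_map p g f) i = g (simplex_vertex f i)"
  by (simp add: simplex_vertex_def simplex_map_def)

lemma alternating_label_cong:
  assumes "\<And>v. v \<in> K \<Longrightarrow> mag v = mag' v" "\<And>v. v \<in> K \<Longrightarrow> sg v = sg' v"
  shows "alternating mag sg k s K = alternating mag' sg' k s K"
proof (induction k arbitrary: s)
  case (Suc k)
  have eq: "{v\<in>K. mag v = k} = {v\<in>K. mag' v = k}" using assms by auto
  have "({v\<in>K. mag' v = k} = {v} \<and> sg v = s) = ({v\<in>K. mag' v = k} = {v} \<and> sg' v = s)" for v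
  proof (rule conj_cong[OF refl])
    assume "{v\<in>K. mag' v = k} = {v}"
    then have "v \<in> {v\<in>K. mag' v = k}" by simp
    then show "(sg v = s) = (sg' v = s)" using assms(2)[of v] by simp
  qed
  moreover have "(\<forall>v\<in>K. mag v \<noteq> k) = (\<forall>v\<in>K. mag' v \<noteq> k)" using assms by auto
  ultimately show ?case unfolding alternating.simps(2) eq Suc.IH by (simp only:)
qed simp

text \<open>The labels at the vertices of a singular simplex form an alternating pattern beginning with \<open>s\<close>.\<close>

definition simplex_alternates ::
    "('a \<Rightarrow> nat) \<Rightarrow> ('a \<Rightarrow> bool) \<Rightarrow> nat \<Rightarrow> bool \<Rightarrow> nat \<Rightarrow> ((nat \<Rightarrow> real) \<Rightarrow> 'a) \<Rightarrow> bool" where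
  "simplex_alternates mag sg m s p f \<longleftrightarrow>
     alternating (mag \<circ> simplex_vertex f) (sg \<circ> simplex_vertex f) m s {..p}"

text \<open>
  The number of alternating simplices in a chain, counted with coefficients.  It is the additive
  extension of the indicator function, obtained as a homomorphism to the free abelian group on
  one generator.
\<close>

definition tally ::
    "('a \<Rightarrow> nat) \<Rightarrow> ('a \<Rightarrow> bool) \<Rightarrow> nat \<Rightarrow> bool \<Rightarrow> nat \<Rightarrow> 'a chain \<Rightarrow> int" where
  "tally mag sg m s p c = poly_mapping.lookup
     (frag_extend (\<lambda>f. frag_cmul (of_bool (simplex_alternates mag sg m s p f)) (frag_of ())) c) ()"

lemma tally_0 [simp]: "tally mag sg m s p 0 = 0"
  by (simp add: tally_def)

lemma tally_of [simp]: "tally mag sg m s p (frag_of f) = of_bool (simplex_alternates mag sg m s p f)"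
  by (simp add: tally_def)

lemma tally_diff: "tally mag sg m s p (a - b) = tally mag sg m s p a - tally mag sg m s p b"
  by (simp add: tally_def frag_extend_diff lookup_minus)

lemma tally_add: "tally mag sg m s p (a + b) = tally mag sg m s p a + tally mag sg m s p b"
  by (simp add: tally_def frag_extend_add lookup_add)

lemma tally_cmul: "tally mag sg m s p (frag_cmul k a) = k * tally mag sg m s p a"
  by (simp add: tally_def frag_extend_cmul)

lemma tally_sum: "finite I \<Longrightarrow> tally mag sg m s p (sum f I) = (\<Sum>i\<in>I. tally mag sg m s p (f i))"
  by (induction I rule: finite_induct) (simp_all add: tally_add)

lemma simplex_alternates_face:
  assumes "k \<le> Suc p"
  shows "simplex_alternates mag sg m s p (singular_face (Suc p) k f) =
    alternating (mag \<circ> simplex_vertex f) (sg \<circ> simplex_vertex f) m s ({..Suc p} - {k})"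
proof -
  have "simplex_alternates mag sg m s p (singular_face (Suc p) k f) =
     alternating ((mag \<circ> simplex_vertex f) \<circ> skip k) ((sg \<circ> simplex_vertex f) \<circ> skip k) m s {..p}"
    unfolding simplex_alternates_def
    by (rule alternating_label_cong) (use assms in \<open>simp_all add: simplex_vertex_singular_face\<close>)
  also have "\<dots> = alternating (mag \<circ> simplex_vertex f) (sg \<circ> simplex_vertex f) m s (skip k ` {..p})"
    by (rule alternating_image[symmetric]) (rule inj_skip)
  finally show ?thesis using skip_image[OF assms] by simp
qed

lemma tally_boundary_simplex:
  assumes nocomp: "\<And>v w. v \<le> Suc p \<Longrightarrow> w \<le> Suc p \<Longrightarrow>
       mag (simplex_vertex f v) = mag (simplex_vertex f w) \<Longrightarrow>
       sg (simplex_vertex f v) = sg (simplex_vertex f w)"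
    and mag: "\<And>v. v \<le> Suc p \<Longrightarrow> mag (simplex_vertex f v) < m"
  shows "even (tally mag sg m s p (chain_boundary (Suc p) (frag_of f))
     - tally mag sg m s (Suc p) (frag_of f) - tally mag sg m (\<not> s) (Suc p) (frag_of f))"
proof -
  let ?P = "\<lambda>k. alternating (mag \<circ> simplex_vertex f) (sg \<circ> simplex_vertex f) m s ({..Suc p} - {k})"
  have "tally mag sg m s p (chain_boundary (Suc p) (frag_of f))
      = (\<Sum>k\<le>Suc p. (-1) ^ k * of_bool (?P k))"
    by (simp add: chain_boundary_of tally_sum tally_cmul simplex_alternates_face del: sum.atMost_Suc)
  moreover have "even ((\<Sum>k\<le>Suc p. (-1) ^ k * of_bool (?P k)) - (\<Sum>k\<le>Suc p. of_bool (?P k) :: int))"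
    unfolding sum_subtractf[symmetric] by (rule dvd_sum) simp
  moreover have "(\<Sum>k\<le>Suc p. of_bool (?P k) :: int) = int (card {v\<in>{..Suc p}. (mag \<circ> simplex_vertex f) v < m \<and> ?P v})"
  proof -
    have "{v\<in>{..Suc p}. (mag \<circ> simplex_vertex f) v < m \<and> ?P v} = {..Suc p} \<inter> {v. ?P v}"
      using mag by auto
    then show ?thesis by (simp add: sum_of_bool_eq del: sum.atMost_Suc)
  qed
  moreover have "even (card {v\<in>{..Suc p}. (mag \<circ> simplex_vertex f) v < m \<and> ?P v}
      + of_bool (simplex_alternates mag sg m s (Suc p) f) + of_bool (simplex_alternates mag sg m (\<not> s) (Suc p) f))"
    unfolding simplex_alternates_def
  proof (rule alternating_boundary)
    fix v w assume "v \<in> {..Suc p}" "w \<in> {..Suc p}" "(mag \<circ> simplex_vertex f) v = (mag \<circ> simplex_vertex f) w"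
    then show "(sg \<circ> simplex_vertex f) v = (sg \<circ> simplex_vertex f) w"
      using nocomp[of v w] by simp
  qed simp
  ultimately show ?thesis
    unfolding tally_of by (auto simp del: sum.atMost_Suc split: if_splits)
qed

lemma tally_boundary:
  assumes "\<And>f v w. f \<in> Poly_Mapping.keys c \<Longrightarrow> v \<le> Suc p \<Longrightarrow> w \<le> Suc p \<Longrightarrow>
       mag (simplex_vertex f v) = mag (simplex_vertex f w) \<Longrightarrow>
       sg (simplex_vertex f v) = sg (simplex_vertex f w)"
    and "\<And>f v. f \<in> Poly_Mapping.keys c \<Longrightarrow> v \<le> Suc p \<Longrightarrow> mag (simplex_vertex f v) < m"
  shows "even (tally mag sg m s p (chain_boundary (Suc p) c)
     - tally mag sg m s (Suc p) c - tally mag sg m (\<not> s) (Suc p) c)"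
proof -
  let ?F = "{f. (\<forall>v w. v \<le> Suc p \<longrightarrow> w \<le> Suc p \<longrightarrow>
       mag (simplex_vertex f v) = mag (simplex_vertex f w) \<longrightarrow>
       sg (simplex_vertex f v) = sg (simplex_vertex f w)) \<and> (\<forall>v\<le>Suc p. mag (simplex_vertex f v) < m)}"
  have "Poly_Mapping.keys c \<subseteq> ?F"
    using assms by blast
  then show ?thesis
  proof (induction c rule: frag_induction)
    case (one f)
    then show ?case by (intro tally_boundary_simplex) blast+
  next
    case (diff a b)
    have "even (x - y)" if "even x" "even y" for x y :: int using that by simp
    from this[OF diff] show ?case by (simp add: chain_boundary_diff tally_diff algebra_simps)
  qed simp
qed

text \<open>An antipodal map flips all signs, hence exchanges the two kinds of alternating simplices.\<close>

lemma tally_antipode: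
  assumes "singular_chain p X c"
    and "\<And>x. x \<in> topspace X \<Longrightarrow> mag (a x) = mag x" "\<And>x. x \<in> topspace X \<Longrightarrow> sg (a x) = (\<not> sg x)"
  shows "tally mag sg m s p (chain_map p a c) = tally mag sg m (\<not> s) p c"
  using assms(1) unfolding singular_chain_def
proof (induction c rule: frag_induction)
  case (one f)
  then have f: "singular_simplex p X f" by simp
  have "simplex_alternates mag sg m s p (simplex_map p a f) =
      alternating (mag \<circ> simplex_vertex f) (\<lambda>v. \<not> (sg \<circ> simplex_vertex f) v) m s {..p}"
    unfolding simplex_alternates_def
    by (rule alternating_label_cong)
      (use assms(2,3) simplex_vertex_in_topspace[OF f] in \<open>simp_all add: simplex_vertex_simplex_map\<close>)
  then show ?case unfolding alternating_neg by (simp add: simplex_alternates_def comp_def)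
qed (auto simp: chain_map_diff tally_diff)

lemma tally_eq_0:
  assumes "singular_chain p X c" "\<And>x. x \<in> topspace X \<Longrightarrow> mag x < m" "m \<le> p"
  shows "tally mag sg m s p c = 0"
  using assms(1) unfolding singular_chain_def
proof (induction c rule: frag_induction)
  case (one f)
  then have f: "singular_simplex p X f" by simp
  have "\<not> simplex_alternates mag sg m s p f"
    using alternating_card_le[of "mag \<circ> simplex_vertex f" "sg \<circ> simplex_vertex f" m s "{..p}"]
      assms(2,3) simplex_vertex_in_topspace[OF f] by (auto simp: simplex_alternates_def)
  then show ?case by simp
qed (auto simp: tally_diff)

lemma alternating_singleton:
  "g v < k \<Longrightarrow> alternating g h k s {v} \<noteq> alternating g h k (\<not> s) {v}"
proof (induction k)
  case (Suc k)
  show ?case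
  proof (cases "g v = k")
    case True
    then have "{w\<in>{v}. g w = k} = {v}" by auto
    note * = alternating_Suc_one[OF this]
    have "alternating g h k s' {v} \<longleftrightarrow> alternating g h k s' {}" for s'
      by (rule alternating_cong) (use True in auto)
    then show ?thesis unfolding * by (simp add: alternating_empty)
  next
    case False
    then have "\<forall>w\<in>{v}. g w \<noteq> k" by simp
    then show ?thesis using Suc.IH Suc.prems False by (simp add: alternating_Suc_none)
  qed
qed simp

text \<open>
  A chain-level form of Tucker's lemma: labels with only \<open>m \<le> n\<close> magnitudes, equivariant under \<open>a\<close>,
  must produce a complementary pair of vertices in some simplex of the chains \<open>c 0, \<dots>, c n\<close>.
  Otherwise the number of alternating simplices of either kind in \<open>c j\<close> has the same parity for all
  \<open>j \<le> n\<close>, which is odd for the single point \<open>c 0\<close> and zero for \<open>c n\<close>, whose simplices have more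
  vertices than there are magnitudes.
\<close>

lemma antipodal_chains_complementary_edge:
  fixes c :: "nat \<Rightarrow> 'a chain"
  assumes chains: "\<And>j. j \<le> n \<Longrightarrow> singular_chain j X (c j)"
    and bd: "\<And>j. j < n \<Longrightarrow>
        chain_boundary (Suc j) (c (Suc j)) = c j + frag_cmul (e j) (chain_map j a (c j))"
    and e: "\<And>j. odd (e j)"
    and c0: "c 0 = frag_of f0"
    and a: "\<And>x. x \<in> topspace X \<Longrightarrow> mag (a x) = mag x" "\<And>x. x \<in> topspace X \<Longrightarrow> sg (a x) = (\<not> sg x)"
    and mag: "\<And>x. x \<in> topspace X \<Longrightarrow> mag x < m" and "m \<le> n"
  shows "\<exists>j f v w. j \<le> n \<and> f \<in> Poly_Mapping.keys (c j) \<and> v \<le> j \<and> w \<le> j \<and>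
       mag (simplex_vertex f v) = mag (simplex_vertex f w) \<and>
       sg (simplex_vertex f v) \<noteq> sg (simplex_vertex f w)"
proof (rule ccontr)
  assume no: "\<not> ?thesis"
  have tot: "odd (tally mag sg m True j (c j) + tally mag sg m False j (c j))" if "j \<le> n" for j
    using that
  proof (induction j)
    case 0
    have "singular_simplex 0 X f0" using chains[of 0] c0 by (simp add: singular_chain_of)
    then have lt: "mag (simplex_vertex f0 0) < m" by (intro mag simplex_vertex_in_topspace) simp_all
    have "alternating (mag \<circ> simplex_vertex f0) (sg \<circ> simplex_vertex f0) m True {0} \<noteq>
        alternating (mag \<circ> simplex_vertex f0) (sg \<circ> simplex_vertex f0) m (\<not> True) {0}"
      by (rule alternating_singleton) (use lt in simp)
    then show ?case
      by (cases "alternating (mag \<circ> simplex_vertex f0) (sg \<circ> simplex_vertex f0) m True {0}")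
        (simp_all add: c0 simplex_alternates_def)
  next
    case (Suc j)
    let ?T = "\<lambda>s j c. tally mag sg m s j c"
    have "even (?T True j (chain_boundary (Suc j) (c (Suc j)))
        - ?T True (Suc j) (c (Suc j)) - ?T (\<not> True) (Suc j) (c (Suc j)))"
    proof (rule tally_boundary)
      fix f v assume f: "f \<in> Poly_Mapping.keys (c (Suc j))" and v: "v \<le> Suc j"
      show "mag (simplex_vertex f v) < m"
        using chains[OF Suc.prems] f v
        by (intro mag simplex_vertex_in_topspace[of "Suc j"]) (auto simp: singular_chain_def)
    next
      fix f v w assume "f \<in> Poly_Mapping.keys (c (Suc j))" "v \<le> Suc j" "w \<le> Suc j"
        "mag (simplex_vertex f v) = mag (simplex_vertex f w)"
      then show "sg (simplex_vertex f v) = sg (simplex_vertex f w)"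
        using no Suc.prems by blast
    qed
    moreover have "?T True j (chain_boundary (Suc j) (c (Suc j))) = ?T True j (c j) + e j * ?T False j (c j)"
      using bd[of j] Suc.prems tally_antipode[OF chains[of j], of mag a sg m True] a
      by (simp add: tally_add tally_cmul)
    ultimately show ?case using Suc e[of j] by auto
  qed
  have "tally mag sg m s n (c n) = 0" for s
    using chains[of n] mag \<open>m \<le> n\<close> by (intro tally_eq_0) simp_all
  with tot[of n] show False by simp
qed

section \<open>Antipodal chains on the octahedral sphere and the Borsuk--Ulam theorem\<close>

text \<open>
  The \<open>n\<close>-dimensional octahedral sphere: the unit sphere of the 1-norm in the first \<open>n + 1\<close>
  coordinates.  Working with sequences lets the dimension vary within a proof.
\<close>

definition octahedron :: "nat \<Rightarrow> (nat \<Rightarrow> real) set" where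
  "octahedron n = {x. (\<Sum>i\<le>n. \<bar>x i\<bar>) = 1 \<and> (\<forall>i>n. x i = 0)}"

abbreviation antipode :: "(nat \<Rightarrow> real) \<Rightarrow> nat \<Rightarrow> real" where
  "antipode \<equiv> \<lambda>x i. - x i"

lemma octahedron_antipode [simp]: "antipode x \<in> octahedron n \<longleftrightarrow> x \<in> octahedron n"
  by (simp add: octahedron_def)

lemma octahedron_mono:
  assumes "j \<le> n" shows "octahedron j \<subseteq> octahedron n"
proof
  fix x assume x: "x \<in> octahedron j"
  have "(\<Sum>i\<le>n. \<bar>x i\<bar>) = (\<Sum>i\<le>j. \<bar>x i\<bar>)"
    by (rule sum.mono_neutral_right) (use x assms in \<open>auto simp: octahedron_def\<close>)
  with x assms show "x \<in> octahedron n" by (simp add: octahedron_def)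
qed

lemma compact_octahedron: "compact (octahedron n)"
proof -
  have "compactin (powertop_real UNIV) (UNIV \<rightarrow>\<^sub>E {-1..1})"
    by (simp add: compactin_PiE)
  then have c: "compact (PiE UNIV (\<lambda>_::nat. {-1..1::real}))"
    by (simp add: euclidean_product_topology)
  have "\<bar>x i\<bar> \<le> 1" if "x \<in> octahedron n" for x i
  proof (cases "i \<le> n")
    case True
    then have "\<bar>x i\<bar> \<le> (\<Sum>i\<le>n. \<bar>x i\<bar>)" by (intro member_le_sum) auto
    then show ?thesis using that by (simp add: octahedron_def)
  qed (use that in \<open>simp add: octahedron_def\<close>)
  then have "octahedron n \<subseteq> PiE UNIV (\<lambda>_::nat. {-1..1::real})"
    by (auto simp: abs_le_iff minus_le_iff)
  moreover have "closed (octahedron n)"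
  proof -
    have "octahedron n = {x. (\<Sum>i\<le>n. \<bar>x i\<bar>) = 1} \<inter> (\<Inter>i\<in>{n<..}. {x. x i = 0})"
      by (auto simp: octahedron_def)
    also have "closed \<dots>"
      by (intro closed_Int closed_INT ballI closed_Collect_eq continuous_intros) auto
    finally show ?thesis .
  qed
  ultimately show ?thesis
    using compact_Int_closed[OF c, of "octahedron n"] by (simp add: Int_absorb1)
qed

lemma octahedron_cone:
  assumes "x \<in> octahedron j" "0 \<le> u" "u \<le> 1"
  shows "(\<lambda>i. (1 - u) * (if i = Suc j then 1 else 0) + u * x i) \<in> octahedron (Suc j)"
proof -
  have "x (Suc j) = 0" "(\<Sum>i\<le>j. \<bar>x i\<bar>) = 1" using assms by (auto simp: octahedron_def)
  moreover have "(\<Sum>i\<le>j. \<bar>(1 - u) * (if i = Suc j then 1 else 0) + u * x i\<bar>) = (\<Sum>i\<le>j. u * \<bar>x i\<bar>)"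
    by (rule sum.cong) (use assms in \<open>auto simp: abs_mult\<close>)
  ultimately show ?thesis
    using assms by (auto simp: octahedron_def simp flip: sum_distrib_left)
qed

text \<open>
  A chain carried by the upper half of the octahedral \<open>j\<close>-sphere: the cone, with a new basis vector
  as apex, over the cycle formed by the previous hemisphere and its antipodal image.
\<close>

primrec hemisphere :: "nat \<Rightarrow> (nat \<Rightarrow> real) chain" where
  "hemisphere 0 = frag_of (oriented_simplex 0 (\<lambda>_ i. if i = 0 then 1 else 0))"
| "hemisphere (Suc j) = simplicial_cone j (\<lambda>i. if i = Suc j then 1 else 0)
     (hemisphere j + frag_cmul ((-1) ^ Suc j) (chain_map j antipode (hemisphere j)))"

lemma simplicial_chain_antipode:
  assumes "simplicial_chain j (octahedron n) c"
  shows "simplicial_chain j (octahedron n) (chain_map j antipode c)"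
  using assms unfolding simplicial_chain_def
proof (induction c rule: frag_induction)
  case (one f)
  then obtain l where f: "f ` standard_simplex j \<subseteq> octahedron n" "f = oriented_simplex j l"
    by (auto simp: simplicial_simplex)
  have "simplex_map j antipode f = oriented_simplex j (\<lambda>k i. - l k i)"
    unfolding f(2) by (auto simp: simplex_map_def oriented_simplex_def fun_eq_iff sum_negf)
  moreover have "simplex_map j antipode f ` standard_simplex j \<subseteq> octahedron n"
    using f(1) by (auto simp: simplex_map_def)
  ultimately show ?case by (simp add: simplicial_simplex) blast
next
  case (diff a b)
  then show ?case using simplicial_chain_diff[of j "octahedron n"]
    by (simp add: chain_map_diff simplicial_chain_def)
qed simp

lemma simplicial_chain_add:
  fixes a b :: "(nat \<Rightarrow> real) chain"
  shows "simplicial_chain p S a \<Longrightarrow> simplicial_chain p S b \<Longrightarrow> simplicial_chain p S (a + b)"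
  using simplicial_chain_diff[of p S a "frag_cmul (-1) b"] simplicial_chain_cmul[of p S b "-1"]
  by simp

lemma simplicial_chain_hemisphere: "simplicial_chain j (octahedron j) (hemisphere j)"
proof (induction j)
  case 0
  have "(oriented_simplex 0 (\<lambda>_ i. if i = 0 then 1 else 0) :: _ \<Rightarrow> nat \<Rightarrow> real) ` standard_simplex 0
      \<subseteq> octahedron 0"
    by (auto simp: oriented_simplex_def standard_simplex_0 octahedron_def)
  then show ?case by (simp add: simplicial_simplex) blast
next
  case (Suc j)
  show ?case unfolding hemisphere.simps
    by (rule simplicial_chain_simplicial_cone[where S = "octahedron j"])
      (use Suc octahedron_cone in \<open>auto intro!: simplicial_chain_add simplicial_chain_cmul simplicial_chain_antipode\<close>)
qed

lemma singular_chain_hemisphere: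
  assumes "j \<le> n"
  shows "singular_chain j (subtopology (powertop_real UNIV) (octahedron n)) (hemisphere j)"
  using simplicial_imp_singular_chain[OF simplicial_chain_hemisphere]
    octahedron_mono[OF assms] by (rule singular_chain_mono)

lemma chain_map_antipode_antipode:
  assumes "singular_chain j X c"
  shows "chain_map j antipode (chain_map j antipode c) = c"
proof -
  have "chain_map j antipode (chain_map j antipode c) = chain_map j (antipode \<circ> antipode) c"
    by (simp add: chain_map_compose)
  also have "antipode \<circ> antipode = id" by auto
  finally show ?thesis using chain_map_ident[OF assms] by (simp only:)
qed

text \<open>
  The alternating signs make the base of each cone a cycle, so that it is the whole boundary.  In
  dimension zero the two signs cancel in the augmentation.
\<close>

lemma chain_boundary_hemisphere:
  "chain_boundary (Suc j) (hemisphere (Suc j)) =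
     hemisphere j + frag_cmul ((-1) ^ Suc j) (chain_map j antipode (hemisphere j))"
proof (induction j)
  case 0
  let ?z = "hemisphere 0 + frag_cmul ((-1) ^ Suc 0) (chain_map 0 antipode (hemisphere 0))"
  have "simplicial_chain 0 (octahedron 0) ?z"
    by (intro simplicial_chain_add simplicial_chain_cmul simplicial_chain_antipode simplicial_chain_hemisphere)
  from chain_boundary_simplicial_cone[OF this]
  show ?case by (simp add: frag_extend_diff)
next
  case (Suc j)
  let ?z = "\<lambda>j. hemisphere j + frag_cmul ((-1) ^ Suc j) (chain_map j antipode (hemisphere j))"
  have sz: "simplicial_chain (Suc j) (octahedron (Suc j)) (?z (Suc j))"
    by (intro simplicial_chain_add simplicial_chain_cmul simplicial_chain_antipode simplicial_chain_hemisphere)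
  have "chain_boundary (Suc j) (?z (Suc j)) = ?z j + frag_cmul ((-1) ^ Suc (Suc j)) (chain_map j antipode (?z j))"
    using Suc.IH
      chain_boundary_chain_map[OF singular_chain_hemisphere[OF order_refl, of "Suc j"], of antipode]
    by (simp add: chain_boundary_add chain_boundary_cmul del: hemisphere.simps)
  also have "\<dots> = 0"
    using chain_map_antipode_antipode[OF singular_chain_hemisphere[OF order_refl, of j]]
    by (simp add: chain_map_add frag_cmul_distrib2 chain_map_minus flip: frag_cmul_distrib)
  finally show ?case
    using chain_boundary_simplicial_cone[OF sz] by (simp add: simplicial_cone_def)
qed

lemma iterated_subdivision_singular_chain:
  "singular_chain p X c \<Longrightarrow> singular_chain p X ((singular_subdivision p ^^ N) c)"
  by (induction N) (auto intro: singular_chain_singular_subdivision)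

lemma iterated_subdivision_boundary:
  "singular_chain (Suc p) X c \<Longrightarrow> chain_boundary (Suc p) ((singular_subdivision (Suc p) ^^ N) c) =
     (singular_subdivision p ^^ N) (chain_boundary (Suc p) c)"
proof (induction N)
  case (Suc N)
  show ?case
    using chain_boundary_singular_subdivision[OF iterated_subdivision_singular_chain[OF Suc.prems], of N] Suc
    by simp
qed simp

lemma iterated_subdivision_chain_map:
  "singular_chain p X c \<Longrightarrow> (singular_subdivision p ^^ N) (chain_map p g c) =
     chain_map p g ((singular_subdivision p ^^ N) c)"
proof (induction N)
  case (Suc N)
  show ?case
    using naturality_singular_subdivision[OF iterated_subdivision_singular_chain[OF Suc.prems, of N], of g] Suc
    by simp
qed simp

lemma iterated_subdivision_add:
  "(singular_subdivision p ^^ N) (a + b) = (singular_subdivision p ^^ N) a + (singular_subdivision p ^^ N) b"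
  by (induction N) (simp_all add: singular_subdivision_add)

lemma iterated_subdivision_cmul:
  "(singular_subdivision p ^^ N) (frag_cmul k a) = frag_cmul k ((singular_subdivision p ^^ N) a)"
  by (induction N) (simp_all add: singular_subdivision_def frag_extend_cmul)

lemma iterated_subdivision_zero:
  "singular_chain 0 X c \<Longrightarrow> (singular_subdivision 0 ^^ N) c = c"
  by (induction N) (simp_all add: singular_subdivision_zero)

text \<open>
  Fewer odd continuous functions than coordinates have a common zero on the sphere.  The label of a
  point is an index \<open>i\<close> with \<open>\<bar>g i x\<bar> \<ge> \<delta>\<close>, together with the sign of \<open>g i x\<close>; the subdivision is so
  fine that every \<open>g i\<close> varies by less than \<open>2 * \<delta>\<close> on each simplex.
\<close>

theorem borsuk_ulam:
  fixes g :: "nat \<Rightarrow> (nat \<Rightarrow> real) \<Rightarrow> real"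
  assumes cont: "\<And>i. i < m \<Longrightarrow> continuous_on (octahedron n) (g i)"
    and odd: "\<And>i x. i < m \<Longrightarrow> x \<in> octahedron n \<Longrightarrow> g i (\<lambda>j. - x j) = - g i x"
    and "m \<le> n"
  shows "\<exists>x\<in>octahedron n. \<forall>i<m. g i x = 0"
proof (rule ccontr)
  assume "\<not> ?thesis"
  then have no: "\<exists>i<m. g i x \<noteq> 0" if "x \<in> octahedron n" for x using that by simp
  let ?X = "subtopology (powertop_real UNIV) (octahedron n)"
  have topX: "topspace ?X = octahedron n" by simp
  have ne: "octahedron n \<noteq> {}"
    using octahedron_mono[of 0 n] by (auto simp: octahedron_def intro!: exI[of _ "\<lambda>i. if i = 0 then 1 else 0"])
  let ?G = "\<lambda>x. \<Sum>i<m. \<bar>g i x\<bar>"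
  have "continuous_on (octahedron n) ?G" by (intro continuous_intros cont) auto
  from continuous_attains_inf[OF compact_octahedron ne this]
  have "\<exists>x0. x0 \<in> octahedron n \<and> (\<forall>x\<in>octahedron n. ?G x0 \<le> ?G x)"
    unfolding Bex_def .
  then obtain x0 where x0: "x0 \<in> octahedron n" "\<forall>x\<in>octahedron n. ?G x0 \<le> ?G x"
    by (elim exE conjE)
  have pos: "?G x > 0" if x: "x \<in> octahedron n" for x
  proof -
    obtain i where "i < m" "g i x \<noteq> 0" using no[OF x] by (elim exE conjE)
    then show ?thesis by (intro sum_pos2[of _ i]) auto
  qed
  have "m > 0" using pos[OF x0(1)] by (cases m) auto
  define \<delta> where "\<delta> = ?G x0 / m"
  have "\<delta> > 0" using pos[OF x0(1)] \<open>m > 0\<close> by (simp add: \<delta>_def)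
  have big: "\<exists>i<m. \<delta> \<le> \<bar>g i x\<bar>" if "x \<in> octahedron n" for x
  proof (rule ccontr)
    assume "\<not> ?thesis"
    then have "?G x < (\<Sum>i<m. \<delta>)" using \<open>m > 0\<close> by (intro sum_strict_mono) auto
    also have "\<dots> = ?G x0" using \<open>m > 0\<close> by (simp add: \<delta>_def)
    finally show False using x0(2) that by fastforce
  qed
  define mag where "mag x = (LEAST i. i < m \<and> \<delta> \<le> \<bar>g i x\<bar>)" for x
  define sg where "sg x = (0 < g (mag x) x)" for x
  have mag: "mag x < m" "\<delta> \<le> \<bar>g (mag x) x\<bar>" if "x \<in> octahedron n" for x
    using LeastI_ex[of "\<lambda>i. i < m \<and> \<delta> \<le> \<bar>g i x\<bar>"] big[OF that] by (auto simp: mag_def)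
  have mag_neg: "mag (antipode x) = mag x" if "x \<in> octahedron n" for x
  proof -
    have "(\<lambda>i. i < m \<and> \<delta> \<le> \<bar>g i (antipode x)\<bar>) = (\<lambda>i. i < m \<and> \<delta> \<le> \<bar>g i x\<bar>)"
      using odd that by (auto simp: fun_eq_iff)
    then show ?thesis by (simp add: mag_def)
  qed
  have sg_neg: "sg (antipode x) = (\<not> sg x)" if "x \<in> octahedron n" for x
    using mag[OF that] odd[OF _ that] \<open>\<delta> > 0\<close> by (auto simp: sg_def mag_neg that)
  \<comment> \<open>On a set contained in some \<open>V x\<close>, a component of size at least \<open>\<delta>\<close> cannot take both signs.\<close>
  define V where "V x = {y\<in>octahedron n. \<forall>i<m. \<bar>g i y - g i x\<bar> < \<delta>}" for x
  have openV: "openin ?X (V x)" for x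
  proof -
    have "V x = octahedron n \<inter> (\<Inter>i\<in>{..<m}. {y\<in>octahedron n. \<bar>g i y - g i x\<bar> \<in> {..<\<delta>}})"
      by (auto simp: V_def)
    moreover have "openin (top_of_set (octahedron n)) {y\<in>octahedron n. \<bar>g i y - g i x\<bar> \<in> {..<\<delta>}}"
      if "i < m" for i
    proof -
      have "continuous_on (octahedron n) (\<lambda>y. \<bar>g i y - g i x\<bar>)"
        by (intro continuous_intros cont that)
      from continuous_openin_preimage_gen[OF this, of "{..<\<delta>}"] show ?thesis
        by (simp add: vimage_def Int_def)
    qed
    ultimately show ?thesis
      using \<open>m > 0\<close> by (auto simp: euclidean_product_topology intro!: openin_Int openin_INT)
  qed
  have cover: "topspace ?X \<subseteq> \<Union> (V ` octahedron n)"
    using \<open>\<delta> > 0\<close> by (auto simp: V_def)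
  have "\<exists>N. \<forall>M f. N \<le> M \<longrightarrow> f \<in> Poly_Mapping.keys ((singular_subdivision j ^^ M) (hemisphere j)) \<longrightarrow>
       (\<exists>U \<in> V ` octahedron n. f \<in> standard_simplex j \<rightarrow> U)" if "j \<le> n" for j
  proof -
    have "\<And>U. U \<in> V ` octahedron n \<Longrightarrow> openin ?X U" using openV by blast
    from sufficient_iterated_singular_subdivision_exists[OF this cover singular_chain_hemisphere[OF that]]
    show ?thesis by metis
  qed
  then obtain N where N: "\<And>j M f. j \<le> n \<Longrightarrow> N j \<le> M \<Longrightarrow>
      f \<in> Poly_Mapping.keys ((singular_subdivision j ^^ M) (hemisphere j)) \<Longrightarrow>
       (\<exists>U \<in> V ` octahedron n. f \<in> standard_simplex j \<rightarrow> U)" by metis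
  define M where "M = Max (N ` {..n})"
  have M: "N j \<le> M" if "j \<le> n" for j using that by (auto simp: M_def)
  let ?c = "\<lambda>j. (singular_subdivision j ^^ M) (hemisphere j)"
  have "\<exists>j f v w. j \<le> n \<and> f \<in> Poly_Mapping.keys (?c j) \<and> v \<le> j \<and> w \<le> j \<and>
       mag (simplex_vertex f v) = mag (simplex_vertex f w) \<and>
       sg (simplex_vertex f v) \<noteq> sg (simplex_vertex f w)"
  proof (rule antipodal_chains_complementary_edge[where X = ?X and e = "\<lambda>j. (-1) ^ Suc j" and a = antipode and m = m])
    show "singular_chain j ?X (?c j)" if "j \<le> n" for j
      by (intro iterated_subdivision_singular_chain singular_chain_hemisphere that)
    show "chain_boundary (Suc j) (?c (Suc j)) = ?c j + frag_cmul ((-1) ^ Suc j) (chain_map j antipode (?c j))"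
      if "j < n" for j
      using that singular_chain_hemisphere[of "Suc j" n] singular_chain_hemisphere[of j n]
      by (simp add: iterated_subdivision_boundary[where X = ?X] chain_boundary_hemisphere
          iterated_subdivision_add iterated_subdivision_cmul iterated_subdivision_chain_map[where X = ?X]
          del: hemisphere.simps power_Suc)
    show "?c 0 = frag_of (oriented_simplex 0 (\<lambda>_ i. if i = 0 then 1 else 0))"
      using iterated_subdivision_zero[OF singular_chain_hemisphere[of 0 n]] by simp
  qed (use mag mag_neg sg_neg \<open>m \<le> n\<close> topX in \<open>simp_all only:, simp_all\<close>)
  then obtain j f v w where f: "j \<le> n" "f \<in> Poly_Mapping.keys (?c j)" "v \<le> j" "w \<le> j"
       "mag (simplex_vertex f v) = mag (simplex_vertex f w)"
       "sg (simplex_vertex f v) \<noteq> sg (simplex_vertex f w)" by blast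
  then obtain x where x: "x \<in> octahedron n" "f \<in> standard_simplex j \<rightarrow> V x"
    using N[OF f(1) M[OF f(1)] f(2)] by blast
  have vert: "simplex_vertex f i \<in> V x" if "i \<le> j" for i
    using x(2) that by (auto simp: simplex_vertex_def)
  define y where "y = simplex_vertex f v"
  define z where "z = simplex_vertex f w"
  have yz: "y \<in> V x" "z \<in> V x" using vert f by (auto simp: y_def z_def)
  let ?i = "mag y"
  have "?i < m" "\<delta> \<le> \<bar>g ?i y\<bar>" "\<delta> \<le> \<bar>g ?i z\<bar>" "(0 < g ?i y) \<noteq> (0 < g ?i z)"
    using yz mag[of y] mag[of z] f(5,6) by (auto simp: V_def y_def[symmetric] z_def[symmetric] sg_def)
  moreover have "\<bar>g ?i y - g ?i x\<bar> < \<delta>" "\<bar>g ?i z - g ?i x\<bar> < \<delta>"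
    using yz \<open>?i < m\<close> by (auto simp: V_def)
  ultimately show False by linarith
qed

section \<open>The Hahn--Banach theorem\<close>

text \<open>
  Subadditive and positively homogeneous.  Only one inequality is required in the homogeneity
  condition, the other one follows.
\<close>

definition sublinear :: "('a::real_vector \<Rightarrow> real) \<Rightarrow> bool" where
  "sublinear p \<longleftrightarrow> (\<forall>x y. p (x + y) \<le> p x + p y) \<and> (\<forall>t\<ge>0. \<forall>x. p (t *\<^sub>R x) \<le> t * p x)"

lemma sublinearD:
  assumes "sublinear p"
  shows "p (x + y) \<le> p x + p y" "t \<ge> 0 \<Longrightarrow> p (t *\<^sub>R x) \<le> t * p x" "p 0 = 0" "- p (- x) \<le> p x"
proof -
  show a: "p (x + y) \<le> p x + p y" for x y using assms by (simp add: sublinear_def)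
  show h: "t \<ge> 0 \<Longrightarrow> p (t *\<^sub>R x) \<le> t * p x" for t x using assms by (simp add: sublinear_def)
  show z: "p 0 = 0" using a[of 0 0] h[of 0 0] by simp
  show "- p (- x) \<le> p x" using a[of x "-x"] z by simp
qed

text \<open>
  A sublinear functional below \<open>p\<close> whose value at \<open>- a\<close> is at most \<open>- p a\<close>; where it agrees with \<open>p\<close>,
  this yields \<open>p (x + a) = p x + p a\<close>.
\<close>

definition tilt :: "('a::real_vector \<Rightarrow> real) \<Rightarrow> 'a \<Rightarrow> 'a \<Rightarrow> real" where
  "tilt p a x = (INF t\<in>{0..}. p (x + t *\<^sub>R a) - t * p a)"

lemma tilt_le:
  assumes "sublinear p" "t \<ge> 0"
  shows "tilt p a x \<le> p (x + t *\<^sub>R a) - t * p a"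
  unfolding tilt_def
proof (rule cINF_lower)
  have "- p (- x) \<le> p (x + s *\<^sub>R a) - s * p a" if "s \<ge> 0" for s
  proof -
    have "s = 0 \<or> p (s *\<^sub>R a) \<ge> s * p a"
    proof (cases "s = 0")
      case False
      then have "p ((1/s) *\<^sub>R (s *\<^sub>R a)) \<le> (1/s) * p (s *\<^sub>R a)"
        using that by (intro sublinearD(2) assms) simp
      then show ?thesis using False that by (simp add: field_simps)
    qed simp
    moreover have "p ((x + s *\<^sub>R a) + (- x)) \<le> p (x + s *\<^sub>R a) + p (- x)"
      by (intro sublinearD(1) assms)
    ultimately show ?thesis using sublinearD(4)[OF assms(1), of x] by auto
  qed
  then show "bdd_below ((\<lambda>t. p (x + t *\<^sub>R a) - t * p a) ` {0..})"
    by (intro bdd_belowI2[of _ "- p (- x)"]) auto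
qed (use assms in simp)

lemma tilt_greatest:
  assumes "\<And>t. t \<ge> 0 \<Longrightarrow> c \<le> p (x + t *\<^sub>R a) - t * p a"
  shows "c \<le> tilt p a x"
  unfolding tilt_def by (rule cINF_greatest) (use assms in auto)

lemma sublinear_tilt:
  assumes "sublinear p"
  shows "sublinear (tilt p a)"
  unfolding sublinear_def
proof (intro conjI allI impI)
  fix x y
  have "tilt p a (x + y) - (p (x + s *\<^sub>R a) - s * p a) \<le> p (y + t *\<^sub>R a) - t * p a"
    if "s \<ge> 0" "t \<ge> 0" for s t
  proof -
    have "tilt p a (x + y) \<le> p ((x + y) + (s + t) *\<^sub>R a) - (s + t) * p a"
      by (rule tilt_le) (use assms that in auto)
    also have "(x + y) + (s + t) *\<^sub>R a = (x + s *\<^sub>R a) + (y + t *\<^sub>R a)"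
      by (simp add: algebra_simps)
    also have "p \<dots> \<le> p (x + s *\<^sub>R a) + p (y + t *\<^sub>R a)" by (rule sublinearD(1)[OF assms])
    finally show ?thesis by (simp add: algebra_simps)
  qed
  then have "tilt p a (x + y) - (p (x + s *\<^sub>R a) - s * p a) \<le> tilt p a y" if "s \<ge> 0" for s
    by (intro tilt_greatest) (use that in auto)
  then have "tilt p a (x + y) - tilt p a y \<le> tilt p a x"
    by (intro tilt_greatest) (simp add: algebra_simps)
  then show "tilt p a (x + y) \<le> tilt p a x + tilt p a y" by simp
next
  fix t :: real and x assume "t \<ge> 0"
  show "tilt p a (t *\<^sub>R x) \<le> t * tilt p a x"
  proof (cases "t = 0")
    case True
    then show ?thesis using tilt_le[OF assms, of 0 a 0] sublinearD(3)[OF assms] by simp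
  next
    case False
    then have "t > 0" using \<open>t \<ge> 0\<close> by simp
    have "tilt p a (t *\<^sub>R x) / t \<le> tilt p a x"
    proof (rule tilt_greatest)
      fix s :: real assume "s \<ge> 0"
      then have "tilt p a (t *\<^sub>R x) \<le> p (t *\<^sub>R x + (t * s) *\<^sub>R a) - t * s * p a"
        using \<open>t > 0\<close> by (intro tilt_le assms) simp
      also have "t *\<^sub>R x + (t * s) *\<^sub>R a = t *\<^sub>R (x + s *\<^sub>R a)" by (simp add: algebra_simps)
      also have "p \<dots> \<le> t * p (x + s *\<^sub>R a)" using \<open>t \<ge> 0\<close> by (rule sublinearD(2)[OF assms])
      finally show "tilt p a (t *\<^sub>R x) / t \<le> p (x + s *\<^sub>R a) - s * p a"
        using \<open>t > 0\<close> by (simp add: field_simps)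
    qed
    then show ?thesis using \<open>t > 0\<close> by (simp add: field_simps)
  qed
qed

text \<open>Zorn's lemma applies because the pointwise infimum of a chain is again sublinear.\<close>

lemma exists_minimal_sublinear:
  fixes p :: "'a::real_vector \<Rightarrow> real"
  assumes "sublinear p"
  shows "\<exists>q. sublinear q \<and> q \<le> p \<and> (\<forall>r. sublinear r \<longrightarrow> r \<le> q \<longrightarrow> r = q)"
proof -
  let ?A = "{q. sublinear q \<and> q \<le> p}"
  have "\<exists>m\<in>?A. \<forall>r\<in>?A. r \<le> m \<longrightarrow> r = m"
  proof (rule predicate_Zorn[where P = "\<lambda>a b. b \<le> a"])
    show "partial_order_on ?A (relation_of (\<lambda>a b. b \<le> a) ?A)"
      by (rule partial_order_on_relation_ofI) auto
  next
    fix C assume "C \<in> Chains (relation_of (\<lambda>a b. b \<le> a) ?A)"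
    then have C: "\<And>q. q \<in> C \<Longrightarrow> sublinear q" "\<And>q. q \<in> C \<Longrightarrow> q \<le> p"
      "\<And>q r. q \<in> C \<Longrightarrow> r \<in> C \<Longrightarrow> q \<le> r \<or> r \<le> q"
      by (auto simp: Chains_def relation_of_def)
    show "\<exists>u\<in>?A. \<forall>a\<in>C. u \<le> a"
    proof (cases "C = {}")
      case True
      then show ?thesis using assms by auto
    next
      case False
      define u where "u x = (INF q\<in>C. q x)" for x
      have le: "u x \<le> q x" if "q \<in> C" for q x
        unfolding u_def
      proof (rule cINF_lower)
        have "- p (- x) \<le> r x" if "r \<in> C" for r
          using sublinearD(4)[OF C(1)[OF that], of x] le_funD[OF C(2)[OF that], of "- x"] by simp
        then show "bdd_below ((\<lambda>q. q x) ` C)" by (intro bdd_belowI2[of _ "- p (- x)"])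
      qed fact
      have greatest: "c \<le> u x" if "\<And>q. q \<in> C \<Longrightarrow> c \<le> q x" for c x
        unfolding u_def by (rule cINF_greatest) (use False that in auto)
      have ur: "u (x + y) \<le> q x + r y" if qr: "q \<in> C" "r \<in> C" for q r x y
      proof -
        obtain m where m: "m \<in> C" "m \<le> q" "m \<le> r" using C(3)[OF qr] qr by blast
        have "u (x + y) \<le> m (x + y)" by (rule le) fact
        also have "\<dots> \<le> m x + m y" by (rule sublinearD(1)[OF C(1)]) fact
        also have "\<dots> \<le> q x + r y" using m by (intro add_mono) (auto simp: le_fun_def)
        finally show ?thesis .
      qed
      have ur': "u (x + y) - q x \<le> u y" if "q \<in> C" for q x y
      proof (rule greatest)
        fix r assume "r \<in> C"
        then show "u (x + y) - q x \<le> r y" using ur[OF \<open>q \<in> C\<close>, of r x y] by simp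
      qed
      have "u (x + y) - u y \<le> u x" for x y
      proof (rule greatest)
        fix r assume "r \<in> C"
        then show "u (x + y) - u y \<le> r x" using ur'[of r x y] by simp
      qed
      then have add: "u (x + y) \<le> u x + u y" for x y by (simp add: algebra_simps)
      have "u (t *\<^sub>R x) \<le> t * u x" if "t \<ge> 0" for t x
      proof (cases "t = 0")
        case True
        obtain q where "q \<in> C" using False by blast
        then show ?thesis using le[of q 0] sublinearD(3)[OF C(1)[of q]] True by simp
      next
        case False
        then have "t > 0" using that by simp
        have "u (t *\<^sub>R x) / t \<le> u x"
        proof (rule greatest)
          fix q assume "q \<in> C"
          then have "u (t *\<^sub>R x) \<le> t * q x"
            using le[of q "t *\<^sub>R x"] sublinearD(2)[OF C(1) that, of q x] by simp
          then show "u (t *\<^sub>R x) / t \<le> q x" using \<open>t > 0\<close> by (simp add: field_simps)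
        qed
        then show ?thesis using \<open>t > 0\<close> by (simp add: field_simps)
      qed
      with add have "sublinear u" by (simp add: sublinear_def)
      moreover have "u \<le> p"
      proof (rule le_funI)
        fix x
        obtain q where "q \<in> C" using False by blast
        then show "u x \<le> p x" using le[of q x] le_funD[OF C(2)[of q], of x] by simp
      qed
      ultimately show ?thesis using le by (auto simp: le_fun_def)
    qed
  qed
  then obtain m where m: "sublinear m" "m \<le> p" "\<And>r. sublinear r \<Longrightarrow> r \<le> p \<Longrightarrow> r \<le> m \<Longrightarrow> r = m"
    by blast
  have "r = m" if "sublinear r" "r \<le> m" for r
    using m(3)[OF that(1) order_trans[OF that(2) m(2)] that(2)] .
  with m(1,2) show ?thesis by blast
qed

lemma minimal_sublinear_linear:
  assumes q: "sublinear q" and min: "\<And>r. sublinear r \<Longrightarrow> r \<le> q \<Longrightarrow> r = q"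
  shows "linear q"
proof -
  have t: "tilt q a = q" for a
  proof (rule min)
    show "tilt q a \<le> q" using tilt_le[OF q, of 0 a] by (simp add: le_fun_def)
  qed (rule sublinear_tilt[OF q])
  have add: "q (x + a) = q x + q a" for x a
    using tilt_le[OF q, of 1 a x] sublinearD(1)[OF q, of x a] by (simp add: t)
  have neg: "q (- x) = - q x" for x using add[of x "-x"] sublinearD(3)[OF q] by simp
  have pos: "q (s *\<^sub>R x) = s * q x" if "s \<ge> 0" for s x
    using sublinearD(2)[OF q that, of x] sublinearD(2)[OF q that, of "-x"] by (simp add: neg)
  have "q (s *\<^sub>R x) = s * q x" for s x
    using pos[of s x] pos[of "-s" x] neg[of "s *\<^sub>R x"] by (cases "s \<ge> 0") auto
  with add show ?thesis by (intro linearI) auto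
qed

text \<open>
  A minimal sublinear functional below \<open>p\<close> is linear.  Starting from the tilted functional forces
  equality at \<open>v\<close>.
\<close>

theorem hahn_banach:
  assumes "sublinear p"
  shows "\<exists>q. linear q \<and> (\<forall>x. q x \<le> p x) \<and> q v = p v"
proof -
  obtain q where q: "sublinear q" "q \<le> tilt p v" "\<And>r. sublinear r \<Longrightarrow> r \<le> q \<Longrightarrow> r = q"
    using exists_minimal_sublinear[OF sublinear_tilt[OF assms]] by metis
  have lin: "linear q" by (rule minimal_sublinear_linear[OF q(1) q(3)])
  have le: "q x \<le> p x" for x
    using le_funD[OF q(2), of x] tilt_le[OF assms, of 0 v x] by simp
  have "q (- v) \<le> - p v"
    using le_funD[OF q(2), of "- v"] tilt_le[OF assms, of 1 v "-v"] sublinearD(3)[OF assms] by simp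
  then have "q v = p v" using le[of v] linear_neg[OF lin, of v] by simp
  with lin le show ?thesis by blast
qed

lemma linear_bounded_blinfun:
  fixes q :: "'a::real_normed_vector \<Rightarrow> real"
  assumes "linear q" "\<And>x. q x \<le> C * norm x"
  obtains \<phi> :: "'a \<Rightarrow>\<^sub>L real" where "\<And>x. blinfun_apply \<phi> x = q x"
proof -
  have "bounded_linear q"
  proof (rule bounded_linear_intro[of _ C])
    fix x
    show "norm (q x) \<le> norm x * C"
      using assms(2)[of x] assms(2)[of "-x"] linear_neg[OF assms(1), of x] by (simp add: abs_le_iff mult.commute)
  qed (simp_all add: linear_add[OF assms(1)] linear_scale[OF assms(1)])
  then show ?thesis using that[of "Blinfun q"] by (simp add: bounded_linear_Blinfun_apply)
qed

lemma norming_functional: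
  fixes x :: "'a::real_normed_vector"
  obtains \<phi> :: "'a \<Rightarrow>\<^sub>L real" where "norm \<phi> \<le> 1" "blinfun_apply \<phi> x = norm x"
proof -
  have "sublinear (norm :: 'a \<Rightarrow> real)"
    by (simp add: sublinear_def norm_triangle_ineq)
  then obtain q where q: "linear q" "\<And>y. q y \<le> norm y" "q x = norm x"
    using hahn_banach by metis
  then obtain \<phi> :: "'a \<Rightarrow>\<^sub>L real" where \<phi>: "\<And>y. blinfun_apply \<phi> y = q y"
    using linear_bounded_blinfun[of q 1] by auto
  have "norm \<phi> \<le> 1"
  proof (rule norm_blinfun_bound)
    fix y show "norm (blinfun_apply \<phi> y) \<le> 1 * norm y"
      using q(2)[of y] q(2)[of "-y"] linear_neg[OF q(1), of y] by (simp add: \<phi> abs_le_iff)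
  qed simp
  then show ?thesis using that \<phi> q(3) by simp
qed

lemma closed_subspace_separation:
  fixes Y :: "'a::real_normed_vector set"
  assumes "subspace Y" "closed Y" "v \<notin> Y"
  obtains \<phi> :: "'a \<Rightarrow>\<^sub>L real" where "\<And>y. y \<in> Y \<Longrightarrow> blinfun_apply \<phi> y = 0" "blinfun_apply \<phi> v \<noteq> 0"
proof -
  have ne: "Y \<noteq> {}" using subspace_0[OF assms(1)] by blast
  define p where "p x = infdist x Y" for x
  have p_eq: "p x = (INF y\<in>Y. norm (x - y))" for x
    using ne by (simp add: p_def infdist_def dist_norm)
  have lower: "p x \<le> norm (x - y)" if "y \<in> Y" for x y
    using infdist_le[OF that, of x] by (simp add: p_def dist_norm)
  have greatest: "c \<le> p x" if "\<And>y. y \<in> Y \<Longrightarrow> c \<le> norm (x - y)" for c x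
    unfolding p_eq by (rule cINF_greatest) (use ne that in auto)
  have sub: "sublinear p"
    unfolding sublinear_def
  proof (intro conjI allI impI)
    fix x x'
    have "p (x + x') - norm (x - y) \<le> norm (x' - y')" if "y \<in> Y" "y' \<in> Y" for y y'
    proof -
      have "p (x + x') \<le> norm ((x + x') - (y + y'))"
        by (intro lower subspace_add assms that)
      also have "\<dots> \<le> norm (x - y) + norm (x' - y')"
        using norm_triangle_ineq[of "x - y" "x' - y'"] by (simp add: algebra_simps)
      finally show ?thesis by simp
    qed
    then have "p (x + x') - norm (x - y) \<le> p x'" if "y \<in> Y" for y
      by (intro greatest) (use that in auto)
    then have "p (x + x') - p x' \<le> p x"
      by (intro greatest) (simp add: algebra_simps)
    then show "p (x + x') \<le> p x + p x'" by simp
  next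
    fix t :: real and x assume "t \<ge> 0"
    show "p (t *\<^sub>R x) \<le> t * p x"
    proof (cases "t = 0")
      case True
      then show ?thesis using lower[OF subspace_0[OF assms(1)], of 0] by simp
    next
      case False
      then have "t > 0" using \<open>t \<ge> 0\<close> by simp
      have "p (t *\<^sub>R x) / t \<le> p x"
      proof (rule greatest)
        fix y assume "y \<in> Y"
        then have "p (t *\<^sub>R x) \<le> norm (t *\<^sub>R x - t *\<^sub>R y)"
          by (intro lower subspace_scale assms)
        also have "\<dots> = t * norm (x - y)"
          using \<open>t > 0\<close> by (simp flip: scaleR_diff_right)
        finally show "p (t *\<^sub>R x) / t \<le> norm (x - y)" using \<open>t > 0\<close> by (simp add: field_simps)
      qed
      then show ?thesis using \<open>t > 0\<close> by (simp add: field_simps)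
    qed
  qed
  obtain q where q: "linear q" "\<And>x. q x \<le> p x" "q v = p v" using hahn_banach[OF sub] by metis
  have "q x \<le> 1 * norm x" for x
    using q(2)[of x] lower[OF subspace_0[OF assms(1)], of x] by simp
  then obtain \<phi> :: "'a \<Rightarrow>\<^sub>L real" where \<phi>: "\<And>x. blinfun_apply \<phi> x = q x"
    using linear_bounded_blinfun[OF q(1)] by metis
  have "q y = 0" if "y \<in> Y" for y
    using q(2)[of y] q(2)[of "-y"] lower[OF that, of y] lower[of "-y" "-y"]
      subspace_neg[OF assms(1) that] linear_neg[OF q(1), of y] by simp
  moreover have "q v > 0"
    using assms(2,3) ne q(3) infdist_nonneg[of v Y] in_closed_iff_infdist_zero[of Y v]
    by (simp add: p_def)
  ultimately show ?thesis using that \<phi> by (metis less_irrefl)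
qed

section \<open>Weak sequential compactness in reflexive spaces\<close>

text \<open>
  Bounded closed subsets of finite-dimensional subspaces are compact, by induction on a spanning set:
  the distance of a new vector to the span controls its coefficient.
\<close>

lemma compact_span_cball:
  fixes B :: "'a::real_normed_vector set"
  assumes "finite B"
  shows "compact (span B \<inter> cball 0 R)"
  using assms
proof (induction B arbitrary: R rule: finite_induct)
  case empty
  have "span {} \<inter> cball 0 R \<subseteq> {0::'a}" by simp
  then show ?case using finite_subset finite_imp_compact by blast
next
  case (insert b B)
  have closed: "closed (span B)"
    unfolding closed_sequential_limits
  proof (intro allI impI, elim conjE)
    fix x :: "nat \<Rightarrow> 'a" and l assume x: "\<forall>n. x n \<in> span B" "x \<longlonglongrightarrow> l"
    then obtain r where r: "\<And>n. norm (x n) \<le> r"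
      using convergent_imp_Bseq[of x] by (auto simp: convergent_def Bseq_def)
    have "closed (span B \<inter> cball 0 r)" using insert.IH by (rule compact_imp_closed)
    then have "l \<in> span B \<inter> cball 0 r"
      by (rule closed_sequentially[OF _ _ x(2)]) (use x r in auto)
    then show "l \<in> span B" by simp
  qed
  show ?case
  proof (cases "b \<in> span B")
    case True
    then show ?thesis using insert.IH by (simp add: span_redundant)
  next
    case False
    define d where "d = infdist b (span B)"
    have "d > 0"
      using closed False in_closed_iff_infdist_zero[of "span B" b] span_0[of B] infdist_nonneg[of b "span B"]
      unfolding d_def by (metis empty_iff less_eq_real_def)
    have coeff: "\<bar>t\<bar> * d \<le> norm (x + t *\<^sub>R b)" if "x \<in> span B" for x t
    proof (cases "t = 0")
      case False
      have "d \<le> dist b ((- 1 / t) *\<^sub>R x)"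
        unfolding d_def by (intro infdist_le span_scale that)
      also have "\<dots> = norm (x + t *\<^sub>R b) / \<bar>t\<bar>"
      proof -
        have "b - (- 1 / t) *\<^sub>R x = (1 / t) *\<^sub>R (x + t *\<^sub>R b)" using False by (simp add: algebra_simps)
        then show ?thesis using False by (simp add: dist_norm)
      qed
      finally show ?thesis using False by (simp add: field_simps)
    qed simp
    let ?T = "R / d"
    let ?K = "(\<lambda>(x, t). x + t *\<^sub>R b) ` ((span B \<inter> cball 0 (R + ?T * norm b)) \<times> {- ?T..?T})"
    have "compact ?K"
      by (intro compact_continuous_image compact_Times insert.IH compact_Icc)
        (auto simp: case_prod_unfold intro!: continuous_intros)
    moreover have "span (insert b B) \<inter> cball 0 R = ?K \<inter> cball 0 R"
    proof (intro equalityI subsetI)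
      fix z assume z: "z \<in> span (insert b B) \<inter> cball 0 R"
      then obtain t where t: "z - t *\<^sub>R b \<in> span B" by (auto simp: span_insert)
      have "\<bar>t\<bar> * d \<le> R" using coeff[OF t, of t] z by simp
      then have T: "\<bar>t\<bar> \<le> ?T" using \<open>d > 0\<close> by (simp add: field_simps)
      have "norm (z - t *\<^sub>R b) \<le> norm z + \<bar>t\<bar> * norm b"
        using norm_triangle_ineq4[of z "t *\<^sub>R b"] by simp
      also have "\<dots> \<le> R + ?T * norm b" using z T by (intro add_mono mult_right_mono) auto
      finally have "(z - t *\<^sub>R b, t) \<in> (span B \<inter> cball 0 (R + ?T * norm b)) \<times> {- ?T..?T}"
        using t T by (auto simp: abs_le_iff minus_le_iff)
      then have "z \<in> ?K" by (rule rev_image_eqI) simp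
      then show "z \<in> ?K \<inter> cball 0 R" using z by blast
    next
      fix z assume "z \<in> ?K \<inter> cball 0 R"
      then obtain x t where "x \<in> span B" "z = x + t *\<^sub>R b" "z \<in> cball 0 R" by auto
      then show "z \<in> span (insert b B) \<inter> cball 0 R" by (auto simp: span_insert intro: exI[of _ t])
    qed
    ultimately show ?thesis by (simp add: compact_Int_closed)
  qed
qed

lemma subspace_closure:
  fixes V :: "'a::real_normed_vector set"
  assumes "subspace V"
  shows "subspace (closure V)"
proof (rule subspaceI)
  show "0 \<in> closure V" using subspace_0[OF assms] closure_subset by blast
next
  fix x y assume "x \<in> closure V" "y \<in> closure V"
  then obtain f g where fg: "\<And>n. f n \<in> V" "f \<longlonglongrightarrow> x" "\<And>n. g n \<in> V" "g \<longlonglongrightarrow> y"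
    unfolding closure_sequential by blast
  have "(\<lambda>n. f n + g n) \<longlonglongrightarrow> x + y" by (intro tendsto_add fg)
  moreover have "f n + g n \<in> V" for n by (intro subspace_add assms fg)
  ultimately show "x + y \<in> closure V"
    unfolding closure_sequential by (intro exI[of _ "\<lambda>n. f n + g n"]) simp
next
  fix c :: real and x assume "x \<in> closure V"
  then obtain f where f: "\<And>n. f n \<in> V" "f \<longlonglongrightarrow> x"
    unfolding closure_sequential by blast
  have "(\<lambda>n. c *\<^sub>R f n) \<longlonglongrightarrow> c *\<^sub>R x" by (intro tendsto_scaleR tendsto_const f)
  moreover have "c *\<^sub>R f n \<in> V" for n by (intro subspace_scale assms f)
  ultimately show "c *\<^sub>R x \<in> closure V"
    unfolding closure_sequential by (intro exI[of _ "\<lambda>n. c *\<^sub>R f n"]) simp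
qed

lemma subspace_UN_incseq:
  fixes V :: "nat \<Rightarrow> 'a::real_vector set"
  assumes "\<And>n. subspace (V n)" "incseq V"
  shows "subspace (\<Union>n. V n)"
proof (rule subspaceI)
  fix x y assume "x \<in> (\<Union>n. V n)" "y \<in> (\<Union>n. V n)"
  then obtain m n where "x \<in> V m" "y \<in> V n" by blast
  moreover have "V m \<subseteq> V (max m n)" "V n \<subseteq> V (max m n)" using assms(2) by (auto simp: incseq_def)
  ultimately have "x + y \<in> V (max m n)" using subspace_add[OF assms(1)] by blast
  then show "x + y \<in> (\<Union>n. V n)" by blast
qed (use assms(1) subspace_0 subspace_scale in blast)+

lemma span_range_eq_UN: "span (range u) = (\<Union>n. span (u ` {..<n::nat}))"
proof
  have "incseq (\<lambda>n. span (u ` {..<n}))" by (auto simp: incseq_def intro!: span_mono)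
  then have "subspace (\<Union>n. span (u ` {..<n}))" by (intro subspace_UN_incseq subspace_span)
  moreover have "range u \<subseteq> (\<Union>n. span (u ` {..<n}))"
    by (auto intro!: exI[of _ "Suc _"] span_base)
  ultimately show "span (range u) \<subseteq> (\<Union>n. span (u ` {..<n}))" by (rule span_minimal[rotated])
  show "(\<Union>n. span (u ` {..<n})) \<subseteq> span (range u)" by (auto intro: span_mono[THEN subsetD, rotated])
qed

lemma countable_dense_closure_span:
  fixes u :: "nat \<Rightarrow> 'a::real_normed_vector"
  obtains Q where "countable Q" "\<And>y e. y \<in> closure (span (range u)) \<Longrightarrow> e > 0 \<Longrightarrow> \<exists>q\<in>Q. dist q y < e"
proof -
  have "\<exists>T. finite T \<and> span (u ` {..<n}) \<inter> cball 0 (real k) \<subseteq> (\<Union>q\<in>T. ball q (1 / real (Suc m)))" for n k m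
  proof -
    have "compact (span (u ` {..<n}) \<inter> cball 0 (real k))" by (rule compact_span_cball) simp
    then obtain T where "finite T" "span (u ` {..<n}) \<inter> cball 0 (real k) \<subseteq> (\<Union>q\<in>T. ball q (1 / real (Suc m)))"
      using seq_compact_imp_totally_bounded[OF compact_imp_seq_compact, rule_format, of _ "1 / real (Suc m)"]
      by (metis divide_pos_pos of_nat_0_less_iff zero_less_Suc zero_less_one)
    then show ?thesis by blast
  qed
  then obtain T where T: "\<And>n k m. finite (T n k m)"
    "\<And>n k m. span (u ` {..<n}) \<inter> cball 0 (real k) \<subseteq> (\<Union>q\<in>T n k m. ball q (1 / real (Suc m)))"
    by metis
  show ?thesis
  proof (rule that[of "\<Union>n k m. T n k m"])
    show "countable (\<Union>n k m. T n k m)" by (intro countable_UN[OF countableI_type] countable_finite T(1))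
    fix y and e :: real assume y: "y \<in> closure (span (range u))" and "e > 0"
    obtain z where z: "z \<in> span (range u)" "dist z y < e / 2"
      using y \<open>e > 0\<close> unfolding closure_approachable by (metis half_gt_zero)
    obtain n where n: "z \<in> span (u ` {..<n})" using z(1) unfolding span_range_eq_UN by blast
    obtain k where k: "norm z \<le> real k" using real_arch_simple by blast
    obtain m where m: "1 / real (Suc m) < e / 2" using \<open>e > 0\<close> by (metis half_gt_zero nat_approx_posE)
    obtain q where q: "q \<in> T n k m" "dist q z < 1 / real (Suc m)" using T(2)[of n k m] n k by force
    have "dist q y < e" using dist_triangle[of q y z] q(2) m z(2) by linarith
    then show "\<exists>q\<in>(\<Union>n k m. T n k m). dist q y < e" using q(1) by blast
  qed
qed

text \<open>
  A bounded sequence has a weak limit along some proper filter finer than \<open>sequentially\<close>: by Tychonoff's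
  theorem the evaluations cluster pointwise at a functional on the dual, which reflexivity
  represents by a vector.
\<close>

lemma bounded_weak_filter_limit:
  fixes u :: "nat \<Rightarrow> 'a::real_normed_vector"
  assumes refl: "reflexive_space TYPE('a)" and R: "\<And>n. norm (u n) \<le> R"
  obtains G l where "G \<noteq> bot" "G \<le> sequentially"
    "\<And>\<phi> :: 'a \<Rightarrow>\<^sub>L real. ((\<lambda>n. blinfun_apply \<phi> (u n)) \<longlongrightarrow> blinfun_apply \<phi> l) G"
proof -
  let ?h = "\<lambda>n (\<phi> :: 'a \<Rightarrow>\<^sub>L real). blinfun_apply \<phi> (u n)"
  let ?K = "PiE UNIV (\<lambda>\<phi> :: 'a \<Rightarrow>\<^sub>L real. {- (R * norm \<phi>)..R * norm \<phi>})"
  have b: "\<bar>?h n \<phi>\<bar> \<le> R * norm \<phi>" for n \<phi>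
    using norm_blinfun[of \<phi> "u n"] mult_left_mono[OF R[of n] norm_ge_zero[of \<phi>]] by (simp add: mult.commute)
  have "compactin (product_topology (\<lambda>_. euclideanreal) UNIV) ?K"
    by (simp add: compactin_PiE)
  then have "compact ?K" by (simp add: euclidean_product_topology)
  moreover have "filtermap ?h sequentially \<noteq> bot" by (simp add: filtermap_bot_iff)
  moreover have "eventually (\<lambda>x. x \<in> ?K) (filtermap ?h sequentially)"
    using b by (auto simp: eventually_filtermap abs_le_iff minus_le_iff intro!: always_eventually)
  ultimately obtain \<Phi> where \<Phi>: "inf (nhds \<Phi>) (filtermap ?h sequentially) \<noteq> bot"
    unfolding compact_filter by blast
  define G where "G = inf (filtercomap ?h (nhds \<Phi>)) sequentially"
  have "G \<noteq> bot"
  proof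
    assume "G = bot"
    then have "eventually (\<lambda>_. False) G" by simp
    then obtain P Q where PQ: "eventually P (filtercomap ?h (nhds \<Phi>))" "eventually Q sequentially"
      "\<And>n. P n \<Longrightarrow> Q n \<Longrightarrow> False"
      unfolding G_def eventually_inf by blast
    from PQ(1) obtain P' where P': "eventually P' (nhds \<Phi>)" "\<And>n. P' (?h n) \<Longrightarrow> P n"
      unfolding eventually_filtercomap by blast
    have "eventually (\<lambda>y. \<exists>n. y = ?h n \<and> Q n) (filtermap ?h sequentially)"
      unfolding eventually_filtermap using PQ(2) by eventually_elim blast
    with P'(1) have "eventually (\<lambda>_. False) (inf (nhds \<Phi>) (filtermap ?h sequentially))"
      unfolding eventually_inf using PQ(3) P'(2) by blast
    then show False using \<Phi> by (simp add: trivial_limit_def)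
  qed
  have "filterlim ?h (nhds \<Phi>) G"
    unfolding G_def by (rule filterlim_mono[OF filterlim_filtercomap order_refl inf_le1])
  then have lim: "((\<lambda>n. ?h n \<phi>) \<longlongrightarrow> \<Phi> \<phi>) G" for \<phi>
  proof -
    show ?thesis
    proof (rule topological_tendstoI)
      fix U assume "open U" "\<Phi> \<phi> \<in> U"
      have "open ((\<lambda>x :: ('a \<Rightarrow>\<^sub>L real) \<Rightarrow> real. x \<phi>) -` U)"
        by (intro open_vimage \<open>open U\<close> continuous_on_product_then_coordinatewise[OF continuous_on_id])
      then have "eventually (\<lambda>n. ?h n \<in> (\<lambda>x. x \<phi>) -` U) G"
        using \<open>filterlim ?h (nhds \<Phi>) G\<close> \<open>\<Phi> \<phi> \<in> U\<close> by (intro topological_tendstoD) auto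
      then show "eventually (\<lambda>n. ?h n \<phi> \<in> U) G" by simp
    qed
  qed
  have "linear \<Phi>"
  proof (rule linearI)
    fix \<phi> \<psi>
    have "((\<lambda>n. ?h n (\<phi> + \<psi>)) \<longlongrightarrow> \<Phi> \<phi> + \<Phi> \<psi>) G"
      using tendsto_add[OF lim lim] by (simp add: plus_blinfun.rep_eq)
    then show "\<Phi> (\<phi> + \<psi>) = \<Phi> \<phi> + \<Phi> \<psi>" using tendsto_unique[OF \<open>G \<noteq> bot\<close> lim] by blast
  next
    fix c \<phi>
    have "((\<lambda>n. ?h n (c *\<^sub>R \<phi>)) \<longlongrightarrow> c * \<Phi> \<phi>) G"
      using tendsto_mult_left[OF lim] by (simp add: scaleR_blinfun.rep_eq)
    then show "\<Phi> (c *\<^sub>R \<phi>) = c *\<^sub>R \<Phi> \<phi>" using tendsto_unique[OF \<open>G \<noteq> bot\<close> lim] by auto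
  qed
  moreover have "\<Phi> \<phi> \<le> R * norm \<phi>" for \<phi>
    by (rule tendsto_upperbound[OF lim _ \<open>G \<noteq> bot\<close>]) (use b in \<open>auto simp: abs_le_iff intro!: always_eventually\<close>)
  ultimately obtain \<Psi> :: "('a \<Rightarrow>\<^sub>L real) \<Rightarrow>\<^sub>L real" where "\<And>\<phi>. blinfun_apply \<Psi> \<phi> = \<Phi> \<phi>"
    using linear_bounded_blinfun by metis
  then obtain l where "\<And>\<phi>. \<Phi> \<phi> = blinfun_apply \<phi> l"
    using refl unfolding reflexive_space_def by metis
  then show ?thesis
    using that[of G l] lim \<open>G \<noteq> bot\<close> by (simp add: G_def)
qed

lemma weak_limit_in_closed_subspace:
  fixes u :: "nat \<Rightarrow> 'a::real_normed_vector"
  assumes "subspace Y" "closed Y" "\<And>n. u n \<in> Y" "G \<noteq> bot"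
    "\<And>\<phi> :: 'a \<Rightarrow>\<^sub>L real. ((\<lambda>n. blinfun_apply \<phi> (u n)) \<longlongrightarrow> blinfun_apply \<phi> l) G"
  shows "l \<in> Y"
proof (rule ccontr)
  assume "l \<notin> Y"
  then obtain \<phi> :: "'a \<Rightarrow>\<^sub>L real" where \<phi>: "\<And>y. y \<in> Y \<Longrightarrow> blinfun_apply \<phi> y = 0" "blinfun_apply \<phi> l \<noteq> 0"
    using closed_subspace_separation[OF assms(1,2)] by metis
  have "((\<lambda>n. 0) \<longlongrightarrow> blinfun_apply \<phi> l) G" using assms(5)[of \<phi>] \<phi>(1)[OF assms(3)] by simp
  then show False using tendsto_unique[OF assms(4) tendsto_const] \<phi>(2) by metis
qed

text \<open>
  The closed span \<open>Y\<close> of the sequence is separable, so countably many functionals separate its points.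
  A diagonal argument makes all of these converge along a subsequence.  Every weak limit along a finer
  filter lies in \<open>Y\<close> and is determined by them, so that the subsequence converges weakly.
\<close>

theorem weak_sequential_compactness:
  fixes u :: "nat \<Rightarrow> 'a::real_normed_vector"
  assumes refl: "reflexive_space TYPE('a)" and bd: "\<And>n. norm (u n) \<le> R"
  obtains r l where "strict_mono r" "weakly_converges (u \<circ> r) l"
proof -
  let ?Y = "closure (span (range u))"
  have Y: "subspace ?Y" "closed ?Y" by (simp_all add: subspace_closure)
  obtain Q where Q: "countable Q" "\<And>y e. y \<in> ?Y \<Longrightarrow> e > 0 \<Longrightarrow> \<exists>q\<in>Q. dist q y < e"
    using countable_dense_closure_span by blast
  have "Q \<noteq> {}" using Q(2)[of 0 1] subspace_0[OF Y(1)] by auto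
  have "\<exists>\<phi> :: 'a \<Rightarrow>\<^sub>L real. norm \<phi> \<le> 1 \<and> blinfun_apply \<phi> q = norm q" for q
    using norming_functional by metis
  then obtain D :: "'a \<Rightarrow> 'a \<Rightarrow>\<^sub>L real" where D: "\<And>q. norm (D q) \<le> 1" "\<And>q. blinfun_apply (D q) q = norm q"
    by metis
  have sep: "y = 0" if y: "y \<in> ?Y" and z: "\<And>q. q \<in> Q \<Longrightarrow> blinfun_apply (D q) y = 0" for y
  proof (rule ccontr)
    assume "y \<noteq> 0"
    then obtain q where q: "q \<in> Q" "dist q y < norm y / 2" using Q(2)[OF y, of "norm y / 2"] by auto
    have "norm q = blinfun_apply (D q) (q - y)" using D(2)[of q] z[OF q(1)] by (simp add: blinfun.diff_right)
    also have "\<dots> \<le> norm (q - y)"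
      using norm_blinfun[of "D q" "q - y"] mult_right_mono[OF D(1)[of q] norm_ge_zero[of "q - y"]] by simp
    finally show False using q(2) norm_triangle_ineq2[of y q] by (simp add: dist_norm norm_minus_commute)
  qed
  define d where "d n = D (from_nat_into Q n)" for n
  \<comment> \<open>The norming functionals of a dense set separate the points of \<open>Y\<close>.\<close>
  interpret subseqs "\<lambda>n s. convergent (\<lambda>k. blinfun_apply (d n) (u (s k)))"
  proof
    fix n and s :: "nat \<Rightarrow> nat"
    have "\<bar>blinfun_apply (d n) (u (s k))\<bar> \<le> norm (d n) * R" for k
      using norm_blinfun[of "d n" "u (s k)"] mult_left_mono[OF bd[of "s k"] norm_ge_zero[of "d n"]] by simp
    then have "bounded (range (\<lambda>k. blinfun_apply (d n) (u (s k))))"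
      by (auto simp: bounded_iff)
    then obtain l r where "strict_mono r" "((\<lambda>k. blinfun_apply (d n) (u (s k))) \<circ> r) \<longlonglongrightarrow> l"
      using bounded_imp_convergent_subsequence by blast
    then show "\<exists>r'. strict_mono r' \<and> convergent (\<lambda>k. blinfun_apply (d n) (u ((s \<circ> r') k)))"
      by (auto simp: convergent_def o_def)
  qed
  define r where "r = diagseq"
  have mono_r: "strict_mono r" unfolding r_def by (rule subseq_diagseq)
  have conv: "convergent (\<lambda>k. blinfun_apply (d n) (u (r k)))" for n
  proof -
    have "convergent (\<lambda>k. blinfun_apply (d n) (u ((diagseq \<circ> ((+) (Suc n))) k)))"
    proof (rule diagseq_holds)
      fix s t :: "nat \<Rightarrow> nat" and n assume "strict_mono s" "convergent (\<lambda>k. blinfun_apply (d n) (u (t k)))"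
      then show "convergent (\<lambda>k. blinfun_apply (d n) (u ((t \<circ> s) k)))"
        using convergent_subseq_convergent[of "\<lambda>k. blinfun_apply (d n) (u (t k))" s] by (simp add: o_def)
    qed
    then have "convergent (\<lambda>k. blinfun_apply (d n) (u (r (k + Suc n))))"
      by (simp add: r_def add.commute)
    then show ?thesis by (rule convergent_ignore_initial_segment[THEN iffD1])
  qed
  obtain G l where G: "G \<noteq> bot" "G \<le> sequentially"
    "\<And>\<phi> :: 'a \<Rightarrow>\<^sub>L real. ((\<lambda>n. blinfun_apply \<phi> ((u \<circ> r) n)) \<longlongrightarrow> blinfun_apply \<phi> l) G"
    by (rule bounded_weak_filter_limit[OF refl, of "u \<circ> r" R]) (simp add: bd, rule that)
  have uY: "u n \<in> ?Y" for n
    using closure_subset[of "span (range u)"] span_base[of "u n" "range u"] by auto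
  have lY: "l \<in> ?Y" by (rule weak_limit_in_closed_subspace[OF Y _ G(1,3)]) (use uY in simp)
  have dlim: "(\<lambda>k. blinfun_apply (d n) (u (r k))) \<longlonglongrightarrow> blinfun_apply (d n) l" for n
  proof -
    obtain a where a: "(\<lambda>k. blinfun_apply (d n) (u (r k))) \<longlonglongrightarrow> a" using conv by (auto simp: convergent_def)
    then have "((\<lambda>k. blinfun_apply (d n) (u (r k))) \<longlongrightarrow> a) G" using G(2) by (rule tendsto_mono[rotated])
    with G(1) G(3)[of "d n"] have "a = blinfun_apply (d n) l" by (auto intro: tendsto_unique)
    with a show ?thesis by simp
  qed
  have "weakly_converges (u \<circ> r) l"
    unfolding weakly_converges_def
  proof (rule allI, rule ccontr)
    fix \<psi> :: "'a \<Rightarrow>\<^sub>L real"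
    assume "\<not> (\<lambda>j. blinfun_apply \<psi> ((u \<circ> r) j)) \<longlonglongrightarrow> blinfun_apply \<psi> l"
    then obtain e where e: "e > 0" "\<And>N. \<exists>n\<ge>N. e \<le> \<bar>blinfun_apply \<psi> (u (r n)) - blinfun_apply \<psi> l\<bar>"
      unfolding LIMSEQ_iff by (auto simp: not_less)
    \<comment> \<open>Otherwise a further subsequence would have a different weak limit \<open>m\<close> along a filter.\<close>
    define B where "B = {n. e \<le> \<bar>blinfun_apply \<psi> (u (r n)) - blinfun_apply \<psi> l\<bar>}"
    have "infinite B" using e(2) by (auto simp: infinite_nat_iff_unbounded_le B_def)
    define t where "t = enumerate B"
    have t: "strict_mono t" "\<And>n. e \<le> \<bar>blinfun_apply \<psi> (u (r (t n))) - blinfun_apply \<psi> l\<bar>"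
      using \<open>infinite B\<close> enumerate_in_set[OF \<open>infinite B\<close>]
      by (auto simp: t_def strict_mono_enumerate B_def)
    obtain H m where H: "H \<noteq> bot" "H \<le> sequentially"
      "\<And>\<phi> :: 'a \<Rightarrow>\<^sub>L real. ((\<lambda>n. blinfun_apply \<phi> ((u \<circ> r \<circ> t) n)) \<longlongrightarrow> blinfun_apply \<phi> m) H"
      by (rule bounded_weak_filter_limit[OF refl, of "u \<circ> r \<circ> t" R]) (simp add: bd, rule that)
    have mY: "m \<in> ?Y" by (rule weak_limit_in_closed_subspace[OF Y _ H(1,3)]) (use uY in simp)
    have "m - l = 0"
    proof (rule sep)
      show "m - l \<in> ?Y" by (intro subspace_diff Y mY lY)
      fix q assume "q \<in> Q"
      then obtain n where n: "D q = d n"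
        using from_nat_into_surj[OF Q(1)] by (metis d_def)
      have "((\<lambda>k. blinfun_apply (d n) (u (r (t k)))) \<longlongrightarrow> blinfun_apply (d n) l) H"
        using LIMSEQ_subseq_LIMSEQ[OF dlim t(1), of n] H(2) by (auto simp: o_def intro: tendsto_mono)
      then have "blinfun_apply (d n) m = blinfun_apply (d n) l"
        using tendsto_unique[OF H(1)] H(3)[of "d n"] by auto
      then show "blinfun_apply (D q) (m - l) = 0" by (simp add: n blinfun.diff_right)
    qed
    then have "m = l" by simp
    have "((\<lambda>n. \<bar>blinfun_apply \<psi> (u (r (t n))) - blinfun_apply \<psi> l\<bar>) \<longlongrightarrow> \<bar>blinfun_apply \<psi> m - blinfun_apply \<psi> l\<bar>) H"
      using H(3)[of \<psi>] by (intro tendsto_rabs tendsto_diff tendsto_const) (simp add: o_def)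
    then have "e \<le> \<bar>blinfun_apply \<psi> m - blinfun_apply \<psi> l\<bar>"
      by (rule tendsto_lowerbound) (use t(2) H(1) in \<open>auto intro: always_eventually\<close>)
    with \<open>m = l\<close> e(1) show False by simp
  qed
  with mono_r show ?thesis by (rule that)
qed

section \<open>Potentials and the level set of a coercive potential\<close>

lemma potential_eq:
  assumes "\<And>u. (G has_derivative blinfun_apply (g u)) (at u)" "G 0 = 0"
  shows "potential g u = G u"
proof -
  have "((\<lambda>\<tau>. blinfun_apply (g (\<tau> *\<^sub>R u)) u) has_integral (G (1 *\<^sub>R u) - G (0 *\<^sub>R u))) {0..1}"
  proof (rule fundamental_theorem_of_calculus)
    fix \<tau> :: real
    have "((\<lambda>\<tau>. \<tau> *\<^sub>R u) has_derivative (\<lambda>h. h *\<^sub>R u)) (at \<tau> within {0..1})"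
      by (auto intro!: derivative_eq_intros)
    from has_derivative_compose[OF this assms(1)]
    show "((\<lambda>\<tau>. G (\<tau> *\<^sub>R u)) has_vector_derivative blinfun_apply (g (\<tau> *\<^sub>R u)) u) (at \<tau> within {0..1})"
      by (simp add: has_vector_derivative_def blinfun.scaleR_right)
  qed simp
  then show ?thesis by (simp add: potential_def integral_unique assms(2))
qed

lemma potential_has_derivative:
  assumes "potential_operator g"
  shows "(potential g has_derivative blinfun_apply (g u)) (at u)"
proof -
  obtain G where "G 0 = 0" "\<And>u. (G has_derivative blinfun_apply (g u)) (at u)"
    using assms unfolding potential_operator_def by blast
  moreover from this have "potential g = G" using potential_eq by blast
  ultimately show ?thesis by simp
qed

lemma potential_line_derivative:
  assumes "potential_operator g"
  shows "((\<lambda>s. potential g (u + s *\<^sub>R v)) has_real_derivative blinfun_apply (g (u + s *\<^sub>R v)) v) (at s)"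
proof -
  have "((\<lambda>s. u + s *\<^sub>R v) has_derivative (\<lambda>h. h *\<^sub>R v)) (at s)"
    by (auto intro!: derivative_eq_intros)
  from has_derivative_compose[OF this potential_has_derivative[OF assms]]
  show ?thesis by (simp add: has_field_derivative_def blinfun.scaleR_right mult_commute_abs)
qed

lemma continuous_potential:
  assumes "potential_operator g"
  shows "continuous_on S (potential g)"
  using has_derivative_continuous[OF potential_has_derivative[OF assms]]
  by (auto intro: continuous_at_imp_continuous_on)

lemma potential_0 [simp]: "potential g 0 = 0"
  by (simp add: potential_def)

lemma potential_even:
  assumes "\<And>u. g (- u) = - g u"
  shows "potential g (- u) = potential g u"
  by (simp add: potential_def assms blinfun.minus_left blinfun.minus_right)

lemma potential_ray_strict_mono:
  assumes g: "potential_operator g" and pos: "\<And>u. u \<noteq> 0 \<Longrightarrow> blinfun_apply (g u) u > 0"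
    and "u \<noteq> 0" "0 \<le> s" "s < t"
  shows "potential g (s *\<^sub>R u) < potential g (t *\<^sub>R u)"
proof (rule DERIV_pos_imp_increasing_open[OF \<open>s < t\<close>])
  fix r assume "s < r" "r < t"
  then have "r > 0" using \<open>0 \<le> s\<close> by simp
  have "blinfun_apply (g (r *\<^sub>R u)) (r *\<^sub>R u) > 0" using \<open>r > 0\<close> \<open>u \<noteq> 0\<close> by (intro pos) simp
  then have "blinfun_apply (g (r *\<^sub>R u)) u > 0"
    using \<open>r > 0\<close> by (simp add: blinfun.scaleR_right zero_less_mult_iff)
  then show "\<exists>y. ((\<lambda>s. potential g (s *\<^sub>R u)) has_real_derivative y) (at r) \<and> 0 < y"
    using potential_line_derivative[OF g, of 0 u r] by auto
next
  show "continuous_on {s..t} (\<lambda>s. potential g (s *\<^sub>R u))"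
    by (intro continuous_on_compose2[OF continuous_potential[OF g, of UNIV]] continuous_intros) auto
qed

lemma potential_pos:
  assumes "potential_operator g" "\<And>u. u \<noteq> 0 \<Longrightarrow> blinfun_apply (g u) u > 0" "u \<noteq> 0"
  shows "potential g u > 0"
  using potential_ray_strict_mono[OF assms, of 0 1] by simp

lemma potential_mean_value:
  assumes "potential_operator g"
  obtains \<tau> where "0 < \<tau>" "\<tau> < 1" "potential g u = blinfun_apply (g (\<tau> *\<^sub>R u)) u"
proof -
  have "\<exists>z>0. z < 1 \<and> potential g (0 + 1 *\<^sub>R u) - potential g (0 + 0 *\<^sub>R u)
      = (1 - 0) * blinfun_apply (g (0 + z *\<^sub>R u)) u"
    by (rule MVT2) (use potential_line_derivative[OF assms, of 0 u] in auto)
  then show ?thesis using that by auto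
qed

text \<open>
  Two odd potential operators that are positive along rays, the first with a coercive potential.
\<close>

locale variational_pair =
  fixes A f :: "'a::real_normed_vector \<Rightarrow> 'a \<Rightarrow>\<^sub>L real"
  assumes A_pot: "potential_operator A" and A_odd: "\<And>u. A (- u) = - A u"
    and A_pos: "\<And>u. u \<noteq> 0 \<Longrightarrow> blinfun_apply (A u) u > 0"
    and A_coercive: "filterlim (potential A) at_top at_infinity"
    and f_pot: "potential_operator f" and f_odd: "\<And>u. f (- u) = - f u"
    and f_pos: "\<And>u. u \<noteq> 0 \<Longrightarrow> blinfun_apply (f u) u > 0"
begin

abbreviation "I \<equiv> potential A"
abbreviation "F \<equiv> potential f"
abbreviation "M \<equiv> unit_level A"

lemma continuous_I: "continuous_on S I" by (rule continuous_potential[OF A_pot])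
lemma continuous_F: "continuous_on S F" by (rule continuous_potential[OF f_pot])
lemma continuous_A: "continuous_on S A"
  using A_pot continuous_on_subset by (auto simp: potential_operator_def)
lemma continuous_f: "continuous_on S f"
  using f_pot continuous_on_subset by (auto simp: potential_operator_def)

lemma I_even: "I (- u) = I u" using potential_even[of A] A_odd by blast
lemma F_even: "F (- u) = F u" using potential_even[of f] f_odd by blast

lemma I_ray: "u \<noteq> 0 \<Longrightarrow> 0 \<le> s \<Longrightarrow> s < t \<Longrightarrow> I (s *\<^sub>R u) < I (t *\<^sub>R u)"
  by (rule potential_ray_strict_mono[OF A_pot]) (simp_all add: A_pos)

lemma F_ray: "u \<noteq> 0 \<Longrightarrow> 0 \<le> s \<Longrightarrow> s < t \<Longrightarrow> F (s *\<^sub>R u) < F (t *\<^sub>R u)"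
  by (rule potential_ray_strict_mono[OF f_pot]) (simp_all add: f_pos)

lemma F_pos: "u \<noteq> 0 \<Longrightarrow> F u > 0"
  by (rule potential_pos[OF f_pot]) (simp_all add: f_pos)

lemma M_nonzero: "u \<in> M \<Longrightarrow> u \<noteq> 0" by (auto simp: unit_level_def)

lemma I_large: obtains R where "R > 0" "\<And>u. norm u \<ge> R \<Longrightarrow> I u > 1"
proof -
  have "eventually (\<lambda>u. I u > 1) at_infinity"
    using A_coercive by (simp add: filterlim_at_top_dense)
  then obtain b where b: "\<And>u. norm u \<ge> b \<Longrightarrow> I u > 1" by (auto simp: eventually_at_infinity)
  show ?thesis by (rule that[of "max 1 b"]) (use b in auto)
qed

lemma M_bounded: obtains R where "R > 0" "\<And>u. u \<in> M \<Longrightarrow> norm u \<le> R"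
proof -
  obtain R where R: "R > 0" "\<And>u. norm u \<ge> R \<Longrightarrow> I u > 1" using I_large by metis
  show ?thesis
  proof (rule that[OF R(1)])
    fix u assume "u \<in> M"
    then show "norm u \<le> R" using R(2)[of u] by (cases "norm u \<le> R") (auto simp: unit_level_def)
  qed
qed

lemma radial_ex1:
  assumes "u \<noteq> 0"
  shows "\<exists>!\<theta>. \<theta> > 0 \<and> I (\<theta> *\<^sub>R u) = 1"
proof -
  obtain R where R: "R > 0" "\<And>u. norm u \<ge> R \<Longrightarrow> I u > 1" using I_large by metis
  let ?b = "R / norm u"
  have "?b > 0" using R(1) assms by simp
  have "I (?b *\<^sub>R u) > 1" by (rule R(2)) (use assms R(1) in simp)
  then have "\<exists>\<theta>. 0 \<le> \<theta> \<and> \<theta> \<le> ?b \<and> I (\<theta> *\<^sub>R u) = 1"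
    using \<open>?b > 0\<close> by (intro IVT' continuous_on_compose2[OF continuous_I[of UNIV]] continuous_intros) auto
  then obtain \<theta> where \<theta>: "0 \<le> \<theta>" "I (\<theta> *\<^sub>R u) = 1" by blast
  then have "\<theta> > 0" by (cases "\<theta> = 0") auto
  show ?thesis
  proof (rule ex1I[of _ \<theta>])
    fix t assume t: "t > 0 \<and> I (t *\<^sub>R u) = 1"
    show "t = \<theta>"
      using I_ray[OF assms, of t \<theta>] I_ray[OF assms, of \<theta> t] t \<theta>
      by (cases t \<theta> rule: linorder_cases) auto
  qed (use \<theta> \<open>\<theta> > 0\<close> in simp)
qed

text \<open>
  The unique positive factor that moves a nonzero vector to \<open>M\<close>, and the resulting radial projection
  onto \<open>M\<close>.
\<close>

definition radial :: "'a \<Rightarrow> real" where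
  "radial u = (THE \<theta>. \<theta> > 0 \<and> I (\<theta> *\<^sub>R u) = 1)"

definition proj :: "'a \<Rightarrow> 'a" where
  "proj u = radial u *\<^sub>R u"

lemma radial: "u \<noteq> 0 \<Longrightarrow> radial u > 0" "u \<noteq> 0 \<Longrightarrow> I (radial u *\<^sub>R u) = 1"
  using theI'[OF radial_ex1[of u]] by (auto simp: radial_def)

lemma less_radial_iff:
  assumes "u \<noteq> 0" "a \<ge> 0"
  shows "a < radial u \<longleftrightarrow> I (a *\<^sub>R u) < 1" "radial u < a \<longleftrightarrow> 1 < I (a *\<^sub>R u)"
  using I_ray[OF assms(1), of a "radial u"] I_ray[OF assms(1), of "radial u" a] radial[OF assms(1)] assms(2)
  by (cases a "radial u" rule: linorder_cases; force)+

lemma proj_in_M: "u \<noteq> 0 \<Longrightarrow> proj u \<in> M"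
  using radial by (simp add: proj_def unit_level_def)

lemma proj_minus: "proj (- u) = - proj u"
  by (simp add: proj_def radial_def I_even)

text \<open>From inside the level set, radial projection moves outwards and so increases \<open>F\<close>.\<close>

lemma F_le_proj:
  assumes "u \<noteq> 0" "I u \<le> 1"
  shows "F u \<le> F (proj u)"
proof (cases "radial u = 1")
  case False
  have "1 \<le> radial u" using less_radial_iff(2)[OF assms(1), of 1] assms(2) by force
  then show ?thesis using F_ray[OF assms(1), of 1 "radial u"] False by (simp add: proj_def)
qed (simp add: proj_def)

lemma continuous_radial: "continuous_on (- {0}) radial"
proof -
  have "(radial \<longlongrightarrow> radial u) (at u)" if u: "u \<noteq> 0" for u
  proof (rule order_tendstoI)
    have ev0: "eventually (\<lambda>v. v \<noteq> 0) (at u)"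
      using u eventually_at_topological[of "\<lambda>v. v \<noteq> 0" u UNIV] by (auto intro: exI[of _ "- {0}"])
    have lim: "((\<lambda>v. I (a *\<^sub>R v)) \<longlongrightarrow> I (a *\<^sub>R u)) (at u)" for a
    proof (rule isCont_tendsto_compose[of _ I])
      show "isCont I (a *\<^sub>R u)" using continuous_I[of UNIV] by (simp add: continuous_on_eq_continuous_at)
    qed (intro tendsto_intros)
    fix a
    {
      assume a: "a < radial u"
      show "eventually (\<lambda>v. a < radial v) (at u)"
      proof (cases "a \<ge> 0")
        case True
        then have "I (a *\<^sub>R u) < 1" using less_radial_iff[OF u True] a by simp
        from order_tendstoD(2)[OF lim this] ev0 show ?thesis
          by eventually_elim (use less_radial_iff(1)[OF _ True] in blast)
      next
        case False
        from ev0 show ?thesis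
          by eventually_elim (use radial(1) False in force)
      qed
    }
    {
      assume a: "radial u < a"
      then have "a \<ge> 0" using radial(1)[OF u] by simp
      then have "1 < I (a *\<^sub>R u)" using less_radial_iff[OF u] a by simp
      from order_tendstoD(1)[OF lim this] ev0 show "eventually (\<lambda>v. radial v < a) (at u)"
        by eventually_elim (use less_radial_iff(2)[OF _ \<open>a \<ge> 0\<close>] in blast)
    }
  qed
  then show ?thesis by (simp add: continuous_on_eq_continuous_at open_Compl continuous_within)
qed

lemma continuous_proj: "continuous_on (- {0}) proj"
  unfolding proj_def by (intro continuous_intros continuous_radial)

end

section \<open>Odd deformations in finite-dimensional subspaces\<close>

text \<open>
  The gradient, and its length, of a functional with respect to the coordinates given by a finite set
  \<open>B\<close>.  The set \<open>B\<close> need not be linearly independent.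
\<close>

definition fgrad :: "'a::real_normed_vector set \<Rightarrow> ('a \<Rightarrow>\<^sub>L real) \<Rightarrow> 'a" where
  "fgrad B \<phi> = (\<Sum>e\<in>B. blinfun_apply \<phi> e *\<^sub>R e)"

definition fnorm :: "'a::real_normed_vector set \<Rightarrow> ('a \<Rightarrow>\<^sub>L real) \<Rightarrow> real" where
  "fnorm B \<phi> = sqrt (\<Sum>e\<in>B. (blinfun_apply \<phi> e)\<^sup>2)"

lemma fgrad_in_span: "fgrad B \<phi> \<in> span B"
  unfolding fgrad_def by (intro span_sum span_scale span_base)

lemma fgrad_minus: "fgrad B (- \<phi>) = - fgrad B \<phi>"
  by (simp add: fgrad_def blinfun.minus_left sum_negf)

lemma fnorm_minus: "fnorm B (- \<phi>) = fnorm B \<phi>"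
  by (simp add: fnorm_def blinfun.minus_left)

lemma apply_fgrad: "blinfun_apply \<psi> (fgrad B \<phi>) = (\<Sum>e\<in>B. blinfun_apply \<phi> e * blinfun_apply \<psi> e)"
  by (simp add: fgrad_def blinfun.sum_right blinfun.scaleR_right)

lemma blinfun_zero_on_span:
  fixes \<phi> :: "'a::real_normed_vector \<Rightarrow>\<^sub>L real"
  assumes "\<And>e. e \<in> B \<Longrightarrow> blinfun_apply \<phi> e = 0" "v \<in> span B"
  shows "blinfun_apply \<phi> v = 0"
  using assms(2)
proof (induction rule: span_induct_alt)
  case (step c x y)
  then show ?case using assms(1) by (simp add: blinfun.add_right blinfun.scaleR_right)
qed simp

lemma fnorm_pos:
  assumes "finite B" "u \<in> span B" "blinfun_apply \<phi> u \<noteq> 0"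
  shows "fnorm B \<phi> > 0"
proof -
  obtain e where "e \<in> B" "blinfun_apply \<phi> e \<noteq> 0"
    using blinfun_zero_on_span[of B \<phi> u] assms(2,3) by blast
  then have "(\<Sum>e\<in>B. (blinfun_apply \<phi> e)\<^sup>2) > 0" using assms(1) by (intro sum_pos2[of _ e]) auto
  then show ?thesis by (simp add: fnorm_def)
qed

lemma fnorm_sq: "(\<Sum>e\<in>B. (blinfun_apply \<phi> e)\<^sup>2) = (fnorm B \<phi>)\<^sup>2"
  by (simp add: fnorm_def sum_nonneg)

context variational_pair
begin

text \<open>
  \<open>u\<close> is a critical point of \<open>F\<close> restricted to \<open>M\<close> within the span of \<open>B\<close>; the multiplier is
  automatically positive when \<open>u\<close> is a nonzero vector of the span.
\<close>

definition critical_on :: "'a set \<Rightarrow> 'a \<Rightarrow> bool" where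
  "critical_on B u \<longleftrightarrow> (\<exists>\<mu>>0. \<forall>v\<in>span B. blinfun_apply (A u) v = \<mu> * blinfun_apply (f u) v)"

text \<open>
  The difference of the normalized gradients of \<open>F\<close> and \<open>I\<close>.  Away from critical points \<open>F\<close> increases
  and \<open>I\<close> decreases in this direction, so a small step followed by radial projection increases \<open>F\<close>
  on \<open>M\<close>, and no derivative of the projection is needed.
\<close>

definition ascent :: "'a set \<Rightarrow> 'a \<Rightarrow> 'a" where
  "ascent B u = (1 / fnorm B (f u)) *\<^sub>R fgrad B (f u) - (1 / fnorm B (A u)) *\<^sub>R fgrad B (A u)"

lemma ascent_in_span: "ascent B u \<in> span B"
  unfolding ascent_def by (intro span_diff span_scale fgrad_in_span)

lemma ascent_minus: "ascent B (- u) = - ascent B u"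
  by (simp add: ascent_def A_odd f_odd fnorm_minus fgrad_minus)

lemma ascent_direction:
  assumes "finite B" "u \<in> span B" "u \<noteq> 0" "\<not> critical_on B u"
  shows "blinfun_apply (f u) (ascent B u) > 0" "blinfun_apply (A u) (ascent B u) < 0"
proof -
  let ?a = "fnorm B (f u)" and ?b = "fnorm B (A u)"
  have a: "?a > 0" and b: "?b > 0"
    using fnorm_pos[OF assms(1,2)] A_pos[OF assms(3)] f_pos[OF assms(3)] by (auto intro: less_imp_neq[symmetric])
  let ?x = "\<lambda>e. blinfun_apply (f u) e" and ?y = "\<lambda>e. blinfun_apply (A u) e"
  define D where "D = (\<Sum>e\<in>B. (?x e / ?a - ?y e / ?b)\<^sup>2)"
  define p where "p = (\<Sum>e\<in>B. ?x e * ?y e)"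
  have "D = (\<Sum>e\<in>B. (?x e)\<^sup>2) / ?a\<^sup>2 + (\<Sum>e\<in>B. (?y e)\<^sup>2) / ?b\<^sup>2 - 2 * p / (?a * ?b)"
    unfolding D_def p_def
    by (simp add: power2_diff power_divide sum.distrib sum_subtractf sum_divide_distrib sum_distrib_left mult.assoc)
  then have D: "D = 2 - 2 * p / (?a * ?b)" using a b by (simp add: fnorm_sq)
  have "D > 0"
  proof (rule ccontr)
    assume "\<not> D > 0"
    moreover have "D \<ge> 0" unfolding D_def by (intro sum_nonneg) simp
    ultimately have "D = 0" by simp
    then have "\<And>e. e \<in> B \<Longrightarrow> ?x e / ?a - ?y e / ?b = 0"
      unfolding D_def using assms(1) by (subst (asm) sum_nonneg_eq_0_iff) auto
    then have "\<And>e. e \<in> B \<Longrightarrow> blinfun_apply (A u - (?b / ?a) *\<^sub>R f u) e = 0"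
      using a b by (simp add: blinfun.diff_left blinfun.scaleR_left field_simps)
    then have "\<And>v. v \<in> span B \<Longrightarrow> blinfun_apply (A u - (?b / ?a) *\<^sub>R f u) v = 0"
      by (rule blinfun_zero_on_span)
    then have "critical_on B u"
      unfolding critical_on_def using a b
      by (intro exI[of _ "?b / ?a"]) (simp add: blinfun.diff_left blinfun.scaleR_left)
    with assms(4) show False by simp
  qed
  have "blinfun_apply (f u) (ascent B u) = ?a\<^sup>2 / ?a - p / ?b"
    by (simp add: ascent_def blinfun.diff_right blinfun.scaleR_right apply_fgrad p_def fnorm_sq
        flip: power2_eq_square) (simp add: mult.commute)
  also have "\<dots> = ?a * D / 2" using a b by (simp add: D field_simps power2_eq_square)
  finally show "blinfun_apply (f u) (ascent B u) > 0"
    using mult_pos_pos[OF a \<open>D > 0\<close>] by linarith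
  have "blinfun_apply (A u) (ascent B u) = p / ?a - ?b\<^sup>2 / ?b"
    by (simp add: ascent_def blinfun.diff_right blinfun.scaleR_right apply_fgrad p_def fnorm_sq
        flip: power2_eq_square)
  also have "\<dots> = - (?b * D / 2)" using a b by (simp add: D field_simps power2_eq_square)
  finally show "blinfun_apply (A u) (ascent B u) < 0"
    using mult_pos_pos[OF b \<open>D > 0\<close>] by linarith
qed

lemma continuous_ascent:
  assumes "finite B"
  shows "continuous_on (span B - {0}) (ascent B)"
proof -
  have "fnorm B (f u) > 0 \<and> fnorm B (A u) > 0" if "u \<in> span B - {0}" for u
    using fnorm_pos[OF assms, of u] A_pos[of u] f_pos[of u] that by (auto intro: less_imp_neq[symmetric])
  then show ?thesis
    unfolding ascent_def fnorm_def fgrad_def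
    by (intro continuous_intros blinfun.continuous_on continuous_f continuous_A) (auto simp: less_imp_neq[symmetric])
qed

lemma compact_M_span: "finite B \<Longrightarrow> compact (M \<inter> span B)"
proof -
  assume B: "finite B"
  obtain R where R: "\<And>u. u \<in> M \<Longrightarrow> norm u \<le> R" using M_bounded by metis
  have "closed M"
    unfolding unit_level_def by (intro closed_Collect_eq continuous_I continuous_on_const)
  then have "compact (M \<inter> (span B \<inter> cball 0 R))"
    by (intro closed_Int_compact compact_span_cball B)
  moreover have "M \<inter> (span B \<inter> cball 0 R) = M \<inter> span B" using R by auto
  ultimately show ?thesis by simp
qed

text \<open>On a compact set of noncritical points one step size serves for all points.\<close>

lemma uniform_step:
  assumes B: "finite B" and C: "compact C" "C \<subseteq> M \<inter> span B" and nc: "\<And>u. u \<in> C \<Longrightarrow> \<not> critical_on B u"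
  obtains s0 c where "s0 > 0" "c > 0"
    "\<And>u s. u \<in> C \<Longrightarrow> 0 \<le> s \<Longrightarrow> s \<le> s0 \<Longrightarrow> F u + c * s \<le> F (u + s *\<^sub>R ascent B u)"
    "\<And>u s. u \<in> C \<Longrightarrow> 0 \<le> s \<Longrightarrow> s \<le> s0 \<Longrightarrow> I (u + s *\<^sub>R ascent B u) \<le> 1"
proof (cases "C = {}")
  case True
  then show ?thesis using that[of 1 1] by simp
next
  case False
  let ?V = "ascent B"
  let ?P = "\<lambda>(u, s). blinfun_apply (f (u + s *\<^sub>R ?V u)) (?V u)"
  let ?Q = "\<lambda>(u, s). blinfun_apply (A (u + s *\<^sub>R ?V u)) (?V u)"
  have C0: "C \<subseteq> span B - {0}" using C(2) M_nonzero by blast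
  have V: "continuous_on (C \<times> {0..1::real}) (\<lambda>x. ?V (fst x))"
    by (rule continuous_on_compose2[OF continuous_ascent[OF B]]) (use C0 in \<open>auto intro!: continuous_intros\<close>)
  have cc: "compact (C \<times> {0..1::real})" by (intro compact_Times C compact_Icc)
  have "continuous_on (C \<times> {0..1}) (\<lambda>x. min (?P x) (- ?Q x))"
    unfolding case_prod_unfold
    by (intro continuous_intros blinfun.continuous_on V
        continuous_on_compose2[OF continuous_f[of UNIV]] continuous_on_compose2[OF continuous_A[of UNIV]]) auto
  then have uc: "uniformly_continuous_on (C \<times> {0..1}) (\<lambda>x. min (?P x) (- ?Q x))" (is "uniformly_continuous_on _ ?m")
    by (rule compact_uniformly_continuous[OF _ cc])
  have "continuous_on (C \<times> {0}) ?m"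
    by (rule continuous_on_subset[OF uniformly_continuous_imp_continuous[OF uc]]) auto
  then have "\<exists>x\<in>C \<times> {0}. \<forall>y\<in>C \<times> {0}. ?m x \<le> ?m y"
    by (intro continuous_attains_inf compact_Times C) (use False in auto)
  then obtain u0 where u0: "u0 \<in> C" "\<And>u. u \<in> C \<Longrightarrow> ?m (u0, 0) \<le> ?m (u, 0)" by auto
  define c where "c = ?m (u0, 0)"
  have "c > 0"
    using ascent_direction[OF B, of u0] u0(1) C0 nc by (auto simp: c_def)
  obtain d where d: "d > 0" "\<And>x y. x \<in> C \<times> {0..1} \<Longrightarrow> y \<in> C \<times> {0..1} \<Longrightarrow> dist y x < d \<Longrightarrow> dist (?m y) (?m x) < c / 2"
    using uc \<open>c > 0\<close> unfolding uniformly_continuous_on_def by (meson half_gt_zero)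
  define s0 where "s0 = min 1 (d / 2)"
  have low: "c / 2 \<le> ?m (u, s)" if "u \<in> C" "0 \<le> s" "s \<le> s0" for u s
  proof -
    have "dist (?m (u, s)) (?m (u, 0)) < c / 2"
      by (rule d(2)) (use that d(1) in \<open>auto simp: s0_def dist_Pair_Pair\<close>)
    moreover have "c \<le> ?m (u, 0)" using u0(2)[OF that(1)] by (simp add: c_def)
    ultimately show ?thesis by (simp only: dist_real_def abs_less_iff) linarith
  qed
  show ?thesis
  proof (rule that[of s0 "c / 2"])
    show "s0 > 0" "c / 2 > 0" using d(1) \<open>c > 0\<close> by (auto simp: s0_def)
    fix u s assume u: "u \<in> C" and s: "0 \<le> s" "s \<le> s0"
    have P: "c / 2 \<le> ?P (u, t)" and Q: "?Q (u, t) \<le> 0" if "0 \<le> t" "t \<le> s" for t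
      using low[OF u that(1)] that(2) s \<open>c > 0\<close> by auto
    show "F u + c / 2 * s \<le> F (u + s *\<^sub>R ?V u)"
    proof (cases "s = 0")
      case False
      have "\<exists>t>0. t < s \<and> F (u + s *\<^sub>R ?V u) - F (u + 0 *\<^sub>R ?V u) = (s - 0) * ?P (u, t)"
        by (rule MVT2) (use False s potential_line_derivative[OF f_pot, of u "?V u"] in auto)
      then obtain t where t: "0 < t" "t < s" "F (u + s *\<^sub>R ?V u) - F u = s * ?P (u, t)" by auto
      have "s * (c / 2) \<le> s * ?P (u, t)" using P[of t] t s by (intro mult_left_mono) auto
      then show ?thesis using t(3) by (simp add: mult.commute)
    qed simp
    have Iu: "I u = 1" using u C(2) by (auto simp: unit_level_def)
    show "I (u + s *\<^sub>R ?V u) \<le> 1"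
    proof (cases "s = 0")
      case False
      have "\<exists>t>0. t < s \<and> I (u + s *\<^sub>R ?V u) - I (u + 0 *\<^sub>R ?V u) = (s - 0) * ?Q (u, t)"
        by (rule MVT2) (use False s potential_line_derivative[OF A_pot, of u "?V u"] in auto)
      then obtain t where t: "0 < t" "t < s" "I (u + s *\<^sub>R ?V u) - I u = s * ?Q (u, t)" by auto
      have "s * ?Q (u, t) \<le> 0" using Q[of t] t s by (intro mult_nonneg_nonpos) auto
      then show ?thesis using t(3) Iu by simp
    qed (use Iu in simp)
  qed
qed

text \<open>
  The step is damped by a cutoff that is \<open>1\<close> below the level \<open>d1\<close> and \<open>0\<close> above \<open>d2\<close>.
\<close>

lemma odd_deformation_step:
  assumes B: "finite B" and eps: "0 < \<epsilon>" "d1 < d2"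
    and nc: "\<And>u. u \<in> M \<inter> span B \<Longrightarrow> \<epsilon> \<le> F u \<Longrightarrow> F u \<le> d2 \<Longrightarrow> \<not> critical_on B u"
  obtains h \<kappa> where "\<kappa> > 0" "continuous_on {u \<in> M \<inter> span B. \<epsilon> \<le> F u} h"
    "\<And>u. h (- u) = - h u"
    "\<And>u. u \<in> M \<inter> span B \<Longrightarrow> \<epsilon> \<le> F u \<Longrightarrow> h u \<in> M \<inter> span B"
    "\<And>u. u \<in> M \<inter> span B \<Longrightarrow> \<epsilon> \<le> F u \<Longrightarrow> min d1 (F u + \<kappa>) \<le> F (h u)"
    "\<And>u. u \<in> M \<inter> span B \<Longrightarrow> \<epsilon> \<le> F u \<Longrightarrow> F u \<le> F (h u)"
proof -
  let ?N = "{u \<in> M \<inter> span B. \<epsilon> \<le> F u}"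
  let ?C = "{u \<in> M \<inter> span B. \<epsilon> \<le> F u \<and> F u \<le> d2}"
  have "closed {u. \<epsilon> \<le> F u \<and> F u \<le> d2}"
    by (intro closed_Collect_conj closed_Collect_le continuous_F continuous_on_const)
  then have "compact (M \<inter> span B \<inter> {u. \<epsilon> \<le> F u \<and> F u \<le> d2})"
    by (intro compact_Int_closed compact_M_span B)
  moreover have "M \<inter> span B \<inter> {u. \<epsilon> \<le> F u \<and> F u \<le> d2} = ?C" by auto
  ultimately have "compact ?C" by simp
  then obtain s0 c where s0: "s0 > 0" "c > 0"
    "\<And>u s. u \<in> ?C \<Longrightarrow> 0 \<le> s \<Longrightarrow> s \<le> s0 \<Longrightarrow> F u + c * s \<le> F (u + s *\<^sub>R ascent B u)"
    "\<And>u s. u \<in> ?C \<Longrightarrow> 0 \<le> s \<Longrightarrow> s \<le> s0 \<Longrightarrow> I (u + s *\<^sub>R ascent B u) \<le> 1"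
    by (rule uniform_step[OF B]) (use nc that in auto)
  define \<eta> where "\<eta> t = max 0 (min 1 ((d2 - t) / (d2 - d1)))" for t
  have \<eta>: "0 \<le> \<eta> t" "\<eta> t \<le> 1" "t \<le> d1 \<Longrightarrow> \<eta> t = 1" "t \<ge> d2 \<Longrightarrow> \<eta> t = 0" for t
    using eps(2) by (auto simp: \<eta>_def field_simps)
  define w where "w u = u + (s0 * \<eta> (F u)) *\<^sub>R ascent B u" for u
  have w: "F u + c * (s0 * \<eta> (F u)) \<le> F (w u)" "I (w u) \<le> 1" "w u \<noteq> 0" if u: "u \<in> ?N" for u
  proof -
    have *: "F u + c * (s0 * \<eta> (F u)) \<le> F (w u) \<and> I (w u) \<le> 1"
    proof (cases "F u \<le> d2")
      case True
      have "s0 * \<eta> (F u) \<le> s0" "0 \<le> s0 * \<eta> (F u)" using \<eta>[of "F u"] s0(1) by (auto simp: mult_le_cancel_left1)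
      then show ?thesis using s0(3,4)[of u "s0 * \<eta> (F u)"] u True by (auto simp: w_def)
    next
      case False
      then have "w u = u" using \<eta>(4) by (simp add: w_def)
      then show ?thesis using \<eta>(4) False u by (auto simp: unit_level_def)
    qed
    moreover have "0 \<le> c * (s0 * \<eta> (F u))" using s0 \<eta>(1) by simp
    ultimately have "F (w u) > 0" using u eps(1) by auto
    then show "F u + c * (s0 * \<eta> (F u)) \<le> F (w u)" "I (w u) \<le> 1" "w u \<noteq> 0" using * by auto
  qed
  have wspan: "w u \<in> span B" if "u \<in> span B" for u
    unfolding w_def by (intro span_add span_scale that ascent_in_span)
  have gain: "F u + c * (s0 * \<eta> (F u)) \<le> F (proj (w u))" if "u \<in> ?N" for u
    using w(1)[OF that] F_le_proj[OF w(3,2)[OF that]] by simp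
  have gain0: "0 \<le> c * (s0 * \<eta> t)" for t using s0 \<eta>(1) by simp
  show ?thesis
  proof (rule that[of "c * s0" "\<lambda>u. proj (w u)"])
    show "c * s0 > 0" using s0 by simp
    have "continuous_on UNIV \<eta>"
      unfolding \<eta>_def using eps(2) by (intro continuous_intros) auto
    then have "continuous_on ?N (\<lambda>u. \<eta> (F u))"
      by (rule continuous_on_compose2) (auto intro: continuous_F)
    moreover have "continuous_on ?N (ascent B)"
      by (rule continuous_on_subset[OF continuous_ascent[OF B]]) (use M_nonzero in auto)
    ultimately have "continuous_on ?N w"
      unfolding w_def by (intro continuous_intros)
    then show "continuous_on ?N (\<lambda>u. proj (w u))"
      by (rule continuous_on_compose2[OF continuous_proj]) (use w(3) in auto)
    have "w (- u) = - w u" for u by (simp add: w_def F_even ascent_minus)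
    then show "proj (w (- u)) = - proj (w u)" for u by (simp add: proj_minus)
    fix u assume "u \<in> M \<inter> span B" "\<epsilon> \<le> F u"
    then have u: "u \<in> ?N" by simp
    show "proj (w u) \<in> M \<inter> span B"
      using proj_in_M[OF w(3)[OF u]] wspan u by (auto simp: proj_def intro: span_scale)
    show "F u \<le> F (proj (w u))" using gain[OF u] gain0[of "F u"] by linarith
    then show "min d1 (F u + c * s0) \<le> F (proj (w u))"
      using gain[OF u] \<eta>(3)[of "F u"] by (cases "F u \<le> d1") auto
  qed
qed

text \<open>
  Without critical points at levels in \<open>[\<epsilon>, d2]\<close>, finitely many steps carry the part of \<open>M\<close> above \<open>\<epsilon>\<close>
  above the level \<open>d1\<close>.
\<close>

lemma odd_deformation:
  assumes B: "finite B" and eps: "0 < \<epsilon>" "d1 < d2"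
    and nc: "\<And>u. u \<in> M \<inter> span B \<Longrightarrow> \<epsilon> \<le> F u \<Longrightarrow> F u \<le> d2 \<Longrightarrow> \<not> critical_on B u"
  obtains h where "continuous_on {u \<in> M \<inter> span B. \<epsilon> \<le> F u} h" "\<And>u. h (- u) = - h u"
    "\<And>u. u \<in> M \<inter> span B \<Longrightarrow> \<epsilon> \<le> F u \<Longrightarrow> h u \<in> M \<and> d1 \<le> F (h u)"
proof -
  let ?N = "{u \<in> M \<inter> span B. \<epsilon> \<le> F u}"
  obtain h \<kappa> where h: "\<kappa> > 0" "continuous_on ?N h" "\<And>u. h (- u) = - h u"
    "\<And>u. u \<in> M \<inter> span B \<Longrightarrow> \<epsilon> \<le> F u \<Longrightarrow> h u \<in> M \<inter> span B"
    "\<And>u. u \<in> M \<inter> span B \<Longrightarrow> \<epsilon> \<le> F u \<Longrightarrow> min d1 (F u + \<kappa>) \<le> F (h u)"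
    "\<And>u. u \<in> M \<inter> span B \<Longrightarrow> \<epsilon> \<le> F u \<Longrightarrow> F u \<le> F (h u)"
    by (rule odd_deformation_step[OF B eps]) (erule (2) nc, rule that)
  have iter: "continuous_on ?N (h ^^ j) \<and> (\<forall>u\<in>?N. (h ^^ j) u \<in> ?N \<and> min d1 (real j * \<kappa>) \<le> F ((h ^^ j) u))" for j
  proof (induction j)
    case 0
    show ?case using eps(1) by (auto simp: id_def)
  next
    case (Suc j)
    have "continuous_on ?N (\<lambda>u. h ((h ^^ j) u))"
      by (rule continuous_on_compose2[OF h(2)]) (use Suc in auto)
    moreover have "h ((h ^^ j) u) \<in> ?N \<and> min d1 (real (Suc j) * \<kappa>) \<le> F (h ((h ^^ j) u))" if "u \<in> ?N" for u
    proof -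
      let ?v = "(h ^^ j) u"
      have v: "?v \<in> M \<inter> span B" "\<epsilon> \<le> F ?v" "min d1 (real j * \<kappa>) \<le> F ?v" using Suc that by auto
      have "h ?v \<in> ?N" using h(4)[OF v(1,2)] h(6)[OF v(1,2)] v(2) by auto
      moreover have "min d1 (real (Suc j) * \<kappa>) \<le> F (h ?v)"
        using h(5)[OF v(1,2)] h(6)[OF v(1,2)] v(3) h(1) by (auto simp: algebra_simps min_def split: if_splits)
      ultimately show ?thesis by blast
    qed
    ultimately show ?case by (simp add: o_def)
  qed
  obtain j where j: "d1 / \<kappa> \<le> real j" using real_arch_simple by blast
  then have "min d1 (real j * \<kappa>) = d1" using h(1) by (simp add: field_simps)
  moreover have "(h ^^ j) (- u) = - (h ^^ j) u" for u by (induction j) (auto simp: h(3))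
  ultimately show ?thesis using that[of "h ^^ j"] iter[of j] by auto
qed

end

section \<open>Critical points at arbitrarily low levels\<close>

lemma infinite_independent_sequence:
  assumes "infinite_dimensional TYPE('a::real_vector)"
  obtains e :: "nat \<Rightarrow> 'a::real_vector" where "inj e" "independent (range e)"
proof -
  obtain B :: "'a set" where B: "independent B" "UNIV \<subseteq> span B"
    by (rule basis_exists[of UNIV]) auto
  then have "infinite B" using assms by (auto simp: infinite_dimensional_def)
  then obtain e :: "nat \<Rightarrow> 'a" where "inj e" "range e \<subseteq> B"
    using infinite_countable_subset by blast
  then show ?thesis using that independent_mono[OF B(1)] by blast
qed

lemma independent_combination_nonzero:
  fixes e :: "nat \<Rightarrow> 'a::real_vector"
  assumes "inj e" "independent (range e)" "(\<Sum>i\<le>n. x i *\<^sub>R e i) = 0" "i \<le> n"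
  shows "x i = 0"
proof -
  have inj: "inj_on e {..n}" using assms(1) by (rule inj_on_subset) simp
  have "(\<Sum>v\<in>e ` {..n}. x (the_inv e v) *\<^sub>R v) = (\<Sum>i\<le>n. x i *\<^sub>R e i)"
    by (subst sum.reindex[OF inj]) (simp add: the_inv_f_f[OF assms(1)])
  then have "x (the_inv e (e i)) = 0"
    using independentD[OF assms(2), of "e ` {..n}" "\<lambda>v. x (the_inv e v)" "e i"] assms(3,4) by auto
  then show ?thesis by (simp add: the_inv_f_f[OF assms(1)])
qed

text \<open>
  The compactness assumptions: a reflexive infinite-dimensional space, complete continuity of \<open>f\<close>,
  and the condition on \<open>A\<close> that upgrades weak to strong convergence.
\<close>

locale compact_variational_pair = variational_pair A f
  for A f :: "'a::real_normed_vector \<Rightarrow> 'a \<Rightarrow>\<^sub>L real" +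
  assumes refl: "reflexive_space TYPE('a)" and inf_dim: "infinite_dimensional TYPE('a)"
    and A_bounded: "\<And>B. bounded B \<Longrightarrow> bounded (A ` B)"
    and A_compact: "\<And>u l. weakly_converges u l \<Longrightarrow>
               (\<lambda>j. blinfun_apply (A (u j)) (u j - l)) \<longlonglongrightarrow> 0 \<Longrightarrow>
               \<exists>r :: nat \<Rightarrow> nat. strict_mono r \<and> (u \<circ> r) \<longlonglongrightarrow> l"
    and f_compact: "\<And>u l. weakly_converges u l \<Longrightarrow> (\<lambda>j. f (u j)) \<longlonglongrightarrow> f l"
begin

lemma weakly_converges_norm_le:
  fixes u :: "nat \<Rightarrow> 'a"
  assumes "weakly_converges u l" "\<And>n. norm (u n) \<le> R"
  shows "norm l \<le> R"
proof -
  obtain \<phi> :: "'a \<Rightarrow>\<^sub>L real" where \<phi>: "norm \<phi> \<le> 1" "blinfun_apply \<phi> l = norm l"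
    by (rule norming_functional)
  have "blinfun_apply \<phi> (u n) \<le> R" for n
    using norm_blinfun[of \<phi> "u n"] mult_right_mono[OF \<phi>(1) norm_ge_zero[of "u n"]] assms(2)[of n] by simp
  moreover have "(\<lambda>n. blinfun_apply \<phi> (u n)) \<longlonglongrightarrow> norm l"
    using assms(1) \<phi>(2) unfolding weakly_converges_def by metis
  ultimately show ?thesis by (intro LIMSEQ_le_const2) auto
qed

lemma seq_compact_image_f: "seq_compact (f ` cball 0 R)"
  unfolding seq_compact_def
proof (intro allI impI)
  fix y :: "nat \<Rightarrow> 'a \<Rightarrow>\<^sub>L real" assume "\<forall>n. y n \<in> f ` cball 0 R"
  then have "\<forall>n. \<exists>u. y n = f u \<and> norm u \<le> R" by (metis imageE mem_cball_0)
  then obtain u where u: "\<And>n. y n = f (u n)" "\<And>n. norm (u n) \<le> R" by metis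
  obtain r l where r: "strict_mono r" "weakly_converges (u \<circ> r) l"
    by (rule weak_sequential_compactness[OF refl u(2)])
  have "norm l \<le> R" by (rule weakly_converges_norm_le[OF r(2)]) (simp add: u(2))
  moreover have "(y \<circ> r) \<longlonglongrightarrow> f l" using f_compact[OF r(2)] by (simp add: o_def u(1))
  ultimately show "\<exists>l\<in>f ` cball 0 R. \<exists>r. strict_mono r \<and> (y \<circ> r) \<longlonglongrightarrow> l"
    using r(1) by (intro bexI[of _ "f l"] exI[of _ r]) auto
qed

text \<open>
  By the mean value theorem \<open>F u = f (\<tau> u) u\<close> for some \<open>\<tau>\<close>, so that an element of a fine finite net of
  \<open>f (cball 0 R)\<close> does not vanish at \<open>u\<close>.
\<close>

lemma finitely_many_separating_functionals:
  assumes "d > 0"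
  obtains \<phi> :: "nat \<Rightarrow> 'a \<Rightarrow>\<^sub>L real" and m
    where "\<And>u. u \<in> M \<Longrightarrow> d \<le> F u \<Longrightarrow> \<exists>i<m. blinfun_apply (\<phi> i) u \<noteq> 0"
proof -
  obtain R where R: "R > 0" "\<And>u. u \<in> M \<Longrightarrow> norm u \<le> R" using M_bounded by metis
  obtain K where K: "finite K" "f ` cball 0 R \<subseteq> (\<Union>\<psi>\<in>K. ball \<psi> (d / (2 * R)))"
    using seq_compact_imp_totally_bounded[OF seq_compact_image_f[of R], rule_format, of "d / (2 * R)"]
      assms R(1) by auto
  obtain \<phi> :: "nat \<Rightarrow> 'a \<Rightarrow>\<^sub>L real" and m where \<phi>: "K = \<phi> ` {i. i < m}"
    using finite_imp_nat_seg_image_inj_on[OF K(1)] by metis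
  show ?thesis
  proof (rule that[of m \<phi>])
    fix u assume u: "u \<in> M" "d \<le> F u"
    obtain \<tau> where \<tau>: "0 < \<tau>" "\<tau> < 1" "F u = blinfun_apply (f (\<tau> *\<^sub>R u)) u"
      by (rule potential_mean_value[OF f_pot])
    have "norm (\<tau> *\<^sub>R u) \<le> R"
      using R(2)[OF u(1)] \<tau>(1,2) mult_left_le_one_le[of "norm u" \<tau>] by simp
    then have "f (\<tau> *\<^sub>R u) \<in> f ` cball 0 R" by (intro imageI) simp
    then have "f (\<tau> *\<^sub>R u) \<in> (\<Union>\<psi>\<in>K. ball \<psi> (d / (2 * R)))" using K(2) by blast
    then obtain i where i: "i < m" "norm (f (\<tau> *\<^sub>R u) - \<phi> i) < d / (2 * R)"
      unfolding \<phi> by (auto simp: dist_norm norm_minus_commute)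
    have "\<bar>blinfun_apply (f (\<tau> *\<^sub>R u) - \<phi> i) u\<bar> \<le> norm (f (\<tau> *\<^sub>R u) - \<phi> i) * norm u"
      using norm_blinfun[of "f (\<tau> *\<^sub>R u) - \<phi> i" u] by simp
    also have "\<dots> \<le> d / (2 * R) * R"
      using i(2) R u(1) assms by (intro mult_mono) auto
    also have "\<dots> = d / 2" using R(1) by simp
    finally have "blinfun_apply (\<phi> i) u \<noteq> 0"
      using u(2) \<tau>(3) assms by (auto simp: blinfun.diff_left)
    with i(1) show "\<exists>i<m. blinfun_apply (\<phi> i) u \<noteq> 0" by blast
  qed
qed

text \<open>
  The intersection argument: an odd deformation past the critical levels would contradict the
  Borsuk--Ulam theorem.
\<close>

lemma critical_points_on_spans:
  assumes "d > 0"
  obtains B0 \<epsilon> where "finite B0" "\<epsilon> > 0"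
    "\<And>B. finite B \<Longrightarrow> B0 \<subseteq> B \<Longrightarrow> \<exists>u\<in>M \<inter> span B. \<epsilon> \<le> F u \<and> F u \<le> d \<and> critical_on B u"
proof -
  obtain \<phi> :: "nat \<Rightarrow> 'a \<Rightarrow>\<^sub>L real" and m
    where \<phi>: "\<And>u. u \<in> M \<Longrightarrow> d / 2 \<le> F u \<Longrightarrow> \<exists>i<m. blinfun_apply (\<phi> i) u \<noteq> 0"
    by (rule finitely_many_separating_functionals[of "d / 2"]) (use assms in simp, rule that)
  obtain e :: "nat \<Rightarrow> 'a" where e: "inj e" "independent (range e)"
    by (rule infinite_independent_sequence[OF inf_dim])
  define B0 where "B0 = e ` {..m}"
  have "finite B0" by (simp add: B0_def)
  define w where "w x = (\<Sum>i\<le>m. x i *\<^sub>R e i)" for x :: "nat \<Rightarrow> real"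
  have w_span: "w x \<in> span B0" for x
    unfolding w_def B0_def by (intro span_sum span_scale span_base) auto
  have w_nz: "w x \<noteq> 0" if "x \<in> octahedron m" for x
  proof
    assume "w x = 0"
    then have "\<And>i. i \<le> m \<Longrightarrow> x i = 0"
      using independent_combination_nonzero[OF e] unfolding w_def by blast
    then show False using that by (simp add: octahedron_def)
  qed
  have pw: "proj (w x) \<in> M \<inter> span B0" if "x \<in> octahedron m" for x
    using proj_in_M[OF w_nz[OF that]] w_span by (auto simp: proj_def intro: span_scale)
  have oct_ne: "(\<lambda>i. if i = 0 then 1 else 0) \<in> octahedron m"
    using octahedron_mono[of 0 m] by (auto simp: octahedron_def)
  then have "M \<inter> span B0 \<noteq> {}" using pw by blast
  then obtain u0 where u0: "u0 \<in> M \<inter> span B0" "\<forall>u\<in>M \<inter> span B0. F u0 \<le> F u"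
    using continuous_attains_inf[OF compact_M_span[OF \<open>finite B0\<close>] _ continuous_F] by blast
  define \<epsilon> where "\<epsilon> = F u0"
  have "\<epsilon> > 0" using u0(1) M_nonzero F_pos by (auto simp: \<epsilon>_def)
  show ?thesis
  proof (rule that[OF \<open>finite B0\<close> \<open>\<epsilon> > 0\<close>], rule ccontr)
    fix B assume B: "finite B" "B0 \<subseteq> B"
      and no: "\<not> (\<exists>u\<in>M \<inter> span B. \<epsilon> \<le> F u \<and> F u \<le> d \<and> critical_on B u)"
    have d: "d / 2 < d" using assms by simp
    obtain h where h: "continuous_on {u \<in> M \<inter> span B. \<epsilon> \<le> F u} h" "\<And>u. h (- u) = - h u"
      "\<And>u. u \<in> M \<inter> span B \<Longrightarrow> \<epsilon> \<le> F u \<Longrightarrow> h u \<in> M \<and> d / 2 \<le> F (h u)"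
      by (rule odd_deformation[OF B(1) \<open>\<epsilon> > 0\<close> d]) (use no in blast, rule that)
    have dom: "proj (w x) \<in> {u \<in> M \<inter> span B. \<epsilon> \<le> F u}" if "x \<in> octahedron m" for x
      using pw[OF that] u0(2) span_mono[OF B(2)] by (auto simp: \<epsilon>_def)
    have "continuous_on (octahedron m) w"
      unfolding w_def
      by (intro continuous_intros continuous_on_product_then_coordinatewise[OF continuous_on_id])
    then have "continuous_on (octahedron m) (\<lambda>x. proj (w x))"
      by (rule continuous_on_compose2[OF continuous_proj]) (use w_nz in auto)
    then have cont: "continuous_on (octahedron m) (\<lambda>x. h (proj (w x)))"
      by (rule continuous_on_compose2[OF h(1)]) (use dom in blast)
    have neg: "h (proj (w (\<lambda>j. - x j))) = - h (proj (w x))" for x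
    proof -
      have "w (\<lambda>j. - x j) = - w x" by (simp add: w_def sum_negf)
      then show ?thesis by (simp add: proj_minus h(2))
    qed
    have "\<exists>x\<in>octahedron m. \<forall>i<m. blinfun_apply (\<phi> i) (h (proj (w x))) = 0"
    proof (rule borsuk_ulam)
      show "continuous_on (octahedron m) (\<lambda>x. blinfun_apply (\<phi> i) (h (proj (w x))))" for i
        by (intro blinfun.continuous_on continuous_on_const cont)
    qed (simp_all add: neg blinfun.minus_right)
    then obtain x where x: "x \<in> octahedron m" "\<forall>i<m. blinfun_apply (\<phi> i) (h (proj (w x))) = 0" by blast
    have "h (proj (w x)) \<in> M \<and> d / 2 \<le> F (h (proj (w x)))" using h(3) dom[OF x(1)] by blast
    with \<phi> x(2) show False by blast
  qed
qed

text \<open>The multiplier forced by testing \<open>A u = \<mu> f u\<close> with \<open>u\<close>, and the resulting residual.\<close>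

definition multiplier :: "'a \<Rightarrow> real" where
  "multiplier u = blinfun_apply (A u) u / blinfun_apply (f u) u"

definition residual :: "'a \<Rightarrow> 'a \<Rightarrow>\<^sub>L real" where
  "residual u = A u - multiplier u *\<^sub>R f u"

lemma critical_on_multiplier:
  assumes "critical_on B u" "u \<in> span B" "u \<noteq> 0" "v \<in> span B"
  shows "blinfun_apply (A u) v = multiplier u * blinfun_apply (f u) v"
proof -
  obtain \<mu> where \<mu>: "\<And>v. v \<in> span B \<Longrightarrow> blinfun_apply (A u) v = \<mu> * blinfun_apply (f u) v"
    using assms(1) by (auto simp: critical_on_def)
  have "multiplier u = \<mu>" using \<mu>[OF assms(2)] f_pos[OF assms(3)] by (simp add: multiplier_def)
  with \<mu>[OF assms(4)] show ?thesis by simp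
qed

lemma continuous_residual:
  assumes "u \<noteq> 0" "x \<longlonglongrightarrow> u"
  shows "(\<lambda>n. residual (x n)) \<longlonglongrightarrow> residual u"
proof -
  have A: "(\<lambda>n. A (x n)) \<longlonglongrightarrow> A u" and f: "(\<lambda>n. f (x n)) \<longlonglongrightarrow> f u"
    using continuous_A[of UNIV] continuous_f[of UNIV] assms(2)
    by (auto simp: continuous_on_eq_continuous_at intro: isCont_tendsto_compose)
  then show ?thesis
    unfolding residual_def multiplier_def
    using f_pos[OF assms(1)] assms(2)
    by (intro tendsto_diff tendsto_scaleR tendsto_divide blinfun.tendsto) auto
qed

lemma almost_norming_vector:
  fixes \<psi> :: "'a \<Rightarrow>\<^sub>L real"
  obtains v where "norm v \<le> 1" "norm \<psi> \<le> 2 * \<bar>blinfun_apply \<psi> v\<bar>"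
proof (cases "\<exists>v. norm v \<le> 1 \<and> norm \<psi> \<le> 2 * \<bar>blinfun_apply \<psi> v\<bar>")
  case False
  then have n: "\<And>v. norm v \<le> 1 \<Longrightarrow> \<bar>blinfun_apply \<psi> v\<bar> \<le> norm \<psi> / 2" by force
  have "norm \<psi> \<le> norm \<psi> / 2"
  proof (rule norm_blinfun_bound)
    fix x
    show "norm (blinfun_apply \<psi> x) \<le> norm \<psi> / 2 * norm x"
    proof (cases "x = 0")
      case False
      then have "\<bar>blinfun_apply \<psi> ((1 / norm x) *\<^sub>R x)\<bar> \<le> norm \<psi> / 2" by (intro n) simp
      then show ?thesis using False by (simp add: blinfun.scaleR_right field_simps abs_mult)
    qed (simp add: blinfun.zero_right)
  qed simp
  then have "norm \<psi> = 0" by simp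
  then show ?thesis using that[of 0] by simp
qed (use that in blast)

text \<open>
  The Galerkin limit.  Critical points on an increasing sequence of finite-dimensional subspaces converge
  strongly to a critical point on the closure \<open>Y\<close> of the union.  It is critical on the whole space
  because \<open>Y\<close> contains vectors that almost norm the residuals.
\<close>

theorem exists_critical_point_below:
  assumes "d > 0"
  obtains u \<mu> where "u \<in> M" "F u \<le> d" "\<mu> > 0" "A u = \<mu> *\<^sub>R f u"
proof -
  obtain B0 \<epsilon> where B0: "finite B0" "\<epsilon> > 0"
    "\<And>B. finite B \<Longrightarrow> B0 \<subseteq> B \<Longrightarrow> \<exists>u\<in>M \<inter> span B. \<epsilon> \<le> F u \<and> F u \<le> d \<and> critical_on B u"
    by (rule critical_points_on_spans[OF assms]) (rule that)
  have "\<forall>B. \<exists>u. finite B \<longrightarrow> B0 \<subseteq> B \<longrightarrow> u \<in> M \<inter> span B \<and> \<epsilon> \<le> F u \<and> F u \<le> d \<and> critical_on B u"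
    using B0(3) by blast
  then obtain pick where pick: "\<And>B. finite B \<Longrightarrow> B0 \<subseteq> B \<Longrightarrow> pick B \<in> M \<inter> span B \<and> \<epsilon> \<le> F (pick B) \<and>
      F (pick B) \<le> d \<and> critical_on B (pick B)"
    by metis
  have "\<forall>\<psi> :: 'a \<Rightarrow>\<^sub>L real. \<exists>v. norm v \<le> 1 \<and> norm \<psi> \<le> 2 * \<bar>blinfun_apply \<psi> v\<bar>"
    using almost_norming_vector by metis
  then obtain vec :: "('a \<Rightarrow>\<^sub>L real) \<Rightarrow> 'a" where vec: "\<And>\<psi>. norm (vec \<psi>) \<le> 1"
    "\<And>\<psi>. norm \<psi> \<le> 2 * \<bar>blinfun_apply \<psi> (vec \<psi>)\<bar>"
    by metis
  \<comment> \<open>Adjoin each critical point together with a vector on which its residual is almost attained.\<close>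
  define Bs where "Bs = rec_nat B0 (\<lambda>_ B. B \<union> {pick B, vec (residual (pick B))})"
  have Bs_0: "Bs 0 = B0" and Bs_Suc: "Bs (Suc n) = Bs n \<union> {pick (Bs n), vec (residual (pick (Bs n)))}" for n
    by (simp_all add: Bs_def)
  have fin: "finite (Bs n)" for n by (induction n) (simp_all add: Bs_0 Bs_Suc B0(1))
  have inc: "incseq Bs" by (rule incseq_SucI) (auto simp: Bs_Suc)
  have sub: "B0 \<subseteq> Bs n" for n using incseqD[OF inc, of 0 n] by (simp add: Bs_0)
  define x where "x n = pick (Bs n)" for n
  have x: "x n \<in> M" "x n \<in> span (Bs n)" "\<epsilon> \<le> F (x n)" "F (x n) \<le> d" "critical_on (Bs n) (x n)" "x n \<noteq> 0" for n
    using pick[OF fin sub, of n] M_nonzero by (auto simp: x_def)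
  let ?V = "\<lambda>n. span (Bs n)"
  have incV: "incseq ?V" using inc by (auto simp: incseq_def intro!: span_mono)
  let ?W = "\<Union>n. ?V n"
  have W: "subspace ?W" by (rule subspace_UN_incseq[OF subspace_span incV])
  obtain R where R: "R > 0" "\<And>u. u \<in> M \<Longrightarrow> norm u \<le> R" using M_bounded by metis
  obtain r u where r: "strict_mono r" and weak: "weakly_converges (x \<circ> r) u"
    by (rule weak_sequential_compactness[OF refl R(2)[OF x(1)]])
  define y where "y = x \<circ> r"
  have y: "y n \<in> M" "y n \<in> ?V (r n)" "\<epsilon> \<le> F (y n)" "F (y n) \<le> d" "critical_on (Bs (r n)) (y n)" "y n \<noteq> 0"
    "norm (y n) \<le> R" for n
    using x R(2) by (simp_all add: y_def)
  have wk: "(\<lambda>n. blinfun_apply \<phi> (y n)) \<longlonglongrightarrow> blinfun_apply \<phi> u" for \<phi> :: "'a \<Rightarrow>\<^sub>L real"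
    using weak by (simp add: weakly_converges_def y_def)
  have uW: "u \<in> closure ?W"
  proof (rule weak_limit_in_closed_subspace[OF _ _ _ sequentially_bot wk])
    show "subspace (closure ?W)" by (rule subspace_closure[OF W])
    show "y n \<in> closure ?W" for n
      by (rule subsetD[OF closure_subset], rule UN_I[OF UNIV_I], rule y(2))
  qed simp
  have fy: "(\<lambda>n. f (y n)) \<longlonglongrightarrow> f u" using f_compact[OF weak] by (simp add: y_def)
  have strong_weak: "(\<lambda>n. blinfun_apply (\<psi> n) (y n)) \<longlonglongrightarrow> blinfun_apply \<phi> u"
    if "\<psi> \<longlonglongrightarrow> \<phi>" for \<psi> and \<phi> :: "'a \<Rightarrow>\<^sub>L real"
  proof -
    have "(\<lambda>n. blinfun_apply (\<psi> n - \<phi>) (y n)) \<longlonglongrightarrow> 0"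
    proof (rule Lim_null_comparison)
      show "eventually (\<lambda>n. norm (blinfun_apply (\<psi> n - \<phi>) (y n)) \<le> norm (\<psi> n - \<phi>) * R) sequentially"
        by (intro always_eventually allI order_trans[OF norm_blinfun] mult_left_mono y(7) norm_ge_zero)
      show "(\<lambda>n. norm (\<psi> n - \<phi>) * R) \<longlonglongrightarrow> 0"
        using that by (intro tendsto_mult_left_zero) (simp add: LIM_zero_iff tendsto_norm_zero)
    qed
    from tendsto_add[OF this wk[of \<phi>]] show ?thesis by (simp add: blinfun.diff_left)
  qed
  \<comment> \<open>If \<open>y\<close> converged weakly to \<open>0\<close>, then so would its shrunk copies, and \<open>F (y n)\<close> would tend to \<open>0\<close>.\<close>
  have "u \<noteq> 0"
  proof
    assume "u = 0"
    have "\<exists>\<tau>. 0 < \<tau> \<and> \<tau> < 1 \<and> F (y n) = blinfun_apply (f (\<tau> *\<^sub>R y n)) (y n)" for n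
      using potential_mean_value[OF f_pot, of "y n"] by metis
    then obtain t where t: "\<And>n. 0 < t n" "\<And>n. t n < 1" "\<And>n. F (y n) = blinfun_apply (f (t n *\<^sub>R y n)) (y n)"
      by metis
    have "weakly_converges (\<lambda>n. t n *\<^sub>R y n) 0"
      unfolding weakly_converges_def blinfun.zero_right
    proof (intro allI, rule Lim_null_comparison)
      fix \<phi> :: "'a \<Rightarrow>\<^sub>L real"
      show "eventually (\<lambda>n. norm (blinfun_apply \<phi> (t n *\<^sub>R y n)) \<le> \<bar>blinfun_apply \<phi> (y n)\<bar>) sequentially"
      proof (intro always_eventually allI)
        fix n show "norm (blinfun_apply \<phi> (t n *\<^sub>R y n)) \<le> \<bar>blinfun_apply \<phi> (y n)\<bar>"
          using t(1,2)[of n] mult_left_le_one_le[of "\<bar>blinfun_apply \<phi> (y n)\<bar>" "t n"]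
          by (simp add: blinfun.scaleR_right abs_mult)
      qed
      show "(\<lambda>n. \<bar>blinfun_apply \<phi> (y n)\<bar>) \<longlonglongrightarrow> 0"
        using tendsto_rabs[OF wk[of \<phi>]] \<open>u = 0\<close> by (simp add: blinfun.zero_right)
    qed
    from strong_weak[OF f_compact[OF this]] have "(\<lambda>n. F (y n)) \<longlonglongrightarrow> 0"
      using t(3) \<open>u = 0\<close> by (simp add: blinfun.zero_right)
    then have "\<epsilon> \<le> 0" by (rule LIMSEQ_le_const) (use y(3) in auto)
    with B0(2) show False by simp
  qed
  have eqn: "blinfun_apply (A (y n)) v = multiplier (y n) * blinfun_apply (f (y n)) v" if "v \<in> ?V (r n)" for n v
    by (rule critical_on_multiplier[OF y(5,2,6) that])
  have "bounded (A ` cball 0 R)" by (rule A_bounded) simp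
  then obtain CA where "\<forall>\<psi>\<in>A ` cball 0 R. norm \<psi> \<le> CA"
    unfolding bounded_iff by blast
  then have CA: "norm (A (y n)) \<le> CA" for n using y(7)[of n] by simp
  have "CA \<ge> 0" using CA[of 0] norm_ge_zero[of "A (y 0)"] by linarith
  have fyu: "(\<lambda>n. blinfun_apply (f (y n)) (y n)) \<longlonglongrightarrow> blinfun_apply (f u) u" by (rule strong_weak[OF fy])
  let ?a = "blinfun_apply (f u) u"
  have "?a > 0" by (rule f_pos) fact
  define Cm where "Cm = CA * R / (?a / 2)"
  have mult_bd: "eventually (\<lambda>n. \<bar>multiplier (y n)\<bar> \<le> Cm) sequentially"
  proof -
    have "eventually (\<lambda>n. blinfun_apply (f (y n)) (y n) > ?a / 2) sequentially"
      by (rule order_tendstoD(1)[OF fyu]) (use \<open>?a > 0\<close> in simp)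
    then show ?thesis
    proof eventually_elim
      case (elim n)
      have "\<bar>blinfun_apply (A (y n)) (y n)\<bar> \<le> norm (A (y n)) * norm (y n)"
        using norm_blinfun[of "A (y n)" "y n"] by simp
      also have "\<dots> \<le> CA * R"
        using CA[of n] y(7)[of n] \<open>CA \<ge> 0\<close> by (intro mult_mono) auto
      finally show ?case
        unfolding multiplier_def Cm_def abs_divide
        using elim \<open>?a > 0\<close> by (intro frac_le) auto
    qed
  qed
  have "Cm \<ge> 0" using eventually_happens[OF mult_bd] by (auto intro: order_trans[OF abs_ge_zero])
  \<comment> \<open>The limit \<open>u\<close> is approximated by a vector \<open>z\<close> of some subspace, and there \<open>A (y n)\<close> is a bounded
    multiple of the convergent sequence \<open>f (y n)\<close>.\<close>
  have small: "(\<lambda>n. blinfun_apply (A (y n)) (y n - u)) \<longlonglongrightarrow> 0"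
  proof (rule LIMSEQ_I)
    fix \<delta> :: real assume "\<delta> > 0"
    define C where "C = CA + Cm * (norm (f u) + 1)"
    have "C \<ge> 0" unfolding C_def using \<open>CA \<ge> 0\<close> \<open>Cm \<ge> 0\<close> by simp
    have "\<delta> / 2 * C / (C + 1) < \<delta> / 2"
      using \<open>C \<ge> 0\<close> \<open>\<delta> > 0\<close> by (simp add: field_simps)
    then have "\<exists>s>0. CA * s + Cm * s * (norm (f u) + 1) < \<delta> / 2"
      using \<open>C \<ge> 0\<close> \<open>\<delta> > 0\<close>
      by (intro exI[of _ "\<delta> / 2 / (C + 1)"]) (simp add: C_def algebra_simps add_divide_distrib)
    then obtain s where s: "s > 0" "CA * s + Cm * s * (norm (f u) + 1) < \<delta> / 2" by blast
    obtain z where z: "z \<in> ?W" "dist z u < s" using uW s(1) unfolding closure_approachable by blast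
    obtain k where k: "z \<in> ?V k" using z(1) by blast
    have fz: "(\<lambda>n. blinfun_apply (f (y n)) (y n - u)) \<longlonglongrightarrow> 0"
      using tendsto_diff[OF fyu blinfun.tendsto[OF fy tendsto_const[of u]]] by (simp add: blinfun.diff_right)
    have "eventually (\<lambda>n. \<bar>Cm * blinfun_apply (f (y n)) (y n - u)\<bar> < \<delta> / 2) sequentially"
      using order_tendstoD(2)[OF tendsto_rabs[OF tendsto_mult_right_zero[OF fz, of Cm]], of "\<delta> / 2"] \<open>\<delta> > 0\<close> by simp
    moreover have "eventually (\<lambda>n. norm (f (y n)) < norm (f u) + 1) sequentially"
      by (rule order_tendstoD(2)[OF tendsto_norm[OF fy]]) simp
    moreover have "eventually (\<lambda>n. n \<ge> k) sequentially" by (rule eventually_ge_at_top)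
    ultimately have "eventually (\<lambda>n. norm (blinfun_apply (A (y n)) (y n - u) - 0) < \<delta>) sequentially"
      using mult_bd
    proof eventually_elim
      case (elim n)
      have "k \<le> r n" using elim(3) seq_suble[OF r, of n] by simp
      then have zV: "z \<in> ?V (r n)" using k incseqD[OF incV] by blast
      let ?m = "multiplier (y n)"
      have zu: "norm (z - u) \<le> s" using z(2) by (simp add: dist_norm)
      have "blinfun_apply (A (y n)) (y n - u) = blinfun_apply (A (y n)) (y n - z) + blinfun_apply (A (y n)) (z - u)"
        by (simp add: blinfun.diff_right)
      also have "blinfun_apply (A (y n)) (y n - z) = ?m * blinfun_apply (f (y n)) (y n - z)"
        by (intro eqn span_diff y(2) zV)
      also have "\<dots> = ?m * blinfun_apply (f (y n)) (y n - u) - ?m * blinfun_apply (f (y n)) (z - u)"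
        by (simp add: blinfun.diff_right algebra_simps)
      finally have dec: "blinfun_apply (A (y n)) (y n - u) =
        ?m * blinfun_apply (f (y n)) (y n - u) - ?m * blinfun_apply (f (y n)) (z - u) + blinfun_apply (A (y n)) (z - u)" .
      have 1: "\<bar>?m * blinfun_apply (f (y n)) (y n - u)\<bar> \<le> \<bar>Cm * blinfun_apply (f (y n)) (y n - u)\<bar>"
        using elim(4) by (simp add: abs_mult mult_right_mono)
      have 2: "\<bar>?m * blinfun_apply (f (y n)) (z - u)\<bar> \<le> Cm * s * (norm (f u) + 1)"
      proof -
        have "\<bar>blinfun_apply (f (y n)) (z - u)\<bar> \<le> norm (f (y n)) * norm (z - u)"
          using norm_blinfun[of "f (y n)" "z - u"] by simp
        also have "\<dots> \<le> (norm (f u) + 1) * s" using elim(2) zu by (intro mult_mono) auto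
        finally have "\<bar>?m\<bar> * \<bar>blinfun_apply (f (y n)) (z - u)\<bar> \<le> Cm * ((norm (f u) + 1) * s)"
          using elim(4) \<open>Cm \<ge> 0\<close> by (intro mult_mono) auto
        then show ?thesis by (simp add: abs_mult mult_ac)
      qed
      have 3: "\<bar>blinfun_apply (A (y n)) (z - u)\<bar> \<le> CA * s"
      proof -
        have "\<bar>blinfun_apply (A (y n)) (z - u)\<bar> \<le> norm (A (y n)) * norm (z - u)"
          using norm_blinfun[of "A (y n)" "z - u"] by simp
        also have "\<dots> \<le> CA * s" using CA zu \<open>CA \<ge> 0\<close> by (intro mult_mono) auto
        finally show ?thesis .
      qed
      show ?case using dec 1 2 3 elim(1) s(2) by (simp add: abs_le_iff abs_less_iff)
    qed
    then show "\<exists>N. \<forall>n\<ge>N. norm (blinfun_apply (A (y n)) (y n - u) - 0) < \<delta>"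
      by (simp add: eventually_sequentially)
  qed
  obtain q where q: "strict_mono q" "(y \<circ> q) \<longlonglongrightarrow> u"
    using A_compact[of y u] weak small by (auto simp: y_def)
  define z where "z = y \<circ> q"
  have zu: "z \<longlonglongrightarrow> u" using q(2) by (simp add: z_def)
  have idx: "z n \<in> M" "\<epsilon> \<le> F (z n)" "F (z n) \<le> d" for n using y by (simp_all add: z_def)
  have lim_I: "(\<lambda>n. I (z n)) \<longlonglongrightarrow> I u" and lim_F: "(\<lambda>n. F (z n)) \<longlonglongrightarrow> F u"
    using continuous_I[of UNIV] continuous_F[of UNIV] zu
    by (auto simp: continuous_on_eq_continuous_at intro: isCont_tendsto_compose)
  have "I (z n) = 1" for n using idx(1) by (simp add: unit_level_def)
  then have "I u = 1" using LIMSEQ_unique[OF lim_I] by simp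
  then have uM: "u \<in> M" by (simp add: unit_level_def)
  have Fd: "F u \<le> d" by (rule LIMSEQ_le_const2[OF lim_F]) (use idx(3) in auto)
  have res: "(\<lambda>n. residual (z n)) \<longlonglongrightarrow> residual u" by (rule continuous_residual[OF \<open>u \<noteq> 0\<close> zu])
  have zero: "blinfun_apply (residual u) v = 0" if v: "v \<in> ?W" for v
  proof -
    obtain k where k: "v \<in> ?V k" using v by blast
    have "eventually (\<lambda>n. blinfun_apply (residual (z n)) v = 0) sequentially"
      using eventually_ge_at_top[of k]
    proof eventually_elim
      case (elim n)
      have "k \<le> r (q n)" using elim seq_suble[OF r, of "q n"] seq_suble[OF q(1), of n] by simp
      then have "v \<in> ?V (r (q n))" using k incseqD[OF incV] by blast
      then show ?case using eqn by (simp add: residual_def z_def blinfun.diff_left blinfun.scaleR_left)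
    qed
    then have "(\<lambda>n. blinfun_apply (residual (z n)) v) \<longlonglongrightarrow> 0" by (rule tendsto_eventually)
    with blinfun.tendsto[OF res tendsto_const[of v]] show ?thesis by (rule LIMSEQ_unique)
  qed
  \<comment> \<open>The almost norming vector for the residual of \<open>z n\<close> lies in a later subspace, where the residual of
    the limit vanishes.\<close>
  have "norm (residual (z n)) \<le> 2 * norm (residual (z n) - residual u)" for n
  proof -
    let ?v = "vec (residual (z n))"
    have "?v \<in> Bs (Suc (r (q n)))" by (simp add: Bs_Suc z_def y_def x_def)
    then have "?v \<in> ?W" using span_base by blast
    then have "blinfun_apply (residual (z n)) ?v = blinfun_apply (residual (z n) - residual u) ?v"
      using zero by (simp add: blinfun.diff_left)
    also have "\<bar>\<dots>\<bar> \<le> norm (residual (z n) - residual u) * norm ?v"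
      using norm_blinfun[of "residual (z n) - residual u" ?v] by simp
    also have "\<dots> \<le> norm (residual (z n) - residual u)"
      using vec(1)[of "residual (z n)"] by (simp add: mult_left_le)
    finally show ?thesis using vec(2)[of "residual (z n)"] by linarith
  qed
  then have "eventually (\<lambda>n. norm (residual (z n)) \<le> 2 * norm (residual (z n) - residual u)) sequentially"
    by simp
  moreover have "(\<lambda>n. 2 * norm (residual (z n) - residual u)) \<longlonglongrightarrow> 0"
    by (rule tendsto_mult_right_zero[OF tendsto_norm_zero[OF LIM_zero[OF res]]])
  ultimately have "(\<lambda>n. residual (z n)) \<longlonglongrightarrow> 0" by (rule Lim_null_comparison)
  with res have "residual u = 0" by (rule LIMSEQ_unique)
  then have "A u = multiplier u *\<^sub>R f u" by (simp add: residual_def)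
  moreover have "multiplier u > 0"
    using A_pos[OF \<open>u \<noteq> 0\<close>] f_pos[OF \<open>u \<noteq> 0\<close>] by (simp add: multiplier_def)
  ultimately show ?thesis using that uM Fd by blast
qed

end

section \<open>Rescaling eigenvectors to solutions\<close>

lemma potential_scaling:
  assumes "scaling_homogeneous S s g" "is_scaling \<sigma> S" "t \<ge> 0"
  shows "potential g (S u t) = t powr s * potential g u"
proof -
  have "blinfun_apply (g (\<tau> *\<^sub>R S u t)) (S u t) = t powr s * blinfun_apply (g (\<tau> *\<^sub>R u)) u" for \<tau>
  proof -
    have "\<tau> *\<^sub>R S u t = S (\<tau> *\<^sub>R u) t" using assms(2,3) by (simp add: is_scaling_def)
    then show ?thesis using assms(1,3) by (simp add: scaling_homogeneous_def)
  qed
  then show ?thesis by (simp add: potential_def)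
qed

lemma scaling_inverse:
  assumes "is_scaling \<sigma> S" "t > 0"
  shows "S (S u (1 / t)) t = u" "S (S u t) (1 / t) = u"
proof -
  have comp: "S (S u a) b = S u (a * b)" if "a \<ge> 0" "b \<ge> 0" for a b
    using assms(1) that by (simp add: is_scaling_def)
  have "S u 1 = u" using assms(1) by (simp add: is_scaling_def)
  then show "S (S u (1 / t)) t = u" "S (S u t) (1 / t) = u" using comp assms(2) by simp_all
qed

text \<open>
  Testing with \<open>S w t\<close>, which is an arbitrary vector, multiplies the two sides of \<open>A u = \<mu> f u\<close> by
  \<open>t powr \<sigma>\<close> and \<open>t powr \<gamma>\<close>; the value of \<open>t\<close> is the one that absorbs \<open>\<mu>\<close>.
\<close>

lemma rescaled_solution:
  fixes S :: "'a::real_normed_vector \<Rightarrow> real \<Rightarrow> 'a"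
  assumes S: "is_scaling \<sigma> S" and A: "scaling_homogeneous S \<sigma> A" and f: "scaling_homogeneous S \<gamma> f"
    and "\<gamma> \<noteq> \<sigma>" "\<mu> > 0" "A u = \<mu> *\<^sub>R f u" "u \<noteq> 0"
  defines "t \<equiv> \<mu> powr (- 1 / (\<sigma> - \<gamma>))"
  shows "S u t \<noteq> 0" "A (S u t) = f (S u t)" "t powr \<gamma> = \<mu> * t powr \<sigma>" "t powr \<sigma> = \<mu> powr (- \<sigma> / (\<sigma> - \<gamma>))"
proof -
  have "t > 0" using \<open>\<mu> > 0\<close> by (simp add: t_def)
  have "t powr (\<sigma> - \<gamma>) = \<mu> powr (- 1)"
    using \<open>\<gamma> \<noteq> \<sigma>\<close> by (simp add: t_def powr_powr)
  then have "t powr \<sigma> / t powr \<gamma> = 1 / \<mu>"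
    using \<open>\<mu> > 0\<close> by (simp add: powr_diff powr_minus_divide)
  then show pw: "t powr \<gamma> = \<mu> * t powr \<sigma>" using \<open>\<mu> > 0\<close> \<open>t > 0\<close> by (simp add: field_simps)
  show "t powr \<sigma> = \<mu> powr (- \<sigma> / (\<sigma> - \<gamma>))" by (simp add: t_def powr_powr)
  have "S (0 *\<^sub>R 0) (1 / t) = 0 *\<^sub>R S 0 (1 / t)"
    using S \<open>t > 0\<close> unfolding is_scaling_def by (metis less_eq_real_def zero_less_divide_1_iff)
  then show "S u t \<noteq> 0" using scaling_inverse(2)[OF S \<open>t > 0\<close>, of u] \<open>u \<noteq> 0\<close> by auto
  show "A (S u t) = f (S u t)"
  proof (rule blinfun_eqI)
    fix v
    let ?w = "S v (1 / t)"
    have v: "S ?w t = v" by (rule scaling_inverse(1)[OF S \<open>t > 0\<close>])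
    have "blinfun_apply (A (S u t)) (S ?w t) = t powr \<sigma> * blinfun_apply (A u) ?w"
      "blinfun_apply (f (S u t)) (S ?w t) = t powr \<gamma> * blinfun_apply (f u) ?w"
      using A f \<open>t > 0\<close> by (simp_all add: scaling_homogeneous_def)
    then show "blinfun_apply (A (S u t)) v = blinfun_apply (f (S u t)) v"
      by (simp add: v \<open>A u = \<mu> *\<^sub>R f u\<close> blinfun.scaleR_left pw)
  qed
qed

theorem theorem3p8:
  fixes S :: "'a::banach \<Rightarrow> real \<Rightarrow> 'a"
    and \<sigma> \<gamma> :: real
    and A f :: "'a \<Rightarrow> 'a \<Rightarrow>\<^sub>L real"
  assumes reflexive: "reflexive_space TYPE('a)"
    and infinite_dim: "infinite_dimensional TYPE('a)"
    and scaling: "is_scaling \<sigma> S"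
    and A_scaled: "scaled_operator S \<sigma> A"
    and A6: "\<And>u. u \<noteq> 0 \<Longrightarrow> blinfun_apply (A u) u > 0"
    and A7: "\<And>u l. weakly_converges u l \<Longrightarrow>
               (\<lambda>j. blinfun_apply (A (u j)) (u j - l)) \<longlonglongrightarrow> 0 \<Longrightarrow>
               \<exists>r :: nat \<Rightarrow> nat. strict_mono r \<and> (u \<circ> r) \<longlonglongrightarrow> l"
    and A10: "filterlim (potential A) at_top at_infinity"
    and f_op: "odd_bounded_potential_operator f"
    and f1: "\<gamma> \<noteq> \<sigma>" "scaling_homogeneous S \<gamma> f"
    and f2: "\<And>u. u \<noteq> 0 \<Longrightarrow> blinfun_apply (f u) u > 0"
    and f3: "\<And>u l. weakly_converges u l \<Longrightarrow> (\<lambda>j. f (u j)) \<longlonglongrightarrow> f l"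
    and f4: "\<And>(\<mu>::real) u. A u = \<mu> *\<^sub>R f u \<Longrightarrow> \<sigma> * potential A u = \<gamma> * \<mu> * potential f u"
  shows "\<exists>(u :: nat \<Rightarrow> 'a) (\<mu> :: nat \<Rightarrow> real) (ubar :: nat \<Rightarrow> 'a).
    (\<forall>k. u k \<in> unit_level A) \<and>
    (\<forall>k. \<mu> k > 0) \<and> incseq \<mu> \<and> filterlim \<mu> at_top sequentially \<and>
    (\<forall>k. ubar k = S (u k) (\<mu> k powr (- 1 / (\<sigma> - \<gamma>)))) \<and>
    (\<forall>k. ubar k \<noteq> 0 \<and> A (ubar k) = f (ubar k)) \<and>
    (\<forall>k. energy A f (ubar k) = (1 - \<sigma> / \<gamma>) * \<mu> k powr (- \<sigma> / (\<sigma> - \<gamma>))) \<and>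
    (\<gamma> < \<sigma> \<longrightarrow>
      (\<forall>k. energy A f (ubar k) < 0) \<and>
      incseq (\<lambda>k. energy A f (ubar k)) \<and>
      (\<lambda>k. energy A f (ubar k)) \<longlonglongrightarrow> 0) \<and>
    (\<gamma> > \<sigma> \<longrightarrow>
      (\<forall>k. energy A f (ubar k) > 0) \<and>
      incseq (\<lambda>k. energy A f (ubar k)) \<and>
      filterlim (\<lambda>k. energy A f (ubar k)) at_top sequentially)"
proof -
  have homA: "scaling_homogeneous S \<sigma> A" and opA: "odd_bounded_potential_operator A"
    using A_scaled by (auto simp: scaled_operator_def)
  have "\<sigma> > 0" using scaling by (simp add: is_scaling_def)
  interpret compact_variational_pair A f
  proof
    show "potential_operator A" "\<And>u. A (- u) = - A u" "\<And>B. bounded B \<Longrightarrow> bounded (A ` B)"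
      "potential_operator f" "\<And>u. f (- u) = - f u"
      using opA f_op by (auto simp: odd_bounded_potential_operator_def)
  qed (fact A6 A10 f2 reflexive infinite_dim A7 f3)+
  have mult: "\<gamma> * \<mu> * F u = \<sigma>" if "u \<in> M" "A u = \<mu> *\<^sub>R f u" for u \<mu>
    using f4[OF that(2)] that(1) by (simp add: unit_level_def)
  have "\<gamma> > 0"
  proof -
    obtain u \<mu> where u: "u \<in> M" "\<mu> > 0" "A u = \<mu> *\<^sub>R f u"
      by (rule exists_critical_point_below[of 1]) (simp, rule that)
    have "\<mu> * F u > 0" using u(2) F_pos[OF M_nonzero[OF u(1)]] by simp
    moreover have "\<gamma> * (\<mu> * F u) > 0" using mult[OF u(1,3)] \<open>\<sigma> > 0\<close> by (simp add: mult.assoc)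
    ultimately show ?thesis using zero_less_mult_pos2 by blast
  qed
  have "\<exists>u \<mu>. u \<in> M \<and> \<mu> > K \<and> A u = \<mu> *\<^sub>R f u" for K
  proof -
    define c where "c = \<bar>K\<bar> + 1"
    have "c > 0" "c > K" by (auto simp: c_def)
    let ?d = "\<sigma> / (\<gamma> * c)"
    have "?d > 0" using \<open>\<sigma> > 0\<close> \<open>\<gamma> > 0\<close> \<open>c > 0\<close> by simp
    then obtain u \<mu> where u: "u \<in> M" "F u \<le> ?d" "\<mu> > 0" "A u = \<mu> *\<^sub>R f u"
      by (rule exists_critical_point_below)
    have "\<sigma> = \<gamma> * \<mu> * F u" using mult[OF u(1,4)] by simp
    also have "\<dots> \<le> \<gamma> * \<mu> * ?d" using \<open>\<gamma> > 0\<close> u(2,3) by (intro mult_left_mono) auto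
    finally have "c \<le> \<mu>" using \<open>\<sigma> > 0\<close> \<open>\<gamma> > 0\<close> \<open>c > 0\<close> by (simp add: field_simps)
    then have "\<mu> > K" using \<open>c > K\<close> by linarith
    with u show ?thesis by blast
  qed
  then obtain U m where Um: "\<And>K. U K \<in> M" "\<And>K. m K > K" "\<And>K. A (U K) = m K *\<^sub>R f (U K)" by metis
  \<comment> \<open>Each threshold exceeds both the previous eigenvalue and its own index.\<close>
  define K where "K = rec_nat 0 (\<lambda>n k. max (m k) (real (Suc n)))"
  have K_Suc: "K (Suc n) = max (m (K n)) (real (Suc n))" for n by (simp add: K_def)
  have K_ge: "real n \<le> K n" for n by (cases n) (simp_all add: K_def)
  define u where "u n = U (K n)" for n
  define \<mu> where "\<mu> n = m (K n)" for n
  have uM: "u n \<in> M" and eq: "A (u n) = \<mu> n *\<^sub>R f (u n)" for n by (simp_all add: u_def \<mu>_def Um)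
  have \<mu>_ge: "real n < \<mu> n" for n using K_ge[of n] Um(2)[of "K n"] by (simp add: \<mu>_def)
  have \<mu>_pos: "\<mu> n > 0" for n using \<mu>_ge[of n] by linarith
  have inc: "incseq \<mu>"
  proof (rule incseq_SucI)
    fix n
    have "\<mu> n \<le> K (Suc n)" by (simp add: \<mu>_def K_Suc)
    also have "\<dots> \<le> \<mu> (Suc n)" using Um(2) by (simp add: \<mu>_def less_imp_le)
    finally show "\<mu> n \<le> \<mu> (Suc n)" .
  qed
  have top: "filterlim \<mu> at_top sequentially"
    by (rule filterlim_at_top_mono[OF filterlim_real_sequentially]) (use \<mu>_ge in \<open>auto intro!: always_eventually less_imp_le\<close>)
  define t where "t n = \<mu> n powr (- 1 / (\<sigma> - \<gamma>))" for n
  define ubar where "ubar n = S (u n) (t n)" for n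
  note resc = rescaled_solution[OF scaling homA f1(2,1) \<mu>_pos eq M_nonzero[OF uM], folded t_def]
  let ?p = "- \<sigma> / (\<sigma> - \<gamma>)"
  have energy: "energy A f (ubar n) = (1 - \<sigma> / \<gamma>) * \<mu> n powr ?p" for n
  proof -
    have "t n \<ge> 0" by (simp add: t_def)
    have "I (u n) = 1" using uM by (simp add: unit_level_def)
    then have "energy A f (ubar n) = t n powr \<sigma> - t n powr \<gamma> * F (u n)"
      by (simp add: energy_def ubar_def potential_scaling[OF homA scaling \<open>t n \<ge> 0\<close>]
          potential_scaling[OF f1(2) scaling \<open>t n \<ge> 0\<close>])
    also have "t n powr \<gamma> * F (u n) = t n powr \<sigma> * (\<mu> n * F (u n))" by (simp add: resc(3))
    also have "\<mu> n * F (u n) = \<sigma> / \<gamma>"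
      using mult[OF uM eq, of n] \<open>\<gamma> > 0\<close> by (simp add: field_simps)
    finally show ?thesis by (simp add: resc(4) algebra_simps)
  qed
  have sub: "(\<forall>k. energy A f (ubar k) < 0) \<and> incseq (\<lambda>k. energy A f (ubar k)) \<and>
      (\<lambda>k. energy A f (ubar k)) \<longlonglongrightarrow> 0" if "\<gamma> < \<sigma>"
  proof -
    have c: "1 - \<sigma> / \<gamma> < 0" and p: "?p < 0"
      using that \<open>\<gamma> > 0\<close> \<open>\<sigma> > 0\<close> by (simp_all add: field_simps)
    have "(\<lambda>k. (1 - \<sigma> / \<gamma>) * \<mu> k powr ?p) \<longlonglongrightarrow> 0"
      by (intro tendsto_mult_right_zero tendsto_neg_powr[OF p top])
    moreover have "incseq (\<lambda>k. (1 - \<sigma> / \<gamma>) * \<mu> k powr ?p)"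
    proof (rule incseq_SucI)
      fix n
      have "\<mu> (Suc n) powr ?p \<le> \<mu> n powr ?p"
        using p \<mu>_pos incseq_SucD[OF inc] by (intro powr_mono2') auto
      then show "(1 - \<sigma> / \<gamma>) * \<mu> n powr ?p \<le> (1 - \<sigma> / \<gamma>) * \<mu> (Suc n) powr ?p"
        using c by (intro mult_left_mono_neg) auto
    qed
    moreover have "(1 - \<sigma> / \<gamma>) * \<mu> k powr ?p < 0" for k
      using c \<mu>_pos[of k] by (intro mult_neg_pos) auto
    ultimately show ?thesis unfolding energy by blast
  qed
  have super: "(\<forall>k. energy A f (ubar k) > 0) \<and> incseq (\<lambda>k. energy A f (ubar k)) \<and>
      filterlim (\<lambda>k. energy A f (ubar k)) at_top sequentially" if "\<gamma> > \<sigma>"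
  proof -
    have c: "1 - \<sigma> / \<gamma> > 0" using that \<open>\<gamma> > 0\<close> by (simp add: field_simps)
    have p: "?p > 0" using that \<open>\<sigma> > 0\<close> by (intro divide_neg_neg) simp_all
    have "filterlim (\<lambda>k. \<mu> k powr ?p) at_top sequentially"
    proof -
      have "filterlim (\<lambda>k. exp (?p * ln (\<mu> k))) at_top sequentially"
        by (intro filterlim_compose[OF exp_at_top] filterlim_tendsto_pos_mult_at_top[OF tendsto_const p]
            filterlim_compose[OF ln_at_top top])
      then show ?thesis using \<mu>_pos by (simp add: powr_def less_imp_neq[symmetric])
    qed
    then have "filterlim (\<lambda>k. (1 - \<sigma> / \<gamma>) * \<mu> k powr ?p) at_top sequentially"
      by (rule filterlim_tendsto_pos_mult_at_top[OF tendsto_const c])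
    moreover have "incseq (\<lambda>k. (1 - \<sigma> / \<gamma>) * \<mu> k powr ?p)"
    proof (rule incseq_SucI)
      fix n
      have "\<mu> n powr ?p \<le> \<mu> (Suc n) powr ?p"
        using p less_imp_le[OF \<mu>_pos[of n]] incseq_SucD[OF inc] by (intro powr_mono2) auto
      then show "(1 - \<sigma> / \<gamma>) * \<mu> n powr ?p \<le> (1 - \<sigma> / \<gamma>) * \<mu> (Suc n) powr ?p"
        using c by (intro mult_left_mono) auto
    qed
    moreover have "(1 - \<sigma> / \<gamma>) * \<mu> k powr ?p > 0" for k
      using c \<mu>_pos[of k] by (intro mult_pos_pos) auto
    ultimately show ?thesis unfolding energy by blast
  qed
  have "ubar k = S (u k) (\<mu> k powr (- 1 / (\<sigma> - \<gamma>)))" for k by (simp add: ubar_def t_def)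
  moreover have "ubar k \<noteq> 0" "A (ubar k) = f (ubar k)" for k
    unfolding ubar_def by (rule resc(1), rule resc(2))
  ultimately show ?thesis
    using uM \<mu>_pos inc top energy sub super by (intro exI[of _ u] exI[of _ \<mu>] exI[of _ ubar]) blast
qed

end
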